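(* In the algorithm setup, assume Property (P1). Then, with $n=|V|$ and $\alpha=d/r$ (so $|E|=\alpha n$), $$\frac{1}{\alpha n}\sum_{a\in E}\mathbb E\big[f(\mathbf z^L_{\partial a})\big]=\hat f(\emptyset)+\frac{r}{\sqrt d}\sum_{\ell=0}^{L-1}\Big(\frac1n\sum_{i\in V}\mathbb E\big[A_i^\ell\,(u_i^{\ell+1})^2\big]\Big)+O_d\Big(\frac1d\Big).$$
   Context: Algorithm setup. Fix $r\ge2$ and a predicate $f:\{\pm1\}^r\to\{0,1\}$, identified with its multilinear extension $f(x)=\sum_{S\subseteq[r]}\hat f(S)\prod_{\iota\in S}x_\iota$ on $\mathbb R^r$, and assume $\hat f(S)=0$ whenever $|S|=1$. Let $\xi(s)=\sum_{j=1}^r\big(\sum_{|S|=j}\hat f(S)^2\big)s^j$. Fix $\delta>0$, let $L=\lfloor1/\delta\rfloor$, and for $\ell\ge1$ let $\nu_\ell=\big(\xi'(\ell\delta)-\xi'((\ell-1)\delta)\big)/r$. Let $G=(V,E)$ be a hypergraph whose hyperedges (factors) $a$ are ordered $r$-tuples $\partial a=(v_{a,1},\dots,v_{a,r})$ of distinct vertices (variables), which is $d$-index-regular: every variable lies in exactly $d$ factors, and for each $\iota\in[r]$ it is the $\iota$-th entry of exactly $d/r$ factors. Write $\partial i$ for the set of factors containing $i$. Assume the bipartite variable–factor incidence graph (factor graph) of $G$ has no cycle of length less than $4L+4$. For a factor $a$ and $j\in\partial a$, $\mathsf D_{j;a}f$ is the partial derivative of (multilinear) $f$ in the coordinate $\iota$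 with $v_{a,\iota}=j$ (it does not depend on that coordinate). Fix $K>0$ and functions $F_{\to,\ell},F_\ell:\mathbb R^\ell\to[-K,K]$ for $0\le\ell\le L-1$ (constants when $\ell=0$). Randomness: $z_i^0$, $i\in V$, i.i.d. $\mathcal N(0,\delta)$; set $z^0_{i\to a}=z_i^0$, $w_i^0=w^0_{i\to a}=0$. For $\ell=0,\dots,L-1$: $A^\ell_{i\to a}=F_{\to,\ell}(u^1_{i\to a},\dots,u^\ell_{i\to a})$, $A^\ell_i=F_\ell(u^1_i,\dots,u^\ell_i)$; with $\mathbf z^\ell_{\partial b\to b}=(z^\ell_{v_{b,1}\to b},\dots,z^\ell_{v_{b,r}\to b})$, $w^{\ell+1}_{i\to a}=(d-1)^{-1/2}\sum_{b\in\partial i\setminus a}\mathsf D_{i;b}f(\mathbf z^\ell_{\partial b\to b})$, $u^{\ell+1}_{i\to a}=w^{\ell+1}_{i\to a}-w^\ell_{i\to a}$, $z^{\ell+1}_{i\to a}=z_i^0+\sum_{s=1}^{\ell+1}A^{s-1}_{i\to a}u^s_{i\to a}$; $w^{\ell+1}_i=d^{-1/2}\sum_{b\in\partial i}\mathsf D_{i;b}f(\mathbf z^\ell_{\partial b\to b})$, $u^{\ell+1}_i=w^{\ell+1}_i-w^\ell_i$, $z^{\ell+1}_i=z_i^0+\sum_{s=1}^{\ell+1}A^{s-1}_iu^s_i$. Also $\mathbf z^\ell_{\partial a}=(z^\ell_{v_{a,1}},\dots,z^\ell_{v_{a,r}})$. Asymptotics: $r,f,\delta,L,K$ are fixed and $d\to\infty$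 along such hypergraphs (nonlinearities may depend on $d$); $O_d(g(d))$ denotes a quantity bounded in absolute value by $C g(d)$ with $C$ independent of $d$, of the hypergraph and of the chosen variables/factors; $o_d(1)$ denotes a quantity tending to $0$ as $d\to\infty$ in the same uniform sense; $\mathrm{plim}$ is limit in probability. Property (P1): for all $0\le\ell\le L-1$, variables $i$, factors $a\in\partial i$, $m\in\mathbb N$: $\mathbb E|A^\ell_i-A^\ell_{i\to a}|^m=O_d(d^{-m/2})$. Property (P2): for all such $\ell,i,a$: $\mathbb E[(A^\ell_i)^2]=\mathbb E[(A^\ell_{i\to a})^2]=\delta/\nu_{\ell+1}$. *)

theory Defs
  imports "HOL-Probability.Probability"
begin

definition cube :: "nat \<Rightarrow> (nat \<Rightarrow> real) set" where
  "cube r = PiE {..<r} (\<lambda>_. {-1, 1})"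

definition fhat :: "((nat \<Rightarrow> real) \<Rightarrow> real) \<Rightarrow> nat \<Rightarrow> nat set \<Rightarrow> real" where
  "fhat f r S = (\<Sum>x\<in>cube r. f x * (\<Prod>\<iota>\<in>S. x \<iota>)) / 2 ^ r"

definition mlext :: "((nat \<Rightarrow> real) \<Rightarrow> real) \<Rightarrow> nat \<Rightarrow> (nat \<Rightarrow> real) \<Rightarrow> real" where
  "mlext f r y = (\<Sum>S\<in>Pow {..<r}. fhat f r S * (\<Prod>\<iota>\<in>S. y \<iota>))"

definition mlderiv :: "((nat \<Rightarrow> real) \<Rightarrow> real) \<Rightarrow> nat \<Rightarrow> nat \<Rightarrow> (nat \<Rightarrow> real) \<Rightarrow> real" where
  "mlderiv f r \<iota> y = (\<Sum>S\<in>{S\<in>Pow {..<r}. \<iota> \<in> S}. fhat f r S * (\<Prod>\<kappa>\<in>S - {\<iota>}. y \<kappa>))"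

text \<open>Vertices and factors are natural numbers; factor a has entries vtx a 0, ..., vtx a (r-1).\<close>
definition fac :: "nat \<Rightarrow> nat set \<Rightarrow> (nat \<Rightarrow> nat \<Rightarrow> nat) \<Rightarrow> nat \<Rightarrow> nat set" where
  "fac r E vtx i = {a\<in>E. \<exists>\<iota><r. vtx a \<iota> = i}"

definition idx :: "nat \<Rightarrow> (nat \<Rightarrow> nat \<Rightarrow> nat) \<Rightarrow> nat \<Rightarrow> nat \<Rightarrow> nat" where
  "idx r vtx a j = (THE \<iota>. \<iota> < r \<and> vtx a \<iota> = j)"

definition Dpart :: "((nat \<Rightarrow> real) \<Rightarrow> real) \<Rightarrow> nat \<Rightarrow> (nat \<Rightarrow> nat \<Rightarrow> nat) \<Rightarrow> nat \<Rightarrow> nat \<Rightarrow> (nat \<Rightarrow> real) \<Rightarrow> real" where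
  "Dpart f r vtx a j y = mlderiv f r (idx r vtx a j) y"

definition index_regular :: "nat \<Rightarrow> nat \<Rightarrow> nat set \<Rightarrow> nat set \<Rightarrow> (nat \<Rightarrow> nat \<Rightarrow> nat) \<Rightarrow> bool" where
  "index_regular r d V E vtx \<longleftrightarrow>
     finite V \<and> finite E \<and>
     (\<forall>a\<in>E. \<forall>\<iota><r. vtx a \<iota> \<in> V) \<and>
     (\<forall>a\<in>E. inj_on (vtx a) {..<r}) \<and>
     (\<forall>i\<in>V. card (fac r E vtx i) = d) \<and>
     (\<forall>i\<in>V. \<forall>\<iota><r. card {a\<in>E. vtx a \<iota> = i} * r = d)"

text \<open>A cycle of length 2k (k >= 2) in the bipartite variable-factor incidence graph:
  distinct variables i_0..i_{k-1}, distinct factors a_0..a_{k-1}, with i_j and i_{j+1 mod k}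
  both in a_j.\<close>
definition has_cycle_of_length :: "nat \<Rightarrow> nat set \<Rightarrow> (nat \<Rightarrow> nat \<Rightarrow> nat) \<Rightarrow> nat \<Rightarrow> bool" where
  "has_cycle_of_length r E vtx len \<longleftrightarrow>
     (\<exists>k is as. len = 2 * k \<and> 2 \<le> k \<and> length is = k \<and> length as = k \<and>
        distinct is \<and> distinct as \<and> set as \<subseteq> E \<and>
        (\<forall>j<k. is ! j \<in> vtx (as ! j) ` {..<r} \<and> is ! ((j + 1) mod k) \<in> vtx (as ! j) ` {..<r}))"

definition girth_ge :: "nat \<Rightarrow> nat set \<Rightarrow> (nat \<Rightarrow> nat \<Rightarrow> nat) \<Rightarrow> nat \<Rightarrow> bool" where
  "girth_ge r E vtx g \<longleftrightarrow> (\<forall>len < g. \<not> has_cycle_of_length r E vtx len)"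

text \<open>For a history ws = [w^0,...,w^l] of one variable (or message): the increments
  [u^1,...,u^l], and z^l = z^0 + sum_{s=1}^{l} G_{s-1}(u^1..u^{s-1}) u^s.\<close>
definition us :: "real list \<Rightarrow> real list" where
  "us ws = map (\<lambda>s. ws ! s - ws ! (s - 1)) [1..<length ws]"

definition zval :: "(nat \<Rightarrow> real list \<Rightarrow> real) \<Rightarrow> real \<Rightarrow> real list \<Rightarrow> real" where
  "zval G z0i ws = z0i + (\<Sum>s\<in>{1..<length ws}. G (s - 1) (take (s - 1) (us ws)) * (us ws ! (s - 1)))"

text \<open>wmh ... l i a = [w^0_{i->a}, ..., w^l_{i->a}].\<close>
primrec wmh :: "((nat \<Rightarrow> real) \<Rightarrow> real) \<Rightarrow> nat \<Rightarrow> nat set \<Rightarrow> (nat \<Rightarrow> nat \<Rightarrow> nat) \<Rightarrow> nat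
    \<Rightarrow> (nat \<Rightarrow> real list \<Rightarrow> real) \<Rightarrow> (nat \<Rightarrow> real) \<Rightarrow> nat \<Rightarrow> nat \<Rightarrow> nat \<Rightarrow> real list" where
  "wmh f r E vtx d Fto z0 0 i a = [0]"
| "wmh f r E vtx d Fto z0 (Suc l) i a =
     wmh f r E vtx d Fto z0 l i a @
     [1 / sqrt (real d - 1) * (\<Sum>b\<in>fac r E vtx i - {a}.
        Dpart f r vtx b i (\<lambda>\<iota>. zval Fto (z0 (vtx b \<iota>)) (wmh f r E vtx d Fto z0 l (vtx b \<iota>) b)))]"

definition zmsg :: "((nat \<Rightarrow> real) \<Rightarrow> real) \<Rightarrow> nat \<Rightarrow> nat set \<Rightarrow> (nat \<Rightarrow> nat \<Rightarrow> nat) \<Rightarrow> nat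
    \<Rightarrow> (nat \<Rightarrow> real list \<Rightarrow> real) \<Rightarrow> (nat \<Rightarrow> real) \<Rightarrow> nat \<Rightarrow> nat \<Rightarrow> nat \<Rightarrow> real" where
  "zmsg f r E vtx d Fto z0 l j b = zval Fto (z0 j) (wmh f r E vtx d Fto z0 l j b)"

text \<open>wnh ... l i = [w^0_i, ..., w^l_i].\<close>
definition wnh :: "((nat \<Rightarrow> real) \<Rightarrow> real) \<Rightarrow> nat \<Rightarrow> nat set \<Rightarrow> (nat \<Rightarrow> nat \<Rightarrow> nat) \<Rightarrow> nat
    \<Rightarrow> (nat \<Rightarrow> real list \<Rightarrow> real) \<Rightarrow> (nat \<Rightarrow> real) \<Rightarrow> nat \<Rightarrow> nat \<Rightarrow> real list" where
  "wnh f r E vtx d Fto z0 l i =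
     0 # map (\<lambda>s. 1 / sqrt (real d) * (\<Sum>b\<in>fac r E vtx i.
                 Dpart f r vtx b i (\<lambda>\<iota>. zmsg f r E vtx d Fto z0 (s - 1) (vtx b \<iota>) b))) [1..<Suc l]"

definition znode :: "((nat \<Rightarrow> real) \<Rightarrow> real) \<Rightarrow> nat \<Rightarrow> nat set \<Rightarrow> (nat \<Rightarrow> nat \<Rightarrow> nat) \<Rightarrow> nat
    \<Rightarrow> (nat \<Rightarrow> real list \<Rightarrow> real) \<Rightarrow> (nat \<Rightarrow> real list \<Rightarrow> real) \<Rightarrow> (nat \<Rightarrow> real) \<Rightarrow> nat \<Rightarrow> nat \<Rightarrow> real" where
  "znode f r E vtx d F Fto z0 l i = zval F (z0 i) (wnh f r E vtx d Fto z0 l i)"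

definition unode :: "((nat \<Rightarrow> real) \<Rightarrow> real) \<Rightarrow> nat \<Rightarrow> nat set \<Rightarrow> (nat \<Rightarrow> nat \<Rightarrow> nat) \<Rightarrow> nat
    \<Rightarrow> (nat \<Rightarrow> real list \<Rightarrow> real) \<Rightarrow> (nat \<Rightarrow> real) \<Rightarrow> nat \<Rightarrow> nat \<Rightarrow> real" where
  "unode f r E vtx d Fto z0 l i = wnh f r E vtx d Fto z0 l i ! l - wnh f r E vtx d Fto z0 l i ! (l - 1)"

definition Anode :: "((nat \<Rightarrow> real) \<Rightarrow> real) \<Rightarrow> nat \<Rightarrow> nat set \<Rightarrow> (nat \<Rightarrow> nat \<Rightarrow> nat) \<Rightarrow> nat
    \<Rightarrow> (nat \<Rightarrow> real list \<Rightarrow> real) \<Rightarrow> (nat \<Rightarrow> real list \<Rightarrow> real) \<Rightarrow> (nat \<Rightarrow> real) \<Rightarrow> nat \<Rightarrow> nat \<Rightarrow> real" where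
  "Anode f r E vtx d F Fto z0 l i = F l (us (wnh f r E vtx d Fto z0 l i))"

definition Amsg :: "((nat \<Rightarrow> real) \<Rightarrow> real) \<Rightarrow> nat \<Rightarrow> nat set \<Rightarrow> (nat \<Rightarrow> nat \<Rightarrow> nat) \<Rightarrow> nat
    \<Rightarrow> (nat \<Rightarrow> real list \<Rightarrow> real) \<Rightarrow> (nat \<Rightarrow> real) \<Rightarrow> nat \<Rightarrow> nat \<Rightarrow> nat \<Rightarrow> real" where
  "Amsg f r E vtx d Fto z0 l i a = Fto l (us (wmh f r E vtx d Fto z0 l i a))"

definition gauss_init :: "real \<Rightarrow> nat set \<Rightarrow> (nat \<Rightarrow> real) measure" where
  "gauss_init \<delta> V = PiM V (\<lambda>_. density lborel (normal_density 0 (sqrt \<delta>)))"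

definition good_nonlin :: "real \<Rightarrow> nat \<Rightarrow> (nat \<Rightarrow> real list \<Rightarrow> real) \<Rightarrow> bool" where
  "good_nonlin K L G \<longleftrightarrow>
     (\<forall>l<L. (\<forall>xs. length xs = l \<longrightarrow> \<bar>G l xs\<bar> \<le> K) \<and>
            (\<lambda>x. G l (map x [0..<l])) \<in> borel_measurable (PiM {..<l} (\<lambda>_. borel)))"

end

(*
  Large girth makes the messages into a factor come from disjoint sets of initial values,
  and since f has no degree-one Fourier coefficients each message history W 0, W 1, ... is an exact
  martingale.  Write the node value as z_i = z_{i->a} + e_i with e_i = O(d^(-1/2)) and expand the
  multilinear f to first order at the messages: the zeroth order term has expectation fhat {}, and
  the second order remainder is O(1/d) by moment bounds.  In the first order term the martingale
  property kills every contribution except D_a f(z^s) A_i^s u_i^(s+1); summing it over the factors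
  around i gives exactly sqrt d times A_i^s (u_i^(s+1))^2, with no further error.
  The orthogonality relations are proved for test functions that are invariant under changes of the
  future of a message, so the only use of Fubini is for a single Gaussian coordinate.
*)
theory Submission
  imports Defs
begin

subsection \<open>Functions with bounded moments\<close>

text \<open>The estimate has to hold with one constant for all \<open>d\<close> and all hypergraphs.
  Every moment bound is therefore an explicit function of the order \<open>m\<close>, built by
  recursion on time from \<open>f\<close>, \<open>r\<close>, \<open>\<delta>\<close>,
  \<open>K\<close> and \<open>Cm\<close> alone. All orders are tracked together, since a product
  asks its factors for order \<open>2 * m\<close> and a polynomial of degree \<open>r\<close> for
  order \<open>r * m\<close>. The obstacle to uniformity is a sum of about \<open>d\<close> branch
  terms divided by the square root of their number: the triangle inequality would lose a factor sqrt
  d. Even moments are bounded instead, using that each new branch term is orthogonal to odd powers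
  of the preceding partial sum. The girth enters only through the disjointness of the dependency
  sets of two members of a factor: a common variable would close a walk through at most 2L+1
  factors, hence give a cycle of length at most 4L+2. The first order term is an identity, so
  Property (P1) is spent on the quadratic remainder alone.\<close>

definition mom_bdd :: "'a measure \<Rightarrow> (nat \<Rightarrow> real) \<Rightarrow> ('a \<Rightarrow> real) \<Rightarrow> bool" where
  "mom_bdd M C X \<longleftrightarrow> X \<in> borel_measurable M \<and>
     (\<forall>m. integrable M (\<lambda>z. \<bar>X z\<bar> ^ m) \<and> (\<integral>z. \<bar>X z\<bar> ^ m \<partial>M) \<le> C m)"

text \<open>Qualitative companion of \<open>mom_bdd\<close>: it serves integrability and the
  orthogonality relations, where the size of the moments is irrelevant.\<close>

definition fin_mom :: "'a measure \<Rightarrow> ('a \<Rightarrow> real) \<Rightarrow> bool" where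
  "fin_mom M X \<longleftrightarrow> (\<exists>C. mom_bdd M C X)"

lemma mom_bddI:
  assumes "X \<in> borel_measurable M"
    and "\<And>m. integrable M (Y m)" and "\<And>m. (\<integral>z. Y m z \<partial>M) \<le> C m"
    and "\<And>m z. z \<in> space M \<Longrightarrow> \<bar>X z\<bar> ^ m \<le> Y m z"
  shows "mom_bdd M C X"
proof -
  have i: "integrable M (\<lambda>z. \<bar>X z\<bar> ^ m)" for m
    by (rule Bochner_Integration.integrable_bound[OF assms(2)[of m]])
       (use assms in \<open>auto intro!: AE_I2 order_trans[OF assms(4)]\<close>)
  moreover have "(\<integral>z. \<bar>X z\<bar> ^ m \<partial>M) \<le> C m" for m
    by (rule order_trans[OF integral_mono[OF i assms(2)] assms(3)]) (use assms in auto)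
  ultimately show ?thesis using assms(1) by (simp add: mom_bdd_def)
qed

lemma mom_bddD:
  assumes "mom_bdd M C X"
  shows "X \<in> borel_measurable M" "integrable M (\<lambda>z. \<bar>X z\<bar> ^ m)"
    "(\<integral>z. \<bar>X z\<bar> ^ m \<partial>M) \<le> C m" "0 \<le> C m"
proof -
  show "X \<in> borel_measurable M" "integrable M (\<lambda>z. \<bar>X z\<bar> ^ m)"
    "(\<integral>z. \<bar>X z\<bar> ^ m \<partial>M) \<le> C m" using assms by (auto simp: mom_bdd_def)
  moreover have "0 \<le> (\<integral>z. \<bar>X z\<bar> ^ m \<partial>M)" by simp
  ultimately show "0 \<le> C m" by linarith
qed

lemma mom_bdd_integrable:
  assumes "mom_bdd M C X" shows "integrable M X"
  using mom_bddD(2)[OF assms, of 1] mom_bddD(1)[OF assms] by (simp add: integrable_abs_iff)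

lemma mom_bdd_power_integral:
  assumes "mom_bdd M C X"
  shows "integrable M (\<lambda>z. X z ^ m)" "(\<integral>z. X z ^ m \<partial>M) \<le> C m"
proof -
  have m: "(\<lambda>z. X z ^ m) \<in> borel_measurable M" using mom_bddD(1)[OF assms] by simp
  show i: "integrable M (\<lambda>z. X z ^ m)"
    using mom_bddD(2)[OF assms, of m] m by (simp add: power_abs[symmetric] integrable_abs_iff)
  show "(\<integral>z. X z ^ m \<partial>M) \<le> C m"
    by (rule order_trans[OF integral_mono[OF i mom_bddD(2)[OF assms, of m]] mom_bddD(3)[OF assms]])
       (metis abs_ge_self power_abs)
qed

lemma mom_bdd_le:
  assumes "mom_bdd M C X" "Y \<in> borel_measurable M" "\<And>z. z \<in> space M \<Longrightarrow> \<bar>Y z\<bar> \<le> \<bar>X z\<bar>"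
  shows "mom_bdd M C Y"
  by (rule mom_bddI[where Y="\<lambda>m z. \<bar>X z\<bar> ^ m"])
     (use assms mom_bddD[OF assms(1)] in \<open>auto intro: power_mono\<close>)

lemma mom_bdd_abs:
  assumes "mom_bdd M C X" shows "mom_bdd M C (\<lambda>z. \<bar>X z\<bar>)"
  using assms by (auto simp: mom_bdd_def)

lemma mom_bdd_minus:
  assumes "mom_bdd M C X" shows "mom_bdd M C (\<lambda>z. - X z)"
  using assms by (auto simp: mom_bdd_def)

lemma (in prob_space) mom_bdd_bounded:
  assumes "X \<in> borel_measurable M" "\<And>z. z \<in> space M \<Longrightarrow> \<bar>X z\<bar> \<le> K"
  shows "mom_bdd M (\<lambda>m. K ^ m) X"
  by (rule mom_bddI[where Y="\<lambda>m z. K ^ m"])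
     (use assms in \<open>auto intro: power_mono simp: prob_space\<close>)

lemma (in prob_space) mom_bdd_const: "mom_bdd M (\<lambda>m. \<bar>c\<bar> ^ m) (\<lambda>z. c)"
  by (rule mom_bdd_bounded) auto

text \<open>The pointwise bound \<open>\<bar>x y\<bar>^m \<le> x^(2m) + y^(2m)\<close> replaces
  Cauchy-Schwarz, so the new bound is a plain sum without square roots.\<close>

lemma mom_bdd_mult:
  assumes X: "mom_bdd M C X" and Y: "mom_bdd M D Y"
  shows "mom_bdd M (\<lambda>m. C (2 * m) + D (2 * m)) (\<lambda>z. X z * Y z)"
proof (rule mom_bddI[where Y="\<lambda>m z. \<bar>X z\<bar> ^ (2 * m) + \<bar>Y z\<bar> ^ (2 * m)"])
  fix m z
  have "\<bar>X z * Y z\<bar> ^ m = \<bar>X z\<bar> ^ m * \<bar>Y z\<bar> ^ m" by (simp add: abs_mult power_mult_distrib)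
  also have "\<dots> \<le> (\<bar>X z\<bar> ^ m)\<^sup>2 + (\<bar>Y z\<bar> ^ m)\<^sup>2"
  proof -
    have "0 \<le> \<bar>X z\<bar> ^ m * \<bar>Y z\<bar> ^ m" by simp
    then show ?thesis using sum_squares_bound[of "\<bar>X z\<bar> ^ m" "\<bar>Y z\<bar> ^ m"] by linarith
  qed
  finally show "\<bar>X z * Y z\<bar> ^ m \<le> \<bar>X z\<bar> ^ (2 * m) + \<bar>Y z\<bar> ^ (2 * m)"
    by (simp add: power_even_eq)
qed (use mom_bddD[OF X] mom_bddD[OF Y] in \<open>auto intro!: add_mono\<close>)

lemma mom_bdd_add:
  assumes X: "mom_bdd M C X" and Y: "mom_bdd M D Y"
  shows "mom_bdd M (\<lambda>m. 2 ^ m * (C m + D m)) (\<lambda>z. X z + Y z)"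
proof (rule mom_bddI[where Y="\<lambda>m z. 2 ^ m * (\<bar>X z\<bar> ^ m + \<bar>Y z\<bar> ^ m)"])
  fix m z
  have "\<bar>X z + Y z\<bar> ^ m \<le> (2 * max \<bar>X z\<bar> \<bar>Y z\<bar>) ^ m" by (rule power_mono) auto
  also have "\<dots> \<le> 2 ^ m * (\<bar>X z\<bar> ^ m + \<bar>Y z\<bar> ^ m)"
    by (auto simp: power_mult_distrib max_def)
  finally show "\<bar>X z + Y z\<bar> ^ m \<le> 2 ^ m * (\<bar>X z\<bar> ^ m + \<bar>Y z\<bar> ^ m)" .
qed (use mom_bddD[OF X] mom_bddD[OF Y] in \<open>auto intro!: add_mono mult_left_mono\<close>)

lemma mom_bdd_power:
  assumes "mom_bdd M C X" shows "mom_bdd M (\<lambda>m. C (k * m)) (\<lambda>z. X z ^ k)"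
  using assms by (auto simp: mom_bdd_def power_abs power_mult[symmetric])

lemma mom_bdd_scale:
  assumes "mom_bdd M C X" "\<bar>c\<bar> \<le> K" shows "mom_bdd M (\<lambda>m. K ^ m * C m) (\<lambda>z. c * X z)"
proof (rule mom_bddI[where Y="\<lambda>m z. K ^ m * \<bar>X z\<bar> ^ m"])
  show "\<bar>c * X z\<bar> ^ m \<le> K ^ m * \<bar>X z\<bar> ^ m" for m z
    using assms(2) by (auto simp: abs_mult power_mult_distrib intro!: mult_right_mono power_mono)
  have "0 \<le> K" using assms(2) by linarith
  then show "(\<integral>z. K ^ m * \<bar>X z\<bar> ^ m \<partial>M) \<le> K ^ m * C m" for m
    using mom_bddD[OF assms(1)] by (auto intro!: mult_left_mono)
qed (use mom_bddD[OF assms(1)] in auto)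

text \<open>For nonempty \<open>I\<close> every summand is replaced by the largest one. The additive
  1 is there for the empty sum with \<open>m = 0\<close>, where the left side is
  \<open>0 ^ 0 = 1\<close>.\<close>

lemma abs_sum_power_le:
  fixes x :: "'i \<Rightarrow> real"
  assumes "finite I"
  shows "\<bar>\<Sum>i\<in>I. x i\<bar> ^ m \<le> 1 + real (card I) ^ m * (\<Sum>i\<in>I. \<bar>x i\<bar> ^ m)"
proof (cases "I = {}")
  case True then show ?thesis by (cases m) auto
next
  case False
  define y where "y = Max ((\<lambda>i. \<bar>x i\<bar>) ` I)"
  have y: "\<bar>x i\<bar> \<le> y" if "i \<in> I" for i using that assms by (simp add: y_def)
  have "y \<in> (\<lambda>i. \<bar>x i\<bar>) ` I" unfolding y_def by (rule Max_in) (use assms False in auto)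
  then obtain i0 where i0: "i0 \<in> I" "y = \<bar>x i0\<bar>" by auto
  have "\<bar>\<Sum>i\<in>I. x i\<bar> \<le> (\<Sum>i\<in>I. \<bar>x i\<bar>)" by (rule sum_abs)
  also have "\<dots> \<le> real (card I) * y" using sum_bounded_above[of I "\<lambda>i. \<bar>x i\<bar>" y] y by simp
  finally have "\<bar>\<Sum>i\<in>I. x i\<bar> ^ m \<le> (real (card I) * y) ^ m" by (rule power_mono) simp
  also have "\<dots> = real (card I) ^ m * \<bar>x i0\<bar> ^ m" by (simp add: power_mult_distrib i0)
  also have "\<dots> \<le> real (card I) ^ m * (\<Sum>i\<in>I. \<bar>x i\<bar> ^ m)"
    by (intro mult_left_mono member_le_sum) (use assms i0 in auto)
  finally show ?thesis by simp
qed

text \<open>This crude bound grows with the number of terms; it serves sums over the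
  \<open>r\<close> members of one factor, never sums over the \<open>d\<close> factors of a
  variable.\<close>

lemma (in prob_space) mom_bdd_sum:
  assumes I: "finite I" "card I \<le> n" and X: "\<And>i. i \<in> I \<Longrightarrow> mom_bdd M C (X i)"
  shows "mom_bdd M (\<lambda>m. 1 + real n ^ m * (real n * \<bar>C m\<bar>)) (\<lambda>z. \<Sum>i\<in>I. X i z)"
proof (rule mom_bddI[where Y="\<lambda>m z. 1 + real n ^ m * (\<Sum>i\<in>I. \<bar>X i z\<bar> ^ m)"])
  note b = mom_bddD[OF X]
  show "(\<lambda>z. \<Sum>i\<in>I. X i z) \<in> borel_measurable M" using b(1) by simp
  fix m
  show "integrable M (\<lambda>z. 1 + real n ^ m * (\<Sum>i\<in>I. \<bar>X i z\<bar> ^ m))" using b(2) by simp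
  have "(\<integral>z. (\<Sum>i\<in>I. \<bar>X i z\<bar> ^ m) \<partial>M) = (\<Sum>i\<in>I. \<integral>z. \<bar>X i z\<bar> ^ m \<partial>M)"
    by (rule Bochner_Integration.integral_sum) (use b in auto)
  also have "\<dots> \<le> (\<Sum>i\<in>I. \<bar>C m\<bar>)" by (rule sum_mono, rule order_trans[OF b(3) abs_ge_self])
  also have "\<dots> \<le> real n * \<bar>C m\<bar>" using I by (simp add: mult_right_mono)
  finally have "(\<integral>z. (\<Sum>i\<in>I. \<bar>X i z\<bar> ^ m) \<partial>M) \<le> real n * \<bar>C m\<bar>" .
  then have "real n ^ m * (\<integral>z. (\<Sum>i\<in>I. \<bar>X i z\<bar> ^ m) \<partial>M) \<le> real n ^ m * (real n * \<bar>C m\<bar>)"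
    by (rule mult_left_mono) simp
  then show "(\<integral>z. 1 + real n ^ m * (\<Sum>i\<in>I. \<bar>X i z\<bar> ^ m) \<partial>M) \<le> 1 + real n ^ m * (real n * \<bar>C m\<bar>)"
    using b(2) by (simp add: prob_space)
  fix z
  have "\<bar>\<Sum>i\<in>I. X i z\<bar> ^ m \<le> 1 + real (card I) ^ m * (\<Sum>i\<in>I. \<bar>X i z\<bar> ^ m)"
    by (rule abs_sum_power_le[OF I(1)])
  also have "\<dots> \<le> 1 + real n ^ m * (\<Sum>i\<in>I. \<bar>X i z\<bar> ^ m)"
    using I(2) by (intro add_left_mono mult_right_mono power_mono sum_nonneg) auto
  finally show "\<bar>\<Sum>i\<in>I. X i z\<bar> ^ m \<le> 1 + real n ^ m * (\<Sum>i\<in>I. \<bar>X i z\<bar> ^ m)" .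
qed

lemma fin_momI: "mom_bdd M C X \<Longrightarrow> fin_mom M X"
  by (auto simp: fin_mom_def)

lemma fin_mom_integrable: "fin_mom M X \<Longrightarrow> integrable M X"
  by (auto simp: fin_mom_def intro: mom_bdd_integrable)

lemma fin_mom_measurable: "fin_mom M X \<Longrightarrow> X \<in> borel_measurable M"
  by (auto simp: fin_mom_def dest: mom_bddD)

lemma fin_mom_mult: "fin_mom M X \<Longrightarrow> fin_mom M Y \<Longrightarrow> fin_mom M (\<lambda>z. X z * Y z)"
  unfolding fin_mom_def using mom_bdd_mult by blast

lemma fin_mom_add: "fin_mom M X \<Longrightarrow> fin_mom M Y \<Longrightarrow> fin_mom M (\<lambda>z. X z + Y z)"
  unfolding fin_mom_def using mom_bdd_add by blast

lemma fin_mom_diff: "fin_mom M X \<Longrightarrow> fin_mom M Y \<Longrightarrow> fin_mom M (\<lambda>z. X z - Y z)"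
  unfolding fin_mom_def using mom_bdd_add[of M _ X _ "\<lambda>z. - Y z"] mom_bdd_minus by fastforce

lemma fin_mom_power: "fin_mom M X \<Longrightarrow> fin_mom M (\<lambda>z. X z ^ k)"
  unfolding fin_mom_def using mom_bdd_power by blast

lemma (in prob_space) fin_mom_const: "fin_mom M (\<lambda>z. c)"
  unfolding fin_mom_def using mom_bdd_const by blast

lemma (in prob_space) fin_mom_cmult: "fin_mom M X \<Longrightarrow> fin_mom M (\<lambda>z. c * X z)"
  by (rule fin_mom_mult[OF fin_mom_const])

lemma (in prob_space) fin_mom_sum:
  "(\<And>i. i \<in> I \<Longrightarrow> fin_mom M (X i)) \<Longrightarrow> fin_mom M (\<lambda>z. \<Sum>i\<in>I. X i z)"
  by (induction I rule: infinite_finite_induct) (auto intro!: fin_mom_const fin_mom_add)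

lemma (in prob_space) fin_mom_prod:
  "(\<And>i. i \<in> I \<Longrightarrow> fin_mom M (X i)) \<Longrightarrow> fin_mom M (\<lambda>z. \<Prod>i\<in>I. X i z)"
  by (induction I rule: infinite_finite_induct) (auto intro!: fin_mom_const fin_mom_mult)

lemma integral_sum_fin_mom:
  assumes "\<And>i. i \<in> I \<Longrightarrow> fin_mom M (X i)"
  shows "(\<integral>z. (\<Sum>i\<in>I. X i z) \<partial>M) = (\<Sum>i\<in>I. \<integral>z. X i z \<partial>M)"
  by (rule Bochner_Integration.integral_sum) (use assms fin_mom_integrable in auto)

subsection \<open>Moments of sums of martingale differences\<close>

text \<open>In the binomial expansion each term of order \<open>j \<ge> 2\<close> in
  \<open>Y\<close> is at most \<open>S^(2m-2) Y^2\<close> if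
  \<open>\<bar>Y\<bar> \<le> \<bar>S\<bar>\<close> and at most \<open>Y^(2m)\<close> otherwise. The
  factor \<open>4 ^ m\<close> bounds the sum of the binomial coefficients. The term linear in
  \<open>Y\<close> is kept exactly, because orthogonality will remove it.\<close>

lemma binomial_remainder_le:
  fixes S Y :: real
  assumes "m \<ge> 1"
  shows "(S + Y) ^ (2 * m) \<le> S ^ (2 * m) + 2 * real m * (S ^ (2 * m - 1) * Y)
    + 4 ^ m * (S ^ (2 * m - 2) * Y\<^sup>2 + Y ^ (2 * m))"
proof -
  obtain k where k: "2 * m = Suc (Suc k)" using assms by (cases m) auto
  have ev: "even k" using k by presburger
  have t: "S ^ (2 * m - j) * Y ^ j \<le> S ^ k * Y\<^sup>2 + Y ^ (2 * m)" if "2 \<le> j" "j \<le> 2 * m" for j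
  proof -
    have n: "0 \<le> S ^ k * Y\<^sup>2" "0 \<le> Y ^ (2 * m)" using ev by (auto simp: zero_le_even_power)
    have "S ^ (2 * m - j) * Y ^ j \<le> \<bar>S\<bar> ^ (2 * m - j) * \<bar>Y\<bar> ^ j"
      by (metis abs_ge_self abs_mult power_abs)
    also have "\<dots> \<le> \<bar>S\<bar> ^ k * \<bar>Y\<bar> ^ 2 + \<bar>Y\<bar> ^ (2 * m)"
    proof (cases "\<bar>Y\<bar> \<le> \<bar>S\<bar>")
      case True
      have yj: "\<bar>Y\<bar> ^ j = \<bar>Y\<bar> ^ (j - 2) * \<bar>Y\<bar>\<^sup>2"
        using that by (metis le_add_diff_inverse2 power_add)
      have sj: "\<bar>S\<bar> ^ (2 * m - j) * \<bar>S\<bar> ^ (j - 2) = \<bar>S\<bar> ^ k"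
        by (subst power_add[symmetric]) (use that k in simp)
      have "\<bar>S\<bar> ^ (2 * m - j) * \<bar>Y\<bar> ^ j = \<bar>S\<bar> ^ (2 * m - j) * \<bar>Y\<bar> ^ (j - 2) * \<bar>Y\<bar>\<^sup>2"
        by (simp only: yj mult.assoc)
      also have "\<dots> \<le> \<bar>S\<bar> ^ (2 * m - j) * \<bar>S\<bar> ^ (j - 2) * \<bar>Y\<bar>\<^sup>2"
        by (intro mult_right_mono mult_left_mono power_mono) (use True in auto)
      also have "\<dots> = \<bar>S\<bar> ^ k * \<bar>Y\<bar>\<^sup>2" by (simp only: sj)
      finally show ?thesis by (rule order_trans) simp
    next
      case False
      have "\<bar>S\<bar> ^ (2 * m - j) * \<bar>Y\<bar> ^ j \<le> \<bar>Y\<bar> ^ (2 * m - j) * \<bar>Y\<bar> ^ j"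
        by (intro mult_right_mono power_mono) (use False in auto)
      also have "\<dots> = \<bar>Y\<bar> ^ (2 * m)"
        by (subst power_add[symmetric]) (use that in simp)
      finally show ?thesis by (rule order_trans) simp
    qed
    finally show ?thesis using ev by (simp add: power_even_abs)
  qed
  have nn: "0 \<le> S ^ k * Y\<^sup>2 + Y ^ (2 * m)" using ev by (auto simp: zero_le_even_power)
  have "(S + Y) ^ (2 * m) = (Y + S) ^ (2 * m)" by (simp add: add.commute)
  also have "\<dots> = (\<Sum>j\<le>2 * m. of_nat (2 * m choose j) * Y ^ j * S ^ (2 * m - j))"
    by (rule binomial_ring)
  also have "{..2 * m} = insert 0 (insert 1 {2..2 * m})" using assms by auto
  also have "(\<Sum>j\<in>insert 0 (insert 1 {2..2 * m}). of_nat (2 * m choose j) * Y ^ j * S ^ (2 * m - j))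
     = S ^ (2 * m) + 2 * real m * (S ^ (2 * m - 1) * Y)
      + (\<Sum>j\<in>{2..2 * m}. of_nat (2 * m choose j) * Y ^ j * S ^ (2 * m - j))"
    by (simp add: algebra_simps)
  also have "(\<Sum>j\<in>{2..2 * m}. of_nat (2 * m choose j) * Y ^ j * S ^ (2 * m - j))
     \<le> (\<Sum>j\<in>{2..2 * m}. of_nat (2 * m choose j) * (S ^ k * Y\<^sup>2 + Y ^ (2 * m)))"
  proof (rule sum_mono)
    fix j assume "j \<in> {2..2 * m}"
    then have "S ^ (2 * m - j) * Y ^ j \<le> S ^ k * Y\<^sup>2 + Y ^ (2 * m)" using t by simp
    from mult_left_mono[OF this, of "real (2 * m choose j)"]
    show "of_nat (2 * m choose j) * Y ^ j * S ^ (2 * m - j)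
      \<le> real (2 * m choose j) * (S ^ k * Y\<^sup>2 + Y ^ (2 * m))" by (simp add: mult_ac)
  qed
  also have "\<dots> = real (\<Sum>j\<in>{2..2 * m}. 2 * m choose j) * (S ^ k * Y\<^sup>2 + Y ^ (2 * m))"
    by (simp add: sum_distrib_right)
  also have "\<dots> \<le> 4 ^ m * (S ^ k * Y\<^sup>2 + Y ^ (2 * m))"
  proof (rule mult_right_mono[OF _ nn])
    have "(\<Sum>j\<in>{2..2 * m}. 2 * m choose j) \<le> (\<Sum>j\<le>2 * m. 2 * m choose j)"
      by (rule sum_mono2) auto
    also have "\<dots> = 2 ^ (2 * m)" by (rule choose_row_sum)
    also have "\<dots> = 4 ^ m" by (simp add: power_mult)
    finally show "real (\<Sum>j\<in>{2..2 * m}. 2 * m choose j) \<le> 4 ^ m"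
      by (metis of_nat_le_iff of_nat_power of_nat_numeral)
  qed
  finally show ?thesis using k by (simp add: numeral_2_eq_2)
qed

text \<open>Young's inequality with a free weight \<open>t\<close>, proved by comparing
  \<open>Y^2\<close> with \<open>S^2 / t\<close>; a large \<open>t\<close> makes the coefficient of
  \<open>S^(2m)\<close> small.\<close>

lemma weighted_young_power:
  fixes S Y t :: real
  assumes "m \<ge> 1" "t > 0"
  shows "S ^ (2 * m - 2) * Y\<^sup>2 \<le> S ^ (2 * m) / t + t ^ (m - 1) * Y ^ (2 * m)"
proof -
  obtain k where k: "m = Suc k" using assms by (cases m) auto
  have S: "S ^ (2 * k) = (S\<^sup>2) ^ k" "S ^ (2 * m) = S\<^sup>2 * (S\<^sup>2) ^ k" "Y ^ (2 * m) = Y\<^sup>2 * (Y\<^sup>2) ^ k"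
    by (simp_all only: k power_mult power_Suc)
  have "(S\<^sup>2) ^ k * Y\<^sup>2 \<le> S\<^sup>2 * (S\<^sup>2) ^ k / t + t ^ k * (Y\<^sup>2 * (Y\<^sup>2) ^ k)"
  proof (cases "Y\<^sup>2 \<le> S\<^sup>2 / t")
    case True
    have "(S\<^sup>2) ^ k * Y\<^sup>2 \<le> (S\<^sup>2) ^ k * (S\<^sup>2 / t)" by (rule mult_left_mono[OF True]) simp
    moreover have "0 \<le> t ^ k * (Y\<^sup>2 * (Y\<^sup>2) ^ k)" using assms by simp
    ultimately show ?thesis by (simp add: mult_ac)
  next
    case False
    then have "S\<^sup>2 \<le> t * Y\<^sup>2" using assms by (simp add: field_simps)
    then have "(S\<^sup>2) ^ k \<le> (t * Y\<^sup>2) ^ k" by (rule power_mono) simp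
    then have "(S\<^sup>2) ^ k * Y\<^sup>2 \<le> (t * Y\<^sup>2) ^ k * Y\<^sup>2" by (rule mult_right_mono) simp
    moreover have "0 \<le> S\<^sup>2 * (S\<^sup>2) ^ k / t" using assms by simp
    ultimately show ?thesis by (simp add: power_mult_distrib mult_ac)
  qed
  moreover have "2 * m - 2 = 2 * k" "m - 1 = k" by (simp_all add: k)
  ultimately show ?thesis by (simp only: S)
qed

text \<open>Only the orthogonality of each new summand to the odd power of the preceding partial sum
  is needed, so that no independence has to be established.\<close>
lemma martingale_sum_even_moment:
  fixes Y :: "'i \<Rightarrow> 'a \<Rightarrow> real"
  assumes m: "m \<ge> 1" and n: "n \<ge> 1" and fin: "finite A" and card: "card A \<le> n"
    and Y: "\<And>b. b \<in> A \<Longrightarrow> fin_mom M (Y b)"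
    and B: "\<And>b. b \<in> A \<Longrightarrow> (\<integral>z. Y b z ^ (2 * m) \<partial>M) \<le> B" "B \<ge> 0"
    and orth: "\<And>A' c. A' \<subseteq> A \<Longrightarrow> c \<in> A - A' \<Longrightarrow> (\<integral>z. (\<Sum>b\<in>A'. Y b z) ^ (2 * m - 1) * Y c z \<partial>M) = 0"
    and M: "prob_space M"
  shows "(\<integral>z. (\<Sum>b\<in>A. Y b z) ^ (2 * m) \<partial>M) \<le> 2 * 4 ^ m * exp (4 ^ m) * B * real n ^ m"
proof -
  interpret prob_space M by (rule M)
  \<comment> \<open>The recursion is E(S+Y)^(2m) \<le> q E S^(2m) + h: \<open>q\<close> is the
    growth factor caused by one more summand and \<open>h\<close> its own contribution. Starting
    from 0, \<open>k\<close> steps give at most \<open>k * h * q ^ k\<close>.\<close>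
  define q where "q = 1 + 4 ^ m / real n"
  define h where "h = 2 * 4 ^ m * real n ^ (m - 1) * B"
  have q1: "q \<ge> 1" by (simp add: q_def)
  have h0: "h \<ge> 0" using B by (simp add: h_def)
  have step: "(\<integral>z. (\<Sum>b\<in>A'. Y b z) ^ (2 * m) \<partial>M) \<le> real (card A') * h * q ^ card A'" if "A' \<subseteq> A" for A'
    using finite_subset[OF that fin] that
  proof (induction A' rule: finite_induct)
    case empty
    then show ?case using m by (simp add: power_0_left)
  next
    case (insert c A')
    define S where "S z = (\<Sum>b\<in>A'. Y b z)" for z
    have fS: "fin_mom M S" unfolding S_def using insert Y by (intro fin_mom_sum) auto
    have fY: "fin_mom M (Y c)" using insert Y by auto
    have I: "integrable M (\<lambda>z. S z ^ i * Y c z ^ j)" for i j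
      by (intro fin_mom_integrable fin_mom_mult fin_mom_power fS fY)
    have IS: "integrable M (\<lambda>z. S z ^ i)" and IY: "integrable M (\<lambda>z. Y c z ^ i)" for i
      by (intro fin_mom_integrable fin_mom_power fS fY)+
    have IA: "integrable M (\<lambda>z. (S z + Y c z) ^ (2 * m))"
      by (intro fin_mom_integrable fin_mom_power fin_mom_add fS fY)
    have pt: "(S z + Y c z) ^ (2 * m) \<le> q * S z ^ (2 * m) + 2 * real m * (S z ^ (2 * m - 1) * Y c z ^ 1)
        + 2 * 4 ^ m * real n ^ (m - 1) * Y c z ^ (2 * m)" for z
    proof -
      have b: "(S z + Y c z) ^ (2 * m) \<le> S z ^ (2 * m) + 2 * real m * (S z ^ (2 * m - 1) * Y c z)
        + 4 ^ m * (S z ^ (2 * m - 2) * (Y c z)\<^sup>2 + Y c z ^ (2 * m))"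
        by (rule binomial_remainder_le[OF m])
      \<comment> \<open>The weight \<open>n\<close> in Young's inequality balances both ends: the
        cost \<open>4 ^ m / n\<close> per summand stays bounded over \<open>n\<close> summands,
        while \<open>n ^ (m - 1)\<close> times \<open>n\<close> summands produces the factor
        \<open>n ^ m\<close> of the claim.\<close>
      have w: "S z ^ (2 * m - 2) * (Y c z)\<^sup>2 + Y c z ^ (2 * m)
        \<le> (S z ^ (2 * m) / n + real n ^ (m - 1) * Y c z ^ (2 * m)) + real n ^ (m - 1) * Y c z ^ (2 * m)"
      proof (rule add_mono[OF weighted_young_power[OF m]])
        have "1 * Y c z ^ (2 * m) \<le> real n ^ (m - 1) * Y c z ^ (2 * m)"
          by (rule mult_right_mono) (use n in \<open>auto simp: zero_le_even_power one_le_power\<close>)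
        then show "Y c z ^ (2 * m) \<le> real n ^ (m - 1) * Y c z ^ (2 * m)" by simp
      qed (use n in auto)
      from b mult_left_mono[OF w, of "4 ^ m"] show ?thesis by (simp add: q_def algebra_simps)
    qed
    have "(\<integral>z. (\<Sum>b\<in>insert c A'. Y b z) ^ (2 * m) \<partial>M) = (\<integral>z. (S z + Y c z) ^ (2 * m) \<partial>M)"
      using insert by (simp add: S_def add.commute)
    also have "\<dots> \<le> (\<integral>z. q * S z ^ (2 * m) + 2 * real m * (S z ^ (2 * m - 1) * Y c z ^ 1)
        + 2 * 4 ^ m * real n ^ (m - 1) * Y c z ^ (2 * m) \<partial>M)"
      by (rule integral_mono[OF IA _ pt]) (intro Bochner_Integration.integrable_add integrable_mult_right I IS IY)
    also have "\<dots> = q * (\<integral>z. S z ^ (2 * m) \<partial>M) + 2 * real m * (\<integral>z. S z ^ (2 * m - 1) * Y c z ^ 1 \<partial>M)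
        + 2 * 4 ^ m * real n ^ (m - 1) * (\<integral>z. Y c z ^ (2 * m) \<partial>M)"
      by (subst Bochner_Integration.integral_add Bochner_Integration.integral_mult_right,
          (intro Bochner_Integration.integrable_add integrable_mult_right I IS IY)+)+ simp
    also have "(\<integral>z. S z ^ (2 * m - 1) * Y c z ^ 1 \<partial>M) = 0"
      using orth[of A' c] insert by (simp add: S_def)
    also have "q * (\<integral>z. S z ^ (2 * m) \<partial>M) + 2 * real m * 0 + 2 * 4 ^ m * real n ^ (m - 1) * (\<integral>z. Y c z ^ (2 * m) \<partial>M)
      \<le> q * (real (card A') * h * q ^ card A') + 2 * real m * 0 + 2 * 4 ^ m * real n ^ (m - 1) * B"
      by (intro add_mono mult_left_mono) (use insert q1 B in \<open>auto simp: S_def\<close>)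
    also have "\<dots> = real (card A') * h * q ^ Suc (card A') + h * 1" by (simp add: h_def mult_ac)
    also have "\<dots> \<le> real (card A') * h * q ^ Suc (card A') + h * q ^ Suc (card A')"
      by (intro add_left_mono mult_left_mono one_le_power q1 h0)
    also have "\<dots> = real (card (insert c A')) * h * q ^ card (insert c A')"
      using insert by (simp add: algebra_simps)
    finally show ?case .
  qed
  have "q ^ card A \<le> q ^ n" by (rule power_increasing[OF card q1])
  also have "\<dots> \<le> exp (4 ^ m / real n) ^ n"
    unfolding q_def by (intro power_mono exp_ge_add_one_self) simp
  also have "\<dots> = exp (4 ^ m)" using n by (simp flip: exp_of_nat_mult)
  finally have q: "q ^ card A \<le> exp (4 ^ m)" .
  have "(\<integral>z. (\<Sum>b\<in>A. Y b z) ^ (2 * m) \<partial>M) \<le> real (card A) * h * q ^ card A" by (rule step) simp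
  also have "\<dots> \<le> real n * h * exp (4 ^ m)"
    by (intro mult_mono) (use card q q1 h0 in auto)
  also have "\<dots> = 2 * 4 ^ m * exp (4 ^ m) * B * (real n * real n ^ (m - 1))"
    by (simp add: h_def mult_ac)
  also have "real n * real n ^ (m - 1) = real n ^ m" using m by (cases m) auto
  finally show ?thesis .
qed

subsection \<open>Gaussian initialisation\<close>

definition gauss1 :: "real \<Rightarrow> real measure" where
  "gauss1 \<delta> = density lborel (normal_density 0 (sqrt \<delta>))"

definition gauss_abs_moment :: "real \<Rightarrow> nat \<Rightarrow> real" where
  "gauss_abs_moment \<delta> m = (\<integral>x. \<bar>x\<bar> ^ m \<partial>gauss1 \<delta>)"

lemma gauss_init_eq: "gauss_init \<delta> V = PiM V (\<lambda>_. gauss1 \<delta>)"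
  by (simp add: gauss_init_def gauss1_def)

lemma sets_gauss1 [measurable_cong, simp]: "sets (gauss1 \<delta>) = sets borel"
  by (simp add: gauss1_def)

lemma space_gauss1 [simp]: "space (gauss1 \<delta>) = UNIV"
  by (simp add: gauss1_def)

lemma prob_space_gauss1: "\<delta> > 0 \<Longrightarrow> prob_space (gauss1 \<delta>)"
  unfolding gauss1_def by (rule prob_space_normal_density) simp

lemma prob_space_gauss_init: "\<delta> > 0 \<Longrightarrow> prob_space (gauss_init \<delta> V)"
  unfolding gauss_init_eq by (rule prob_space_PiM) (rule prob_space_gauss1)

lemma integrable_gauss1_moment:
  assumes "\<delta> > 0" shows "integrable (gauss1 \<delta>) (\<lambda>x. \<bar>x\<bar> ^ m)"
  using integrable_normal_moment_abs[of "sqrt \<delta>" 0 m] assms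
  unfolding gauss1_def by (subst integrable_density) auto

lemma integral_gauss1: "\<delta> > 0 \<Longrightarrow> (\<integral>x. x \<partial>gauss1 \<delta>) = 0"
  unfolding gauss1_def using integral_normal_moment_nz_1[of "sqrt \<delta>" 0]
  by (subst integral_density) auto

lemma measurable_gauss_init_coord [measurable (raw)]:
  "k \<in> V \<Longrightarrow> (\<lambda>z. z k) \<in> borel_measurable (gauss_init \<delta> V)"
  unfolding gauss_init_eq by (rule measurable_PiM_component_rev) auto

lemma mom_bdd_gauss_init_coord:
  assumes \<delta>: "\<delta> > 0" and k: "k \<in> V"
  shows "mom_bdd (gauss_init \<delta> V) (gauss_abs_moment \<delta>) (\<lambda>z. z k)"
proof -
  have d: "distr (PiM V (\<lambda>_. gauss1 \<delta>)) (gauss1 \<delta>) (\<lambda>z. z k) = gauss1 \<delta>"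
    using distr_PiM_component[of V "\<lambda>_. gauss1 \<delta>" k] prob_space_gauss1[OF \<delta>] k by simp
  have m: "(\<lambda>z. z k) \<in> measurable (PiM V (\<lambda>_. gauss1 \<delta>)) (gauss1 \<delta>)"
    using k by simp
  have a: "(\<lambda>x::real. \<bar>x\<bar> ^ m) \<in> borel_measurable (gauss1 \<delta>)" for m by simp
  have "integrable (distr (PiM V (\<lambda>_. gauss1 \<delta>)) (gauss1 \<delta>) (\<lambda>z. z k)) (\<lambda>x. \<bar>x\<bar> ^ m)" for m
    unfolding d by (rule integrable_gauss1_moment[OF \<delta>])
  then have i: "integrable (PiM V (\<lambda>_. gauss1 \<delta>)) (\<lambda>z. \<bar>z k\<bar> ^ m)" for m
    using integrable_distr_eq[OF m a] by blast
  have "(\<integral>z. \<bar>z k\<bar> ^ m \<partial>PiM V (\<lambda>_. gauss1 \<delta>)) = gauss_abs_moment \<delta> m" for m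
    using integral_distr[OF m a, of m] unfolding d gauss_abs_moment_def by simp
  then show ?thesis
    unfolding mom_bdd_def using i measurable_gauss_init_coord[OF k] by (simp add: gauss_init_eq)
qed

text \<open>Independence of \<open>\<phi>\<close> from the coordinate \<open>k\<close> is expressed
  as invariance under updating it. The inner integral then pulls \<open>\<phi>\<close> out and
  leaves the mean of a centred Gaussian.\<close>

lemma integral_mult_gauss_coord_eq_0:
  assumes \<delta>: "\<delta> > 0" and V: "finite V" "k \<in> V" and \<phi>: "fin_mom (gauss_init \<delta> V) \<phi>"
    and inv: "\<And>z x. \<phi> (z(k := x)) = \<phi> z"
  shows "(\<integral>z. \<phi> z * z k \<partial>gauss_init \<delta> V) = 0"
proof -
  interpret product_sigma_finite "\<lambda>_. gauss1 \<delta>"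
    by (rule product_sigma_finite.intro) (rule prob_space_imp_sigma_finite[OF prob_space_gauss1[OF \<delta>]])
  have "fin_mom (gauss_init \<delta> V) (\<lambda>z. \<phi> z * z k)"
    using mom_bdd_gauss_init_coord[OF \<delta> V(2)] by (intro fin_mom_mult[OF \<phi> fin_momI])
  then have i: "integrable (PiM (insert k (V - {k})) (\<lambda>_. gauss1 \<delta>)) (\<lambda>z. \<phi> z * z k)"
    using fin_mom_integrable V by (simp add: insert_absorb gauss_init_eq)
  have "(\<integral>z. \<phi> z * z k \<partial>gauss_init \<delta> V) = (\<integral>z. \<phi> z * z k \<partial>PiM (insert k (V - {k})) (\<lambda>_. gauss1 \<delta>))"
    using V by (simp add: insert_absorb gauss_init_eq)
  also have "\<dots> = (\<integral>z. (\<integral>x. \<phi> (z(k := x)) * (z(k := x)) k \<partial>gauss1 \<delta>) \<partial>PiM (V - {k}) (\<lambda>_. gauss1 \<delta>))"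
    by (rule product_integral_insert[OF _ _ i]) (use V in auto)
  also have "\<dots> = 0" by (simp add: inv integral_gauss1[OF \<delta>])
  finally show ?thesis .
qed

subsection \<open>Multilinear polynomials\<close>

text \<open>The spectral l1-norm of \<open>f\<close>.\<close>

definition fhat_l1 :: "((nat \<Rightarrow> real) \<Rightarrow> real) \<Rightarrow> nat \<Rightarrow> real" where
  "fhat_l1 f r = (\<Sum>S\<in>Pow {..<r}. \<bar>fhat f r S\<bar>)"

lemma fhat_l1_nonneg: "0 \<le> fhat_l1 f r"
  by (simp add: fhat_l1_def sum_nonneg)

lemma abs_prod_le_power:
  fixes y :: "'i \<Rightarrow> real"
  assumes "finite T" "card T \<le> n" "1 \<le> R" "\<And>\<iota>. \<iota> \<in> T \<Longrightarrow> \<bar>y \<iota>\<bar> \<le> R"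
  shows "\<bar>\<Prod>\<iota>\<in>T. y \<iota>\<bar> \<le> R ^ n"
proof -
  have "\<bar>\<Prod>\<iota>\<in>T. y \<iota>\<bar> = (\<Prod>\<iota>\<in>T. \<bar>y \<iota>\<bar>)" by (rule abs_prod)
  also have "\<dots> \<le> (\<Prod>\<iota>\<in>T. R)" by (rule prod_mono) (use assms in auto)
  also have "\<dots> = R ^ card T" by simp
  also have "\<dots> \<le> R ^ n" by (rule power_increasing) (use assms in auto)
  finally show ?thesis .
qed

lemma abs_le_one_plus_sum:
  fixes y :: "nat \<Rightarrow> real"
  assumes "\<iota> < r" shows "\<bar>y \<iota>\<bar> \<le> 1 + (\<Sum>\<kappa><r. \<bar>y \<kappa>\<bar>)"
  using member_le_sum[of \<iota> "{..<r}" "\<lambda>\<kappa>. \<bar>y \<kappa>\<bar>"] assms by simp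

text \<open>The base \<open>1 + (\<Sum>\<kappa><r. \<bar>y \<kappa>\<bar>)\<close> dominates every
  coordinate and is at least 1, so monomials of lower degree may also be bounded by its
  \<open>r\<close>-th power.\<close>

lemma abs_mlderiv_le:
  "\<bar>mlderiv f r \<iota> y\<bar> \<le> fhat_l1 f r * (1 + (\<Sum>\<kappa><r. \<bar>y \<kappa>\<bar>)) ^ r"
proof -
  let ?R = "1 + (\<Sum>\<kappa><r. \<bar>y \<kappa>\<bar>)"
  have R: "1 \<le> ?R" by (simp add: sum_nonneg)
  have "\<bar>mlderiv f r \<iota> y\<bar> \<le> (\<Sum>S\<in>{S\<in>Pow {..<r}. \<iota> \<in> S}. \<bar>fhat f r S\<bar> * \<bar>\<Prod>\<kappa>\<in>S - {\<iota>}. y \<kappa>\<bar>)"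
    unfolding mlderiv_def by (rule order_trans[OF sum_abs]) (simp add: abs_mult)
  also have "\<dots> \<le> (\<Sum>S\<in>{S\<in>Pow {..<r}. \<iota> \<in> S}. \<bar>fhat f r S\<bar> * ?R ^ r)"
  proof (rule sum_mono, rule mult_left_mono)
    fix S assume S: "S \<in> {S\<in>Pow {..<r}. \<iota> \<in> S}"
    then have fS: "finite S" "card S \<le> r"
      using finite_subset[of S "{..<r}"] card_mono[of "{..<r}" S] by auto
    show "\<bar>\<Prod>\<kappa>\<in>S - {\<iota>}. y \<kappa>\<bar> \<le> ?R ^ r"
    proof (rule abs_prod_le_power[OF _ _ R])
      show "card (S - {\<iota>}) \<le> r" using fS card_mono[of S "S - {\<iota>}"] by auto
      show "\<bar>y \<kappa>\<bar> \<le> ?R" if "\<kappa> \<in> S - {\<iota>}" for \<kappa>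
        using that S by (intro abs_le_one_plus_sum) auto
    qed (use fS in auto)
  qed simp
  also have "\<dots> \<le> (\<Sum>S\<in>Pow {..<r}. \<bar>fhat f r S\<bar> * ?R ^ r)"
    by (rule sum_mono2) (use R in auto)
  also have "\<dots> = fhat_l1 f r * ?R ^ r" by (simp add: fhat_l1_def sum_distrib_right)
  finally show ?thesis .
qed

lemma mlderiv_cong:
  assumes "\<And>\<kappa>. \<kappa> < r \<Longrightarrow> \<kappa> \<noteq> \<iota> \<Longrightarrow> y \<kappa> = y' \<kappa>"
  shows "mlderiv f r \<iota> y = mlderiv f r \<iota> y'"
  unfolding mlderiv_def using assms by (intro sum.cong prod.cong refl arg_cong2[of _ _ _ _ "(*)"]) auto

text \<open>Multiplying out gives a sum over the set \<open>X\<close> of positions where the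
  perturbation is chosen. The empty set and the singletons are the zeroth and first order terms.
  Each of the at most \<open>2 ^ card S\<close> remaining sets carries
  \<open>\<epsilon> ^ card X \<le> \<epsilon>\<^sup>2\<close> and at most \<open>card S\<close>
  factors of size \<open>R\<close>.\<close>

lemma prod_taylor_le:
  fixes y e :: "'i \<Rightarrow> real"
  assumes S: "finite S" "card S \<le> n" and R: "1 \<le> R" and \<epsilon>: "0 \<le> \<epsilon>" "\<epsilon> \<le> 1"
    and yR: "\<And>\<iota>. \<iota> \<in> S \<Longrightarrow> \<bar>y \<iota>\<bar> \<le> R" and eR: "\<And>\<iota>. \<iota> \<in> S \<Longrightarrow> \<bar>e \<iota>\<bar> \<le> R"
  shows "\<bar>(\<Prod>\<iota>\<in>S. y \<iota> + \<epsilon> * e \<iota>) - (\<Prod>\<iota>\<in>S. y \<iota>) - (\<Sum>\<iota>\<in>S. (\<Prod>\<kappa>\<in>S - {\<iota>}. y \<kappa>) * (\<epsilon> * e \<iota>))\<bar>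
    \<le> \<epsilon>\<^sup>2 * (2 * R) ^ n"
proof -
  define t where "t X = (\<Prod>\<iota>\<in>X. \<epsilon> * e \<iota>) * (\<Prod>\<iota>\<in>S - X. y \<iota>)" for X
  define P where "P = {X \<in> Pow S. 2 \<le> card X}"
  have fin: "finite X" if "X \<subseteq> S" for X using that S(1) by (rule finite_subset)
  have split: "Pow S = insert {} ((\<lambda>\<iota>. {\<iota>}) ` S \<union> P)"
  proof (rule equalityI; rule subsetI)
    fix X assume X: "X \<in> Pow S"
    consider "card X = 0" | "card X = 1" | "2 \<le> card X" by linarith
    then show "X \<in> insert {} ((\<lambda>\<iota>. {\<iota>}) ` S \<union> P)"
    proof cases
      case 2
      then obtain x where "X = {x}" by (auto simp: card_1_singleton_iff)
      then show ?thesis using X by auto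
    qed (use fin X in \<open>auto simp: P_def\<close>)
  qed (auto simp: P_def)
  have "(\<Prod>\<iota>\<in>S. y \<iota> + \<epsilon> * e \<iota>) = (\<Prod>\<iota>\<in>S. \<epsilon> * e \<iota> + y \<iota>)" by (simp add: add.commute)
  also have "\<dots> = (\<Sum>X\<in>Pow S. t X)" unfolding t_def by (rule prod_add[OF S(1)])
  also have "\<dots> = t {} + ((\<Sum>X\<in>(\<lambda>\<iota>. {\<iota>}) ` S. t X) + (\<Sum>X\<in>P. t X))"
    unfolding split using S(1)
    by (subst sum.insert, (auto simp: P_def)[2], subst sum.union_disjoint) (auto simp: P_def)
  also have "t {} = (\<Prod>\<iota>\<in>S. y \<iota>)" by (simp add: t_def)
  also have "(\<Sum>X\<in>(\<lambda>\<iota>. {\<iota>}) ` S. t X) = (\<Sum>\<iota>\<in>S. (\<Prod>\<kappa>\<in>S - {\<iota>}. y \<kappa>) * (\<epsilon> * e \<iota>))"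
    by (subst sum.reindex) (auto simp: t_def mult_ac)
  finally have "\<bar>(\<Prod>\<iota>\<in>S. y \<iota> + \<epsilon> * e \<iota>) - (\<Prod>\<iota>\<in>S. y \<iota>) - (\<Sum>\<iota>\<in>S. (\<Prod>\<kappa>\<in>S - {\<iota>}. y \<kappa>) * (\<epsilon> * e \<iota>))\<bar>
    = \<bar>\<Sum>X\<in>P. t X\<bar>" by simp
  also have "\<dots> \<le> (\<Sum>X\<in>P. \<bar>t X\<bar>)" by (rule sum_abs)
  also have "\<dots> \<le> (\<Sum>X\<in>P. \<epsilon>\<^sup>2 * R ^ card S)"
  proof (rule sum_mono)
    fix X assume X: "X \<in> P"
    then have XS: "X \<subseteq> S" "2 \<le> card X" by (auto simp: P_def)
    have c: "card X + card (S - X) = card S"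
      using XS S(1) fin by (metis card_Diff_subset card_mono le_add_diff_inverse)
    have "\<bar>t X\<bar> = \<epsilon> ^ card X * \<bar>\<Prod>\<iota>\<in>X. e \<iota>\<bar> * \<bar>\<Prod>\<iota>\<in>S - X. y \<iota>\<bar>"
      using \<epsilon> by (simp add: t_def abs_mult prod.distrib)
    also have "\<dots> \<le> \<epsilon>\<^sup>2 * R ^ card X * R ^ card (S - X)"
      using \<epsilon> XS R fin S(1)
      by (intro mult_mono abs_prod_le_power power_decreasing yR eR) auto
    also have "\<dots> = \<epsilon>\<^sup>2 * R ^ card S" by (simp add: mult.assoc flip: power_add c)
    finally show "\<bar>t X\<bar> \<le> \<epsilon>\<^sup>2 * R ^ card S" .
  qed
  also have "\<dots> = real (card P) * (\<epsilon>\<^sup>2 * R ^ card S)" by simp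
  also have "\<dots> \<le> 2 ^ card S * (\<epsilon>\<^sup>2 * R ^ card S)"
  proof (rule mult_right_mono)
    have "card P \<le> card (Pow S)" unfolding P_def by (rule card_mono) (use S in auto)
    then show "real (card P) \<le> 2 ^ card S" using S(1) by (simp add: card_Pow)
  qed (use R in auto)
  also have "\<dots> = \<epsilon>\<^sup>2 * (2 * R) ^ card S" by (simp add: power_mult_distrib mult_ac)
  also have "\<dots> \<le> \<epsilon>\<^sup>2 * (2 * R) ^ n"
    by (intro mult_left_mono power_increasing) (use S R in auto)
  finally show ?thesis .
qed

lemma sum_mlderiv_mult:
  "(\<Sum>\<iota><r. mlderiv f r \<iota> y * e \<iota>)
    = (\<Sum>S\<in>Pow {..<r}. fhat f r S * (\<Sum>\<iota>\<in>S. (\<Prod>\<kappa>\<in>S - {\<iota>}. y \<kappa>) * e \<iota>))"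
proof -
  have "(\<Sum>\<iota><r. mlderiv f r \<iota> y * e \<iota>)
    = (\<Sum>\<iota>\<in>{..<r}. \<Sum>S\<in>{S\<in>Pow {..<r}. \<iota> \<in> S}. fhat f r S * ((\<Prod>\<kappa>\<in>S - {\<iota>}. y \<kappa>) * e \<iota>))"
    by (simp add: mlderiv_def sum_distrib_right mult.assoc)
  also have "\<dots> = (\<Sum>S\<in>Pow {..<r}. \<Sum>\<iota>\<in>{\<iota>\<in>{..<r}. \<iota> \<in> S}. fhat f r S * ((\<Prod>\<kappa>\<in>S - {\<iota>}. y \<kappa>) * e \<iota>))"
    by (rule sum.swap_restrict) auto
  also have "\<dots> = (\<Sum>S\<in>Pow {..<r}. fhat f r S * (\<Sum>\<iota>\<in>S. (\<Prod>\<kappa>\<in>S - {\<iota>}. y \<kappa>) * e \<iota>))"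
  proof (rule sum.cong[OF refl])
    fix S assume "S \<in> Pow {..<r}"
    then have "{\<iota>\<in>{..<r}. \<iota> \<in> S} = S" by auto
    then show "(\<Sum>\<iota>\<in>{\<iota>\<in>{..<r}. \<iota> \<in> S}. fhat f r S * ((\<Prod>\<kappa>\<in>S - {\<iota>}. y \<kappa>) * e \<iota>))
      = fhat f r S * (\<Sum>\<iota>\<in>S. (\<Prod>\<kappa>\<in>S - {\<iota>}. y \<kappa>) * e \<iota>)"
      by (simp add: sum_distrib_left)
  qed
  finally show ?thesis .
qed

text \<open>The scale \<open>\<epsilon>\<close> is separated from the direction \<open>e\<close>
  because it will be \<open>1 / sqrt d\<close>, with \<open>e\<close> the rescaled deviation whose
  moments are bounded uniformly; the factor \<open>\<epsilon>\<^sup>2\<close> is then the whole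
  dependence on \<open>d\<close>.\<close>

lemma mlext_taylor_le:
  assumes \<epsilon>: "0 \<le> \<epsilon>" "\<epsilon> \<le> 1"
  shows "\<bar>mlext f r (\<lambda>\<iota>. y \<iota> + \<epsilon> * e \<iota>) - mlext f r y - (\<Sum>\<iota><r. mlderiv f r \<iota> y * (\<epsilon> * e \<iota>))\<bar>
    \<le> \<epsilon>\<^sup>2 * fhat_l1 f r * (2 * (1 + (\<Sum>\<kappa><r. \<bar>y \<kappa>\<bar>) + (\<Sum>\<kappa><r. \<bar>e \<kappa>\<bar>))) ^ r"
proof -
  let ?R = "1 + (\<Sum>\<kappa><r. \<bar>y \<kappa>\<bar>) + (\<Sum>\<kappa><r. \<bar>e \<kappa>\<bar>)"
  have n: "0 \<le> (\<Sum>\<kappa><r. \<bar>y \<kappa>\<bar>)" "0 \<le> (\<Sum>\<kappa><r. \<bar>e \<kappa>\<bar>)" by (simp_all add: sum_nonneg)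
  have yR: "\<bar>y \<iota>\<bar> \<le> ?R" "\<bar>e \<iota>\<bar> \<le> ?R" if "\<iota> < r" for \<iota>
    using abs_le_one_plus_sum[OF that, of y] abs_le_one_plus_sum[OF that, of e] n by linarith+
  define t where "t S = (\<Prod>\<iota>\<in>S. y \<iota> + \<epsilon> * e \<iota>) - (\<Prod>\<iota>\<in>S. y \<iota>)
    - (\<Sum>\<iota>\<in>S. (\<Prod>\<kappa>\<in>S - {\<iota>}. y \<kappa>) * (\<epsilon> * e \<iota>))" for S
  have "mlext f r (\<lambda>\<iota>. y \<iota> + \<epsilon> * e \<iota>) - mlext f r y - (\<Sum>\<iota><r. mlderiv f r \<iota> y * (\<epsilon> * e \<iota>))
    = (\<Sum>S\<in>Pow {..<r}. fhat f r S * t S)"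
    unfolding sum_mlderiv_mult mlext_def t_def
    by (simp only: right_diff_distrib sum_subtractf)
  also have "\<bar>\<dots>\<bar> \<le> (\<Sum>S\<in>Pow {..<r}. \<bar>fhat f r S\<bar> * \<bar>t S\<bar>)"
    by (rule order_trans[OF sum_abs]) (simp add: abs_mult)
  also have "\<dots> \<le> (\<Sum>S\<in>Pow {..<r}. \<bar>fhat f r S\<bar> * (\<epsilon>\<^sup>2 * (2 * ?R) ^ r))"
  proof (rule sum_mono, rule mult_left_mono)
    fix S assume S: "S \<in> Pow {..<r}"
    then have fS: "finite S" "card S \<le> r"
      using finite_subset[of S "{..<r}"] card_mono[of "{..<r}" S] by auto
    show "\<bar>t S\<bar> \<le> \<epsilon>\<^sup>2 * (2 * ?R) ^ r"
      unfolding t_def by (rule prod_taylor_le[OF fS _ \<epsilon>]) (use S yR n in auto)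
  qed simp
  also have "\<dots> = \<epsilon>\<^sup>2 * fhat_l1 f r * (2 * ?R) ^ r"
    by (simp only: fhat_l1_def sum_distrib_right[symmetric] mult_ac)
  finally show ?thesis .
qed

subsection \<open>Dependency sets and large girth\<close>

abbreviation mem :: "nat \<Rightarrow> (nat \<Rightarrow> nat \<Rightarrow> nat) \<Rightarrow> nat \<Rightarrow> nat set" where
  "mem r vtx a \<equiv> vtx a ` {..<r}"

lemma fac_iff: "a \<in> fac r E vtx i \<longleftrightarrow> a \<in> E \<and> i \<in> mem r vtx a"
  by (auto simp: fac_def)

text \<open>The variables whose initial values enter the messages of variable \<open>j\<close> to factor \<open>b\<close>
  up to time \<open>l\<close>.\<close>
primrec dep :: "nat \<Rightarrow> nat set \<Rightarrow> (nat \<Rightarrow> nat \<Rightarrow> nat) \<Rightarrow> nat \<Rightarrow> nat \<Rightarrow> nat \<Rightarrow> nat set" where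
  "dep r E vtx 0 j b = {j}"
| "dep r E vtx (Suc l) j b
    = insert j (\<Union>c\<in>fac r E vtx j - {b}. \<Union>k\<in>mem r vtx c - {j}. dep r E vtx l k c)"

text \<open>A non-backtracking walk in the incidence graph: \<open>n\<close> counts factors, so the
  walk has \<open>2 * n\<close> edges. Total functions make shifting, reversing and joining a matter
  of reindexing. Nothing is demanded where the ends meet: the first and last factor of a closed walk
  may coincide.\<close>

definition nbwalk :: "nat \<Rightarrow> nat set \<Rightarrow> (nat \<Rightarrow> nat \<Rightarrow> nat) \<Rightarrow> nat \<Rightarrow> (nat \<Rightarrow> nat) \<Rightarrow> (nat \<Rightarrow> nat) \<Rightarrow> bool" where
  "nbwalk r E vtx n y c \<longleftrightarrow>
     (\<forall>t<n. c t \<in> E \<and> y t \<in> mem r vtx (c t) \<and> y (Suc t) \<in> mem r vtx (c t) \<and> y t \<noteq> y (Suc t)) \<and>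
     (\<forall>t. Suc t < n \<longrightarrow> c t \<noteq> c (Suc t))"

lemma nbwalk_shift:
  assumes "nbwalk r E vtx n y c" "s + m \<le> n"
  shows "nbwalk r E vtx m (\<lambda>t. y (s + t)) (\<lambda>t. c (s + t))"
  using assms unfolding nbwalk_def by simp

lemma nbwalk_Cons:
  assumes "nbwalk r E vtx n y c" "a \<in> E" "j \<in> mem r vtx a" "y 0 \<in> mem r vtx a" "j \<noteq> y 0"
    "0 < n \<Longrightarrow> c 0 \<noteq> a"
  shows "nbwalk r E vtx (Suc n) (case_nat j y) (case_nat a c)"
  using assms unfolding nbwalk_def by (auto split: nat.splits simp: less_Suc_eq_0_disj)

lemma nbwalk_rev:
  assumes "nbwalk r E vtx n y c"
  shows "nbwalk r E vtx n (\<lambda>t. y (n - t)) (\<lambda>t. c (n - Suc t))"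
proof -
  have 1: "c t \<in> E \<and> y t \<in> mem r vtx (c t) \<and> y (Suc t) \<in> mem r vtx (c t) \<and> y t \<noteq> y (Suc t)" if "t < n" for t
    using assms that unfolding nbwalk_def by blast
  have 2: "c t \<noteq> c (Suc t)" if "Suc t < n" for t
    using assms that unfolding nbwalk_def by blast
  have "c (n - Suc t) \<in> E \<and> y (n - t) \<in> mem r vtx (c (n - Suc t)) \<and>
      y (n - Suc t) \<in> mem r vtx (c (n - Suc t)) \<and> y (n - t) \<noteq> y (n - Suc t)" if "t < n" for t
    using 1[of "n - Suc t"] that by (simp add: Suc_diff_Suc)
  moreover have "c (n - Suc t) \<noteq> c (n - Suc (Suc t))" if "Suc t < n" for t
    using 2[of "n - Suc (Suc t)"] that by (simp add: Suc_diff_Suc)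
  ultimately show ?thesis unfolding nbwalk_def by blast
qed

lemma nbwalk_append:
  assumes w: "nbwalk r E vtx n y c" "nbwalk r E vtx m y' c'" and e: "y n = y' 0"
    and c: "0 < n \<Longrightarrow> 0 < m \<Longrightarrow> c (n - 1) \<noteq> c' 0"
  shows "nbwalk r E vtx (n + m) (\<lambda>t. if t \<le> n then y t else y' (t - n)) (\<lambda>t. if t < n then c t else c' (t - n))"
    (is "nbwalk r E vtx _ ?y ?c")
proof -
  have 1: "c t \<in> E \<and> y t \<in> mem r vtx (c t) \<and> y (Suc t) \<in> mem r vtx (c t) \<and> y t \<noteq> y (Suc t)" if "t < n" for t
    using w(1) that unfolding nbwalk_def by blast
  have 2: "c' t \<in> E \<and> y' t \<in> mem r vtx (c' t) \<and> y' (Suc t) \<in> mem r vtx (c' t) \<and> y' t \<noteq> y' (Suc t)" if "t < m" for t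
    using w(2) that unfolding nbwalk_def by blast
  have 3: "t \<ge> n \<Longrightarrow> ?y t = y' (t - n)" for t using e by auto
  have "?c t \<in> E \<and> ?y t \<in> mem r vtx (?c t) \<and> ?y (Suc t) \<in> mem r vtx (?c t) \<and> ?y t \<noteq> ?y (Suc t)"
    if "t < n + m" for t
  proof (cases "t < n")
    case True
    then show ?thesis using 1[OF True] by simp
  next
    case False
    then have "?y t = y' (t - n)" "?y (Suc t) = y' (Suc (t - n))" "?c t = c' (t - n)"
      using 3[of t] 3[of "Suc t"] by (auto simp: Suc_diff_le)
    then show ?thesis using 2[of "t - n"] False that by simp
  qed
  moreover have "?c t \<noteq> ?c (Suc t)" if t: "Suc t < n + m" for t
  proof -
    consider "Suc t < n" | "Suc t = n" | "Suc t > n" by linarith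
    then show ?thesis
    proof cases
      case 1 then show ?thesis using w(1) by (simp add: nbwalk_def)
    next
      case 2 then show ?thesis using c t by auto
    next
      case 3
      then have "\<not> t < n" "\<not> Suc t < n" "Suc t - n = Suc (t - n)" "Suc (t - n) < m" using t by auto
      then show ?thesis using w(2) by (simp add: nbwalk_def)
    qed
  qed
  ultimately show ?thesis unfolding nbwalk_def by blast
qed

text \<open>A shortest closed walk that does not backtrack in its interior is a cycle: a repeated
  variable or a repeated factor would cut off a shorter closed walk of the same kind.\<close>
lemma closed_nbwalk_imp_cycle:
  assumes "nbwalk r E vtx n y c" "1 \<le> n" "y 0 = y n"
  shows "\<exists>k\<le>n. has_cycle_of_length r E vtx (2 * k)"
  using assms
proof (induction n arbitrary: y c rule: less_induct)
  case (less n)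
  note w = less.prems(1)
  have w1: "c t \<in> E" "y t \<in> mem r vtx (c t)" "y (Suc t) \<in> mem r vtx (c t)" "y t \<noteq> y (Suc t)" if "t < n" for t
    using w that unfolding nbwalk_def by blast+
  have w2: "c t \<noteq> c (Suc t)" if "Suc t < n" for t
    using w that unfolding nbwalk_def by blast
  show ?case
  proof (cases "\<exists>n'<n. \<exists>y' c'. nbwalk r E vtx n' y' c' \<and> 1 \<le> n' \<and> y' 0 = y' n'")
    case True
    then show ?thesis using less.IH by (meson less_imp_le order_trans)
  next
    case False
    then have short: False if "nbwalk r E vtx n' y' c'" "n' < n" "1 \<le> n'" "y' 0 = y' n'" for n' y' c'
      using that by blast
    \<comment> \<open>A closed walk through a single factor would have \<open>y 0 = y 1\<close>,
      against the distinctness of consecutive variables.\<close>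
    have n2: "2 \<le> n" using less.prems(2,3) w1(4)[of 0] by (cases "n = 1") auto
    have yd: "y s \<noteq> y t" if "s < t" "t \<le> n" "(s, t) \<noteq> (0, n)" for s t
    proof
      assume eq: "y s = y t"
      have "nbwalk r E vtx (t - s) (\<lambda>u. y (s + u)) (\<lambda>u. c (s + u))"
        by (rule nbwalk_shift[OF w]) (use that in simp)
      then show False by (rule short) (use that eq in auto)
    qed
    have cd: "c s \<noteq> c t" if "s < t" "t < n" for s t
    proof
      assume eq: "c s = c t"
      have st: "Suc s < t" using that eq w2[of s] by (metis Suc_lessI)
      \<comment> \<open>If a factor is met at times \<open>s < t\<close>, it contains both
        \<open>y (Suc s)\<close> and \<open>y t\<close>. Reversing the part between them and putting
        this factor in front yields a closed walk through \<open>t - s < n\<close> factors.\<close>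
      have "nbwalk r E vtx (t - Suc s) (\<lambda>u. y (Suc s + u)) (\<lambda>u. c (Suc s + u))"
        by (rule nbwalk_shift[OF w]) (use that in simp)
      from nbwalk_rev[OF this]
      have cut: "nbwalk r E vtx (Suc (t - Suc s)) (case_nat (y (Suc s)) (\<lambda>u. y (Suc s + (t - Suc s - u))))
         (case_nat (c t) (\<lambda>u. c (Suc s + (t - Suc s - Suc u))))"
      proof (rule nbwalk_Cons)
        show "c t \<in> E" using w1 that by blast
        show "y (Suc s) \<in> mem r vtx (c t)" using w1(3)[of s] that eq by simp
        show "y (Suc s + (t - Suc s - 0)) \<in> mem r vtx (c t)" using w1(2)[of t] that st by simp
        show "y (Suc s) \<noteq> y (Suc s + (t - Suc s - 0))" using yd[of "Suc s" t] that st by simp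
        have "Suc s + (t - Suc s - Suc 0) = t - 1" "Suc (t - 1) = t" using st by auto
        then show "c (Suc s + (t - Suc s - Suc 0)) \<noteq> c t" using w2[of "t - 1"] that by metis
      qed
      show False by (rule short[OF cut]) (use that st in auto)
    qed
    have yi: "inj_on y {..<n}"
      by (rule linorder_inj_onI) (use yd in auto)
    have ci: "inj_on c {..<n}"
      by (rule linorder_inj_onI) (use cd in auto)
    have "has_cycle_of_length r E vtx (2 * n)"
      unfolding has_cycle_of_length_def
    proof (intro exI conjI allI impI)
      show "length (map y [0..<n]) = n" "length (map c [0..<n]) = n" "2 * n = 2 * n" "2 \<le> n"
        using n2 by simp_all
      show "distinct (map y [0..<n])" "distinct (map c [0..<n])"
        using yi ci by (simp_all add: distinct_map atLeast0LessThan)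
      show "set (map c [0..<n]) \<subseteq> E" using w1(1) by auto
      fix j assume j: "j < n"
      show "map y [0..<n] ! j \<in> mem r vtx (map c [0..<n] ! j)" using w1(2)[OF j] j by simp
      \<comment> \<open>At the last factor the index wraps around to 0, where
        \<open>y 0 = y n\<close> supplies the incidence.\<close>
      have "y ((j + 1) mod n) = y (Suc j)"
        using j less.prems(3) by (cases "Suc j = n") auto
      then show "map y [0..<n] ! ((j + 1) mod n) \<in> mem r vtx (map c [0..<n] ! j)"
        using w1(3)[OF j] j n2 by simp
    qed
    then show ?thesis by blast
  qed
qed

text \<open>Each unfolding of \<open>dep\<close> passes through one factor, different from the one
  it came from. That the first factor is not \<open>b\<close> allows \<open>b\<close> to be put in
  front of the walk later.\<close>

lemma dep_imp_nbwalk: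
  assumes "v \<in> dep r E vtx l j b"
  shows "\<exists>n\<le>l. \<exists>y c. nbwalk r E vtx n y c \<and> y 0 = j \<and> y n = v \<and> (0 < n \<longrightarrow> c 0 \<noteq> b)"
  using assms
proof (induction l arbitrary: j b)
  case 0
  then show ?case by (auto simp: nbwalk_def)
next
  case (Suc l)
  show ?case
  proof (cases "v = j")
    case True
    have "nbwalk r E vtx 0 (\<lambda>_. j) c" for c by (simp add: nbwalk_def)
    then show ?thesis using True by (intro exI[of _ 0]) auto
  next
    case False
    then obtain a k where a: "a \<in> E" "j \<in> mem r vtx a" "a \<noteq> b"
      and k: "k \<in> mem r vtx a" "k \<noteq> j" "v \<in> dep r E vtx l k a"
      using Suc.prems unfolding dep.simps insert_iff UN_iff Bex_def Diff_iff fac_iff by blast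
    from Suc.IH[OF k(3)] obtain n y c where w: "n \<le> l" "nbwalk r E vtx n y c" "y 0 = k" "y n = v" "0 < n \<longrightarrow> c 0 \<noteq> a"
      by blast
    have "nbwalk r E vtx (Suc n) (case_nat j y) (case_nat a c)"
      by (rule nbwalk_Cons[OF w(2)]) (use a k w in auto)
    then show ?thesis using w a
      by (intro exI[of _ "Suc n"] conjI exI[of _ "case_nat j y"] exI[of _ "case_nat a c"]) auto
  qed
qed

text \<open>A common variable \<open>v\<close> would give a closed walk: from \<open>v\<close> back
  to \<open>k\<close>, through \<open>b\<close> to \<open>j\<close>, and on to \<open>v\<close>. It
  uses at most \<open>2 * L + 1\<close> factors, so the girth bound \<open>4 * L + 4\<close>
  excludes the resulting cycle.\<close>

lemma dep_disjoint:
  assumes g: "girth_ge r E vtx (4 * L + 4)" and l: "l \<le> L" "l' \<le> L"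
    and b: "b \<in> E" "j \<in> mem r vtx b" "k \<in> mem r vtx b" "j \<noteq> k"
  shows "dep r E vtx l j b \<inter> dep r E vtx l' k b = {}"
proof (rule ccontr)
  assume "\<not> ?thesis"
  then obtain v where v: "v \<in> dep r E vtx l j b" "v \<in> dep r E vtx l' k b" by auto
  from dep_imp_nbwalk[OF v(1)] obtain n y c where
    w: "n \<le> l" "nbwalk r E vtx n y c" "y 0 = j" "y n = v" "0 < n \<longrightarrow> c 0 \<noteq> b" by blast
  from dep_imp_nbwalk[OF v(2)] obtain m x e where
    u: "m \<le> l'" "nbwalk r E vtx m x e" "x 0 = k" "x m = v" "0 < m \<longrightarrow> e 0 \<noteq> b" by blast
  have 1: "nbwalk r E vtx (Suc n) (case_nat k y) (case_nat b c)"
    by (rule nbwalk_Cons[OF w(2)]) (use b w in auto)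
  have 2: "nbwalk r E vtx m (\<lambda>t. x (m - t)) (\<lambda>t. e (m - Suc t))" by (rule nbwalk_rev[OF u(2)])
  have "\<exists>i\<le>m + Suc n. has_cycle_of_length r E vtx (2 * i)"
    by (rule closed_nbwalk_imp_cycle[OF nbwalk_append[OF 2 1]]) (use u w in auto)
  then show False using g u(1) w(1) l unfolding girth_ge_def by fastforce
qed

lemma dep_self: "j \<in> dep r E vtx l j b"
  by (cases l) auto

lemma dep_mono: "l \<le> l' \<Longrightarrow> dep r E vtx l j b \<subseteq> dep r E vtx l' j b"
proof (induction l arbitrary: l' j b)
  case 0
  then show ?case using dep_self by auto
next
  case (Suc l)
  then obtain k where "l' = Suc k" "l \<le> k" by (cases l') auto
  then show ?case using Suc.IH[of k] by fastforce
qed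

lemma dep_branch_subset:
  "c \<in> fac r E vtx j \<Longrightarrow> c \<noteq> b \<Longrightarrow> k \<in> mem r vtx c \<Longrightarrow> k \<noteq> j \<Longrightarrow>
    dep r E vtx l k c \<subseteq> dep r E vtx (Suc l) j b"
  by auto

subsection \<open>Histories as functions of time\<close>

text \<open>Reading a history as a function of time turns "depends only on times up to
  \<open>l\<close>" into a congruence rule and removes all list indexing from the probabilistic
  part.\<close>

definition hA :: "(nat \<Rightarrow> real list \<Rightarrow> real) \<Rightarrow> (nat \<Rightarrow> real) \<Rightarrow> nat \<Rightarrow> real" where
  "hA G w l = G l (map (\<lambda>s. w (Suc s) - w s) [0..<l])"

definition hZ :: "(nat \<Rightarrow> real list \<Rightarrow> real) \<Rightarrow> real \<Rightarrow> (nat \<Rightarrow> real) \<Rightarrow> nat \<Rightarrow> real" where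
  "hZ G x w l = x + (\<Sum>s<l. hA G w s * (w (Suc s) - w s))"

lemma us_map: "us (map w [0..<Suc l]) = map (\<lambda>s. w (Suc s) - w s) [0..<l]"
  by (rule nth_equalityI) (auto simp: us_def nth_append simp del: upt_Suc)

lemma zval_map: "zval G x (map w [0..<Suc l]) = hZ G x w l"
proof -
  have "zval G x (map w [0..<Suc l])
    = x + (\<Sum>s\<in>{Suc 0..<Suc l}. G (s - 1) (take (s - 1) (us (map w [0..<Suc l]))) * (us (map w [0..<Suc l]) ! (s - 1)))"
    by (simp add: zval_def del: upt_Suc)
  also have "\<dots> = x + (\<Sum>s\<in>{0..<l}. G s (take s (us (map w [0..<Suc l]))) * (us (map w [0..<Suc l]) ! s))"
    by (subst sum.shift_bounds_Suc_ivl) simp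
  also have "\<dots> = hZ G x w l"
    by (simp add: hZ_def hA_def us_map take_map atLeast0LessThan del: upt_Suc)
  finally show ?thesis .
qed

lemma hA_cong: "(\<And>s. s \<le> l \<Longrightarrow> w s = w' s) \<Longrightarrow> hA G w l = hA G w' l"
  unfolding hA_def by (intro arg_cong[of _ _ "G l"] map_cong) auto

lemma hZ_cong: "x = x' \<Longrightarrow> (\<And>s. s \<le> l \<Longrightarrow> w s = w' s) \<Longrightarrow> hZ G x w l = hZ G x' w' l"
  unfolding hZ_def by (intro arg_cong2[of _ _ _ _ "(+)"] sum.cong arg_cong2[of _ _ _ _ "(*)"] hA_cong) auto

lemma hZ_Suc: "hZ G x w (Suc l) = hZ G x w l + hA G w l * (w (Suc l) - w l)"
  by (simp add: hZ_def)

lemma abs_hA_le: "good_nonlin K L G \<Longrightarrow> l < L \<Longrightarrow> \<bar>hA G w l\<bar> \<le> K"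
  by (simp add: good_nonlin_def hA_def)

lemma hA_measurable:
  assumes G: "good_nonlin K L G" "l < L" and w: "\<And>s. s \<le> l \<Longrightarrow> w s \<in> borel_measurable M"
  shows "(\<lambda>z. hA G (\<lambda>s. w s z) l) \<in> borel_measurable M"
proof -
  have g: "(\<lambda>x. G l (map x [0..<l])) \<in> borel_measurable (PiM {..<l} (\<lambda>_. borel))"
    using G by (auto simp: good_nonlin_def)
  \<comment> \<open>Measurability of \<open>G l\<close> is given on the product space over
    \<open>{..<l}\<close>, so the increments are restricted to that index set; the list over
    \<open>[0..<l]\<close> does not see the restriction.\<close>
  have "(\<lambda>z. \<lambda>s\<in>{..<l}. w (Suc s) z - w s z) \<in> measurable M (PiM {..<l} (\<lambda>_. borel))"
    by (rule measurable_restrict) (auto intro!: borel_measurable_diff w)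
  from measurable_compose[OF this g]
  have "(\<lambda>z. G l (map (\<lambda>s\<in>{..<l}. w (Suc s) z - w s z) [0..<l])) \<in> borel_measurable M" .
  also have "(\<lambda>z. G l (map (\<lambda>s\<in>{..<l}. w (Suc s) z - w s z) [0..<l])) = (\<lambda>z. hA G (\<lambda>s. w s z) l)"
    unfolding hA_def by (intro ext arg_cong[of _ _ "G l"] map_cong) auto
  finally show ?thesis .
qed

section \<open>The messages and node values on one fixed hypergraph\<close>

locale message_passing =
  fixes r :: nat and f :: "(nat \<Rightarrow> real) \<Rightarrow> real" and \<delta> K :: real and L d :: nat
    and V E :: "nat set" and vtx :: "nat \<Rightarrow> nat \<Rightarrow> nat" and F Fto :: "nat \<Rightarrow> real list \<Rightarrow> real"
  assumes fhat_singleton: "\<And>S. S \<subseteq> {..<r} \<Longrightarrow> card S = 1 \<Longrightarrow> fhat f r S = 0"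
    and \<delta>_pos: "\<delta> > 0" and d2: "d \<ge> 2" and regular: "index_regular r d V E vtx"
    and girth: "girth_ge r E vtx (4 * L + 4)"
    and F_good: "good_nonlin K L F" and Fto_good: "good_nonlin K L Fto"
begin

abbreviation "M \<equiv> gauss_init \<delta> V"
abbreviation "facs i \<equiv> fac r E vtx i"
abbreviation "mems a \<equiv> mem r vtx a"

text \<open>The outcome \<open>z\<close> is the last argument throughout, so that partial
  applications such as \<open>W t i a\<close> are random variables.\<close>

definition "W t i a z = wmh f r E vtx d Fto z t i a ! t"
definition "Z t j b z = zmsg f r E vtx d Fto z t j b"
definition "A t j b z = hA Fto (\<lambda>s. W s j b z) t"
definition "D t j c z = Dpart f r vtx c j (\<lambda>\<iota>. Z t (vtx c \<iota>) c z)"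
definition "Wn t i z = wnh f r E vtx d Fto z t i ! t"
definition "An t i z = hA F (\<lambda>s. Wn s i z) t"
definition "Zn t i z = znode f r E vtx d F Fto z t i"

sublocale prob_space M by (rule prob_space_gauss_init[OF \<delta>_pos])

lemma finite_V: "finite V" and finite_E: "finite E"
  and vtx_in: "a \<in> E \<Longrightarrow> \<iota> < r \<Longrightarrow> vtx a \<iota> \<in> V"
  and vtx_inj: "a \<in> E \<Longrightarrow> inj_on (vtx a) {..<r}"
  and card_facs: "i \<in> V \<Longrightarrow> card (facs i) = d"
  using regular by (auto simp: index_regular_def)

lemma finite_facs: "finite (facs i)"
  using finite_E by (simp add: fac_def)

lemma idx_vtx: "a \<in> E \<Longrightarrow> \<iota> < r \<Longrightarrow> idx r vtx a (vtx a \<iota>) = \<iota>"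
  unfolding idx_def by (rule the_equality) (auto dest: inj_onD[OF vtx_inj])

text \<open>A later history extends an earlier one, so the entry for time \<open>t\<close> is the
  same in all of them and \<open>W t\<close> describes the whole list.\<close>

lemma wmh_eq: "wmh f r E vtx d Fto z l i a = map (\<lambda>t. W t i a z) [0..<Suc l]"
proof (induction l)
  case 0
  then show ?case by (simp add: W_def)
next
  case (Suc l)
  let ?x = "1 / sqrt (real d - 1) * (\<Sum>b\<in>facs i - {a}.
        Dpart f r vtx b i (\<lambda>\<iota>. zval Fto (z (vtx b \<iota>)) (wmh f r E vtx d Fto z l (vtx b \<iota>) b)))"
  have e: "wmh f r E vtx d Fto z (Suc l) i a = map (\<lambda>t. W t i a z) [0..<Suc l] @ [?x]"
    by (simp only: wmh.simps Suc.IH)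
  then have "W (Suc l) i a z = ?x" unfolding W_def[of "Suc l"] by (simp only: e) (simp add: nth_append del: upt_Suc)
  then show ?case using e by simp
qed

lemma Z_eq: "Z t j b z = hZ Fto (z j) (\<lambda>s. W s j b z) t"
  by (simp only: Z_def zmsg_def wmh_eq zval_map)

lemma Amsg_eq: "Amsg f r E vtx d Fto z l i a = A l i a z"
  by (simp only: Amsg_def A_def hA_def wmh_eq us_map)

lemma W_0: "W 0 i a z = 0"
  by (simp add: W_def)

lemma W_Suc: "W (Suc l) i a z = 1 / sqrt (real d - 1) * (\<Sum>b\<in>facs i - {a}. D l i b z)"
proof -
  have "length (wmh f r E vtx d Fto z l i a) = Suc l" by (simp add: wmh_eq)
  then show ?thesis by (simp add: W_def nth_append D_def Z_def zmsg_def)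
qed

lemma Wn_0: "Wn 0 i z = 0"
  by (simp add: Wn_def wnh_def)

lemma Wn_Suc: "Wn (Suc l) i z = 1 / sqrt (real d) * (\<Sum>b\<in>facs i. D l i b z)"
  by (simp add: Wn_def wnh_def D_def Z_def del: upt_Suc)

lemma wnh_eq: "wnh f r E vtx d Fto z l i = map (\<lambda>t. Wn t i z) [0..<Suc l]"
proof (rule nth_equalityI)
  fix t assume "t < length (wnh f r E vtx d Fto z l i)"
  then have t: "t \<le> l" by (simp add: wnh_def del: upt_Suc)
  show "wnh f r E vtx d Fto z l i ! t = map (\<lambda>t. Wn t i z) [0..<Suc l] ! t"
  proof (cases t)
    case 0
    then show ?thesis using Wn_0 by (simp add: wnh_def del: upt_Suc)
  next
    case (Suc s)
    then show ?thesis using t Wn_Suc[of s] by (simp add: wnh_def D_def Z_def del: upt_Suc)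
  qed
qed (simp add: wnh_def del: upt_Suc)

lemma Anode_eq: "Anode f r E vtx d F Fto z l i = An l i z"
  by (simp only: Anode_def An_def hA_def wnh_eq us_map)

lemma Zn_eq: "Zn t i z = hZ F (z i) (\<lambda>s. Wn s i z) t"
  by (simp only: Zn_def znode_def wnh_eq zval_map)

lemma unode_eq: "unode f r E vtx d Fto z (Suc l) i = Wn (Suc l) i z - Wn l i z"
  by (simp add: unode_def wnh_eq del: upt_Suc)

lemma Z_0: "Z 0 j b z = z j"
  by (simp add: Z_eq hZ_def)

lemma Z_Suc: "Z (Suc t) j b z = Z t j b z + A t j b z * (W (Suc t) j b z - W t j b z)"
  by (simp add: Z_eq hZ_Suc A_def)

lemma D_sum: "D t j c z = (\<Sum>S\<in>{S\<in>Pow {..<r}. idx r vtx c j \<in> S}.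
    fhat f r S * (\<Prod>\<kappa>\<in>S - {idx r vtx c j}. Z t (vtx c \<kappa>) c z))"
  by (simp add: D_def Dpart_def mlderiv_def)

lemma vtx_neq:
  assumes "c \<in> E" "j \<in> mems c" "\<kappa> < r" "\<kappa> \<noteq> idx r vtx c j" shows "vtx c \<kappa> \<noteq> j"
  using assms(4) idx_vtx[OF assms(1,3)] by auto

lemma D_cong:
  assumes c: "c \<in> E" "j \<in> mems c" and Z: "\<And>k. k \<in> mems c - {j} \<Longrightarrow> Z t k c z = Z t k c z'"
  shows "D t j c z = D t j c z'"
  unfolding D_def Dpart_def by (rule mlderiv_cong) (use Z vtx_neq[OF c] in auto)

subsection \<open>Locality of the messages\<close>

text \<open>A derivative at \<open>j\<close> leaves out the message of \<open>j\<close> itself, so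
  only the other members of each factor \<open>c\<close> enter, and their dependency sets lie inside
  that of \<open>j\<close> one level up. The induction is strong because \<open>Z s\<close> contains
  the whole history up to \<open>s\<close>.\<close>

lemma W_local: "(\<And>v. v \<in> dep r E vtx t j b \<Longrightarrow> z v = z' v) \<Longrightarrow> W t j b z = W t j b z'"
proof (induction t arbitrary: j b rule: less_induct)
  case (less t)
  show ?case
  proof (cases t)
    case 0
    then show ?thesis by (simp add: W_0)
  next
    case (Suc s)
    have "D s j c z = D s j c z'" if c: "c \<in> facs j - {b}" for c
    proof (rule D_cong)
      fix k assume k: "k \<in> mems c - {j}"
      have sub: "dep r E vtx s k c \<subseteq> dep r E vtx t j b"
        unfolding Suc using dep_branch_subset c k by auto
      show "Z s k c z = Z s k c z'" unfolding Z_eq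
      proof (rule hZ_cong)
        show "z k = z' k" using less.prems sub dep_self by blast
        show "W u k c z = W u k c z'" if "u \<le> s" for u
        proof (rule less.IH)
          show "u < t" using that Suc by simp
          show "z v = z' v" if "v \<in> dep r E vtx u k c" for v
            using less.prems sub dep_mono[OF \<open>u \<le> s\<close>] that by blast
        qed
      qed
    qed (use c in \<open>auto simp: fac_iff\<close>)
    then show ?thesis unfolding Suc W_Suc by simp
  qed
qed

lemma Z_local:
  assumes "\<And>v. v \<in> dep r E vtx t j b \<Longrightarrow> z v = z' v"
  shows "Z t j b z = Z t j b z'"
  unfolding Z_eq
proof (rule hZ_cong)
  show "z j = z' j" using assms dep_self by blast
  show "W u j b z = W u j b z'" if "u \<le> t" for u
    using assms dep_mono[OF that] by (intro W_local) blast
qed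

text \<open>Invariance under \<open>sim t k c\<close> expresses measurability with respect to everything except the
  future of the message from \<open>k\<close> to \<open>c\<close> after time \<open>t\<close>.\<close>
definition sim :: "nat \<Rightarrow> nat \<Rightarrow> nat \<Rightarrow> (nat \<Rightarrow> real) \<Rightarrow> (nat \<Rightarrow> real) \<Rightarrow> bool" where
  "sim t k c z z' \<longleftrightarrow> (\<forall>v. v \<notin> dep r E vtx (Suc t) k c \<longrightarrow> z v = z' v) \<and> z k = z' k \<and>
     (\<forall>s\<le>t. W s k c z = W s k c z')"

lemma sim_Z: "sim t k c z z' \<Longrightarrow> s \<le> t \<Longrightarrow> Z s k c z = Z s k c z'"
  unfolding Z_eq sim_def by (intro hZ_cong) auto

lemma sim_A: "sim t k c z z' \<Longrightarrow> s \<le> t \<Longrightarrow> A s k c z = A s k c z'"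
  unfolding A_def sim_def by (intro hA_cong) auto

lemma sim_outside:
  assumes "sim t k c z z'" "X \<inter> dep r E vtx (Suc t) k c = {}" "v \<in> X"
  shows "z v = z' v"
  using assms unfolding sim_def by blast

text \<open>Related outcomes differ only inside \<open>dep r E vtx (Suc t) k c\<close>, which large
  girth separates from the dependency set of any other member of \<open>c\<close>. Hence
  \<open>u\<close> may exceed \<open>t\<close> and run up to \<open>L\<close>.\<close>

lemma sim_Z_other:
  assumes s: "sim t k c z z'" and c: "c \<in> E" "k \<in> mems c" "k' \<in> mems c" "k' \<noteq> k"
    and t: "Suc t \<le> L" "u \<le> L"
  shows "Z u k' c z = Z u k' c z'"
  by (rule Z_local, rule sim_outside[OF s]) (rule dep_disjoint[OF girth t(2,1) c(1,3,2,4)])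

lemma sim_D:
  assumes s: "sim t k c z z'" and c: "c \<in> facs j" "k \<in> mems c" "k \<noteq> j"
    and t: "Suc t \<le> L" "u \<le> t" and c': "c' \<in> facs j"
  shows "D u j c' z = D u j c' z'"
proof (rule D_cong)
  fix k' assume k': "k' \<in> mems c' - {j}"
  show "Z u k' c' z = Z u k' c' z'"
  proof (cases "c' = c")
    case True
    show ?thesis
    proof (cases "k' = k")
      case True
      then show ?thesis using \<open>c' = c\<close> sim_Z[OF s t(2)] by simp
    next
      case False
      then show ?thesis using \<open>c' = c\<close> k' c t by (auto intro!: sim_Z_other[OF s] simp: fac_iff)
    qed
  next
    case False
    \<comment> \<open>The branch through \<open>c'\<close> hangs on the side of \<open>j\<close>,
      hence inside the dependency set of the message from \<open>j\<close> to \<open>c\<close>; that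
      set is disjoint from the one of \<open>k\<close>.\<close>
    have "dep r E vtx u k' c' \<subseteq> dep r E vtx (Suc u) j c"
      using dep_branch_subset[OF c' False] k' by auto
    moreover have "dep r E vtx (Suc u) j c \<inter> dep r E vtx (Suc t) k c = {}"
      using dep_disjoint[OF girth _ t(1), of "Suc u" c j k] c t by (auto simp: fac_iff)
    ultimately show ?thesis by (intro Z_local sim_outside[OF s]) blast+
  qed
qed (use c' in \<open>auto simp: fac_iff\<close>)

text \<open>The bound is \<open>Suc t\<close> and not \<open>t\<close>: \<open>W (Suc t)\<close> at
  \<open>j\<close> is computed from messages of time \<open>t\<close>, and these are still
  frozen.\<close>

lemma sim_W:
  assumes s: "sim t k c z z'" and c: "c \<in> facs j" "k \<in> mems c" "k \<noteq> j" and t: "Suc t \<le> L" "u \<le> Suc t"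
  shows "W u j b z = W u j b z'"
proof (cases u)
  case (Suc u')
  then show ?thesis using t by (simp add: W_Suc sim_D[OF s c t(1), of u'])
qed (simp add: W_0)

lemma sim_Wn:
  assumes s: "sim t k c z z'" and c: "c \<in> facs j" "k \<in> mems c" "k \<noteq> j" and t: "Suc t \<le> L" "u \<le> Suc t"
  shows "Wn u j z = Wn u j z'"
proof (cases u)
  case (Suc u')
  then show ?thesis using t by (simp add: Wn_Suc sim_D[OF s c t(1), of u'])
qed (simp add: Wn_0)

text \<open>This makes the martingale induction run: a test function admissible for the message from
  \<open>j\<close> to \<open>b\<close> at time \<open>Suc t\<close> is admissible for each message
  feeding into it at time \<open>t\<close>.\<close>

lemma sim_branch:
  assumes s: "sim t k c z z'" and c: "c \<in> facs j" "c \<noteq> b" "k \<in> mems c" "k \<noteq> j" and t: "Suc t \<le> L"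
  shows "sim (Suc t) j b z z'"
proof -
  have "z v = z' v" if "v \<notin> dep r E vtx (Suc (Suc t)) j b" for v
    using that s dep_branch_subset[OF c, of "Suc t"] unfolding sim_def by blast
  moreover have "z j = z' j"
  proof (rule sim_outside[OF s])
    show "dep r E vtx 0 j c \<inter> dep r E vtx (Suc t) k c = {}"
      using dep_disjoint[OF girth _ t, of 0 c j k] c by (auto simp: fac_iff)
  qed simp
  ultimately show ?thesis using sim_W[OF s c(1,3,4) t] unfolding sim_def by blast
qed

subsection \<open>The messages are martingales\<close>

lemma fin_mom_coord: "k \<in> V \<Longrightarrow> fin_mom M (\<lambda>z. z k)"
  by (rule fin_momI[OF mom_bdd_gauss_init_coord[OF \<delta>_pos]])

lemma mom_bdd_A:
  assumes "t < L" "\<And>s. s \<le> t \<Longrightarrow> W s j b \<in> borel_measurable M"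
  shows "mom_bdd M (\<lambda>m. K ^ m) (A t j b)"
  unfolding A_def[abs_def] using assms
  by (intro mom_bdd_bounded hA_measurable[OF Fto_good] abs_hA_le[OF Fto_good])

lemma mom_bdd_An:
  assumes "t < L" "\<And>s. s \<le> t \<Longrightarrow> Wn s i \<in> borel_measurable M"
  shows "mom_bdd M (\<lambda>m. K ^ m) (An t i)"
  unfolding An_def[abs_def] using assms
  by (intro mom_bdd_bounded hA_measurable[OF F_good] abs_hA_le[OF F_good])

text \<open>The moments of \<open>W\<close> are a hypothesis because this is applied inside the
  induction that proves them finite.\<close>

lemma fin_mom_Z_aux:
  assumes "j \<in> V" "t \<le> L" "\<And>s. s \<le> t \<Longrightarrow> fin_mom M (W s j b)"
  shows "fin_mom M (Z t j b)"
proof -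
  have "fin_mom M (\<lambda>z. z j + (\<Sum>s<t. A s j b z * (W (Suc s) j b z - W s j b z)))"
    by (intro fin_mom_add fin_mom_coord fin_mom_sum fin_mom_mult fin_mom_diff
        fin_momI[OF mom_bdd_A] fin_mom_measurable) (use assms in auto)
  then show ?thesis by (simp add: Z_eq[abs_def] hZ_def A_def)
qed

lemma fin_mom_D_aux:
  assumes "c \<in> E" "\<And>k. k \<in> mems c \<Longrightarrow> fin_mom M (Z t k c)"
  shows "fin_mom M (D t j c)"
  unfolding D_sum[abs_def] by (intro fin_mom_sum fin_mom_cmult fin_mom_prod) (use assms in auto)

lemma fin_mom_W: "t \<le> L \<Longrightarrow> fin_mom M (W t j b)"
proof (induction t arbitrary: j b rule: less_induct)
  case (less t)
  show ?case
  proof (cases t)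
    case 0
    then show ?thesis by (simp add: W_0[abs_def] fin_mom_const)
  next
    case (Suc s)
    have "fin_mom M (D s j c)" if "c \<in> facs j" for c
      by (intro fin_mom_D_aux fin_mom_Z_aux) (use that less Suc vtx_in in \<open>auto simp: fac_iff\<close>)
    then show ?thesis unfolding Suc W_Suc[abs_def] by (intro fin_mom_cmult fin_mom_sum) auto
  qed
qed

lemma fin_mom_Z: "j \<in> V \<Longrightarrow> t \<le> L \<Longrightarrow> fin_mom M (Z t j b)"
  by (rule fin_mom_Z_aux) (auto intro: fin_mom_W)

lemma fin_mom_D: "c \<in> E \<Longrightarrow> t \<le> L \<Longrightarrow> fin_mom M (D t j c)"
  by (rule fin_mom_D_aux) (use vtx_in in \<open>auto intro: fin_mom_Z\<close>)

lemma fin_mom_A: "t < L \<Longrightarrow> fin_mom M (A t j b)"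
  by (rule fin_momI[OF mom_bdd_A]) (auto intro!: fin_mom_measurable fin_mom_W)

lemma fin_mom_Wn: "t \<le> L \<Longrightarrow> fin_mom M (Wn t i)"
proof (cases t)
  case 0
  then show ?thesis by (simp add: Wn_0[abs_def] fin_mom_const)
next
  case (Suc s)
  assume "t \<le> L"
  then show ?thesis unfolding Suc Wn_Suc[abs_def]
    by (intro fin_mom_cmult fin_mom_sum fin_mom_D) (auto simp: fac_iff)
qed

lemma fin_mom_An: "t < L \<Longrightarrow> fin_mom M (An t i)"
  by (rule fin_momI[OF mom_bdd_An]) (auto intro!: fin_mom_measurable fin_mom_Wn)

text \<open>Weak form of the statement that the increment at time \<open>Suc t\<close> has
  conditional expectation 0: the functions \<open>\<phi>\<close> invariant under
  \<open>sim t k c\<close> take the place of those measurable in the conditioning sigma-algebra. All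
  messages are covered at once, since the induction on \<open>t\<close> passes to messages one level
  deeper.\<close>

definition mart_step :: "nat \<Rightarrow> bool" where
  "mart_step t \<longleftrightarrow> (\<forall>k c \<phi>. fin_mom M \<phi> \<longrightarrow> (\<forall>z z'. sim t k c z z' \<longrightarrow> \<phi> z = \<phi> z') \<longrightarrow>
     (\<integral>z. \<phi> z * (W (Suc t) k c z - W t k c z) \<partial>M) = 0)"

text \<open>One factor is changed at a time: \<open>Z' P' - Z P = (Z' - Z) P' + Z (P' - P)\<close>.
  In the first part \<open>Z' - Z\<close> is \<open>A\<close> times an increment of one message, and
  \<open>\<phi> * P' * A\<close> is a test function for it because \<open>P'\<close> comes from
  other members of \<open>c\<close>. The second part is the induction hypothesis for the test
  function \<open>\<phi> * Z\<close>, hence the generality in \<open>\<phi>\<close>.\<close>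

lemma prod_increment:
  assumes mg: "mart_step t" and t: "Suc t \<le> L" and c: "c \<in> E" and T: "T \<subseteq> {..<r}"
    and \<phi>: "fin_mom M \<phi>" "\<And>k z z'. k \<in> vtx c ` T \<Longrightarrow> sim t k c z z' \<Longrightarrow> \<phi> z = \<phi> z'"
  shows "(\<integral>z. \<phi> z * ((\<Prod>\<kappa>\<in>T. Z (Suc t) (vtx c \<kappa>) c z) - (\<Prod>\<kappa>\<in>T. Z t (vtx c \<kappa>) c z)) \<partial>M) = 0"
  using finite_subset[OF T finite_lessThan] T \<phi>
proof (induction T arbitrary: \<phi> rule: finite_induct)
  case empty
  then show ?case by simp
next
  case (insert \<kappa> T)
  define k where "k = vtx c \<kappa>"
  have k: "k \<in> mems c" "k \<in> V" using insert.prems(1) vtx_in c by (auto simp: k_def)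
  have TV: "vtx c \<kappa>' \<in> V" "vtx c \<kappa>' \<in> mems c" if "\<kappa>' \<in> T" for \<kappa>'
    using insert.prems(1) vtx_in c that by auto
  have ne: "vtx c \<kappa>' \<noteq> k" if "\<kappa>' \<in> T" for \<kappa>'
    using inj_onD[OF vtx_inj[OF c], of \<kappa>' \<kappa>] insert.hyps(2) insert.prems(1) that by (auto simp: k_def)
  define P' where "P' z = (\<Prod>\<kappa>\<in>T. Z (Suc t) (vtx c \<kappa>) c z)" for z
  define P where "P z = (\<Prod>\<kappa>\<in>T. Z t (vtx c \<kappa>) c z)" for z
  have fP: "fin_mom M P'" "fin_mom M P"
    unfolding P'_def P_def using t TV by (auto intro!: fin_mom_prod fin_mom_Z)
  have fU: "fin_mom M (\<lambda>z. W (Suc t) k c z - W t k c z)"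
    using t by (auto intro!: fin_mom_diff fin_mom_W)
  have fA: "fin_mom M (A t k c)" and fZ: "fin_mom M (Z t k c)"
    using t k by (auto intro: fin_mom_A fin_mom_Z)
  have "(\<integral>z. (\<phi> z * P' z * A t k c z) * (W (Suc t) k c z - W t k c z) \<partial>M) = 0"
  proof (rule mg[unfolded mart_step_def, rule_format])
    show "fin_mom M (\<lambda>z. \<phi> z * P' z * A t k c z)" by (intro fin_mom_mult insert.prems fP fA)
    fix z z' assume s: "sim t k c z z'"
    have "P' z = P' z'" unfolding P'_def
      by (rule prod.cong[OF refl], rule sim_Z_other[OF s c k(1)]) (use TV ne t in auto)
    then show "\<phi> z * P' z * A t k c z = \<phi> z' * P' z' * A t k c z'"
      using sim_A[OF s order_refl] insert.prems(3)[of k z z'] s by (simp add: k_def)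
  qed
  moreover have "(\<integral>z. (\<phi> z * Z t k c z) * (P' z - P z) \<partial>M) = 0"
    unfolding P'_def P_def
  proof (rule insert.IH)
    show "T \<subseteq> {..<r}" using insert.prems by simp
    show "fin_mom M (\<lambda>z. \<phi> z * Z t k c z)" by (intro fin_mom_mult insert.prems fZ)
    fix k' z z' assume k': "k' \<in> vtx c ` T" and s: "sim t k' c z z'"
    obtain \<kappa>' where \<kappa>': "\<kappa>' \<in> T" "k' = vtx c \<kappa>'" using k' by auto
    have "Z t k c z = Z t k c z'"
      by (rule sim_Z_other[OF s c _ k(1)]) (use \<kappa>' TV[OF \<kappa>'(1)] ne[OF \<kappa>'(1)] t in simp_all)
    then show "\<phi> z * Z t k c z = \<phi> z' * Z t k c z'"
      using insert.prems(3)[of k' z z'] s k' by auto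
  qed
  moreover have "(\<integral>z. (\<phi> z * P' z * A t k c z) * (W (Suc t) k c z - W t k c z)
      + (\<phi> z * Z t k c z) * (P' z - P z) \<partial>M)
    = (\<integral>z. (\<phi> z * P' z * A t k c z) * (W (Suc t) k c z - W t k c z) \<partial>M)
      + (\<integral>z. (\<phi> z * Z t k c z) * (P' z - P z) \<partial>M)"
    by (intro Bochner_Integration.integral_add fin_mom_integrable fin_mom_mult fin_mom_diff
        insert.prems fP fA fZ fU)
  moreover have "\<phi> z * ((\<Prod>\<kappa>\<in>insert \<kappa> T. Z (Suc t) (vtx c \<kappa>) c z) - (\<Prod>\<kappa>\<in>insert \<kappa> T. Z t (vtx c \<kappa>) c z))
    = (\<phi> z * P' z * A t k c z) * (W (Suc t) k c z - W t k c z) + (\<phi> z * Z t k c z) * (P' z - P z)" for z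
    using insert.hyps by (simp add: P'_def P_def k_def Z_Suc[of t "vtx c \<kappa>"] algebra_simps)
  ultimately show ?case by simp
qed

text \<open>One coordinate is singled out and integrated; the members of a factor are distinct, so
  the remaining product does not involve it.\<close>

lemma prod_initial:
  assumes c: "c \<in> E" and T: "T \<subseteq> {..<r}" "T \<noteq> {}"
    and \<phi>: "fin_mom M \<phi>" "\<And>k z x. k \<in> vtx c ` T \<Longrightarrow> \<phi> (z(k := x)) = \<phi> z"
  shows "(\<integral>z. \<phi> z * (\<Prod>\<kappa>\<in>T. Z 0 (vtx c \<kappa>) c z) \<partial>M) = 0"
proof -
  obtain \<kappa> where \<kappa>: "\<kappa> \<in> T" using T(2) by auto
  have fin: "finite T" using T(1) finite_subset by auto
  have ne: "vtx c \<kappa>' \<noteq> vtx c \<kappa>" if "\<kappa>' \<in> T - {\<kappa>}" for \<kappa>'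
    using inj_onD[OF vtx_inj[OF c], of \<kappa>' \<kappa>] T(1) \<kappa> that by auto
  have "(\<integral>z. (\<phi> z * (\<Prod>\<kappa>'\<in>T - {\<kappa>}. z (vtx c \<kappa>'))) * z (vtx c \<kappa>) \<partial>M) = 0"
  proof (rule integral_mult_gauss_coord_eq_0[OF \<delta>_pos finite_V])
    show "vtx c \<kappa> \<in> V" using \<kappa> T(1) vtx_in c by auto
    show "fin_mom M (\<lambda>z. \<phi> z * (\<Prod>\<kappa>'\<in>T - {\<kappa>}. z (vtx c \<kappa>')))"
      by (intro fin_mom_mult \<phi> fin_mom_prod fin_mom_coord) (use T(1) vtx_in c in auto)
    show "\<phi> (z(vtx c \<kappa> := x)) * (\<Prod>\<kappa>'\<in>T - {\<kappa>}. (z(vtx c \<kappa> := x)) (vtx c \<kappa>'))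
       = \<phi> z * (\<Prod>\<kappa>'\<in>T - {\<kappa>}. z (vtx c \<kappa>'))" for z x
      using \<phi>(2) \<kappa> ne by (intro arg_cong2[of _ _ _ _ "(*)"] prod.cong) auto
  qed
  moreover have "(\<Prod>\<kappa>\<in>T. Z 0 (vtx c \<kappa>) c z) = (\<Prod>\<kappa>'\<in>T - {\<kappa>}. z (vtx c \<kappa>')) * z (vtx c \<kappa>)" for z
    using prod.remove[OF fin \<kappa>, of "\<lambda>\<kappa>. z (vtx c \<kappa>)"] by (simp add: Z_0 mult.commute)
  ultimately show ?thesis by (simp add: mult.assoc)
qed

text \<open>Here the vanishing of the degree-one coefficients is used: they are the constant terms
  of the derivatives, so only nonempty products remain. \<open>P\<close> stands for any family
  indexed by monomials: products at one time, or their increments, multiplied by a test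
  function.\<close>

lemma D_integral_0:
  assumes c: "c \<in> E" "j \<in> mems c"
    and P: "\<And>S. fin_mom M (P S)"
    and 0: "\<And>T. T \<subseteq> {..<r} \<Longrightarrow> T \<noteq> {} \<Longrightarrow> j \<notin> vtx c ` T \<Longrightarrow> (\<integral>z. P T z \<partial>M) = 0"
  shows "(\<integral>z. (\<Sum>S\<in>{S\<in>Pow {..<r}. idx r vtx c j \<in> S}. fhat f r S * P (S - {idx r vtx c j}) z) \<partial>M) = 0"
proof -
  let ?\<iota> = "idx r vtx c j"
  have "(\<integral>z. (\<Sum>S\<in>{S\<in>Pow {..<r}. ?\<iota> \<in> S}. fhat f r S * P (S - {?\<iota>}) z) \<partial>M)
    = (\<Sum>S\<in>{S\<in>Pow {..<r}. ?\<iota> \<in> S}. \<integral>z. fhat f r S * P (S - {?\<iota>}) z \<partial>M)"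
    by (intro integral_sum_fin_mom fin_mom_cmult P)
  also have "\<dots> = 0"
  proof (rule sum.neutral, rule ballI)
    fix S assume S: "S \<in> {S\<in>Pow {..<r}. ?\<iota> \<in> S}"
    show "(\<integral>z. fhat f r S * P (S - {?\<iota>}) z \<partial>M) = 0"
    proof (cases "S = {?\<iota>}")
      case True
      then have "fhat f r S = 0" using S by (intro fhat_singleton) auto
      then show ?thesis by simp
    next
      case False
      then have "(\<integral>z. P (S - {?\<iota>}) z \<partial>M) = 0" using S vtx_neq[OF c] by (intro 0) auto
      then show ?thesis by simp
    qed
  qed
  finally show ?thesis .
qed

lemma D_increment:
  assumes mg: "mart_step t" and t: "Suc t \<le> L" and c: "c \<in> E" "j \<in> mems c"
    and \<phi>: "fin_mom M \<phi>" "\<And>k z z'. k \<in> mems c \<Longrightarrow> k \<noteq> j \<Longrightarrow> sim t k c z z' \<Longrightarrow> \<phi> z = \<phi> z'"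
  shows "(\<integral>z. \<phi> z * (D (Suc t) j c z - D t j c z) \<partial>M) = 0"
proof -
  \<comment> \<open>The default 0 gives \<open>P T\<close> finite moments for every
    \<open>T\<close>, as \<open>D_integral_0\<close> asks; only subsets of \<open>{..<r}\<close>
    occur in the derivative.\<close>
  define P where "P T z = (if T \<subseteq> {..<r} then
    \<phi> z * ((\<Prod>\<kappa>\<in>T. Z (Suc t) (vtx c \<kappa>) c z) - (\<Prod>\<kappa>\<in>T. Z t (vtx c \<kappa>) c z)) else 0)" for T z
  have "(\<integral>z. (\<Sum>S\<in>{S\<in>Pow {..<r}. idx r vtx c j \<in> S}. fhat f r S * P (S - {idx r vtx c j}) z) \<partial>M) = 0"
  proof (rule D_integral_0[OF c])
    show "fin_mom M (P T)" for T
    proof (cases "T \<subseteq> {..<r}")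
      case True
      then show ?thesis unfolding P_def[abs_def]
        using t vtx_in[OF c(1)] by (auto intro!: fin_mom_mult fin_mom_diff fin_mom_prod fin_mom_Z \<phi>)
    qed (simp add: P_def[abs_def] fin_mom_const)
    show "(\<integral>z. P T z \<partial>M) = 0" if T: "T \<subseteq> {..<r}" "j \<notin> vtx c ` T" for T
    proof -
      have "(\<integral>z. \<phi> z * ((\<Prod>\<kappa>\<in>T. Z (Suc t) (vtx c \<kappa>) c z) - (\<Prod>\<kappa>\<in>T. Z t (vtx c \<kappa>) c z)) \<partial>M) = 0"
      proof (rule prod_increment[OF mg t c(1) T(1) \<phi>(1)])
        fix k z z' assume "k \<in> vtx c ` T" "sim t k c z z'"
        moreover from this have "k \<in> mems c" "k \<noteq> j" using T by auto
        ultimately show "\<phi> z = \<phi> z'" using \<phi>(2) by blast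
      qed
      then show ?thesis using T by (simp add: P_def)
    qed
  qed
  moreover have "\<phi> z * (D (Suc t) j c z - D t j c z)
    = (\<Sum>S\<in>{S\<in>Pow {..<r}. idx r vtx c j \<in> S}. fhat f r S * P (S - {idx r vtx c j}) z)" for z
    unfolding D_sum sum_subtractf[symmetric] sum_distrib_left
    by (intro sum.cong refl) (auto simp: P_def algebra_simps)
  ultimately show ?thesis by simp
qed

lemma D_initial:
  assumes c: "c \<in> E" "j \<in> mems c"
    and \<phi>: "fin_mom M \<phi>" "\<And>k z x. k \<in> mems c \<Longrightarrow> k \<noteq> j \<Longrightarrow> \<phi> (z(k := x)) = \<phi> z"
  shows "(\<integral>z. \<phi> z * D 0 j c z \<partial>M) = 0"
proof -
  define P where "P T z = (if T \<subseteq> {..<r} then \<phi> z * (\<Prod>\<kappa>\<in>T. Z 0 (vtx c \<kappa>) c z) else 0)" for T z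
  have "(\<integral>z. (\<Sum>S\<in>{S\<in>Pow {..<r}. idx r vtx c j \<in> S}. fhat f r S * P (S - {idx r vtx c j}) z) \<partial>M) = 0"
  proof (rule D_integral_0[OF c])
    show "fin_mom M (P T)" for T
    proof (cases "T \<subseteq> {..<r}")
      case True
      then show ?thesis unfolding P_def[abs_def]
        using vtx_in[OF c(1)] by (auto intro!: fin_mom_mult fin_mom_prod fin_mom_Z \<phi>)
    qed (simp add: P_def[abs_def] fin_mom_const)
    show "(\<integral>z. P T z \<partial>M) = 0" if T: "T \<subseteq> {..<r}" "T \<noteq> {}" "j \<notin> vtx c ` T" for T
    proof -
      have "(\<integral>z. \<phi> z * (\<Prod>\<kappa>\<in>T. Z 0 (vtx c \<kappa>) c z) \<partial>M) = 0"
      proof (rule prod_initial[OF c(1) T(1,2) \<phi>(1)])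
        fix k z x assume "k \<in> vtx c ` T"
        then have "k \<in> mems c" "k \<noteq> j" using T by auto
        then show "\<phi> (z(k := x)) = \<phi> z" by (rule \<phi>(2))
      qed
      then show ?thesis using T by (simp add: P_def)
    qed
  qed
  moreover have "\<phi> z * D 0 j c z
    = (\<Sum>S\<in>{S\<in>Pow {..<r}. idx r vtx c j \<in> S}. fhat f r S * P (S - {idx r vtx c j}) z)" for z
    unfolding D_sum sum_distrib_left
    by (intro sum.cong refl) (auto simp: P_def algebra_simps)
  ultimately show ?thesis by simp
qed

text \<open>An increment of \<open>W\<close> is the normalised sum over branches of increments of
  \<open>D\<close> one time step earlier, and \<open>sim_branch\<close> hands the test function down
  to each branch. At time 0 the increment is the sum of the \<open>D 0\<close>, and the centred
  Gaussian coordinates make it vanish.\<close>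

lemma mart_step: "Suc t \<le> L \<Longrightarrow> mart_step t"
proof (induction t)
  case 0
  show ?case unfolding mart_step_def
  proof (intro allI impI)
    fix j b \<phi> assume \<phi>: "fin_mom M \<phi>" "\<forall>z z'. sim 0 j b z z' \<longrightarrow> \<phi> z = \<phi> z'"
    have "(\<integral>z. \<phi> z * D 0 j c z \<partial>M) = 0" if c: "c \<in> facs j - {b}" for c
    proof (rule D_initial)
      fix k z x assume k: "k \<in> mems c" "k \<noteq> j"
      have "k \<in> dep r E vtx (Suc 0) j b" using c k by auto
      \<comment> \<open>The history up to time 0 is the constant 0, so changing a single coordinate
        other than \<open>j\<close> inside the dependency set respects \<open>sim 0\<close>.\<close>
      then have "sim 0 j b (z(k := x)) z" using k unfolding sim_def by (auto simp: W_0)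
      then show "\<phi> (z(k := x)) = \<phi> z" using \<phi>(2) by blast
    qed (use c \<phi> in \<open>auto simp: fac_iff\<close>)
    then have "(\<integral>z. (\<Sum>c\<in>facs j - {b}. \<phi> z * D 0 j c z) \<partial>M) = 0"
      by (subst integral_sum_fin_mom) (auto intro!: fin_mom_mult \<phi> fin_mom_D simp: fac_iff)
    moreover have "\<phi> z * (W (Suc 0) j b z - W 0 j b z)
      = 1 / sqrt (real d - 1) * (\<Sum>c\<in>facs j - {b}. \<phi> z * D 0 j c z)" for z
      by (simp add: W_Suc W_0 sum_distrib_left)
    ultimately show "(\<integral>z. \<phi> z * (W (Suc 0) j b z - W 0 j b z) \<partial>M) = 0" by simp
  qed
next
  case (Suc t)
  then have mg: "mart_step t" by simp
  show ?case unfolding mart_step_def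
  proof (intro allI impI)
    fix j b \<phi> assume \<phi>: "fin_mom M \<phi>" "\<forall>z z'. sim (Suc t) j b z z' \<longrightarrow> \<phi> z = \<phi> z'"
    have "(\<integral>z. \<phi> z * (D (Suc t) j c z - D t j c z) \<partial>M) = 0" if c: "c \<in> facs j - {b}" for c
    proof (rule D_increment[OF mg])
      fix k z z' assume k: "k \<in> mems c" "k \<noteq> j" and s: "sim t k c z z'"
      have "sim (Suc t) j b z z'" using c Suc.prems by (intro sim_branch[OF s _ _ k]) auto
      then show "\<phi> z = \<phi> z'" using \<phi>(2) by blast
    qed (use c \<phi> Suc.prems in \<open>auto simp: fac_iff\<close>)
    then have "(\<integral>z. (\<Sum>c\<in>facs j - {b}. \<phi> z * (D (Suc t) j c z - D t j c z)) \<partial>M) = 0"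
      using Suc.prems
      by (subst integral_sum_fin_mom) (auto intro!: fin_mom_mult fin_mom_diff \<phi> fin_mom_D simp: fac_iff)
    moreover have "\<phi> z * (W (Suc (Suc t)) j b z - W (Suc t) j b z)
      = 1 / sqrt (real d - 1) * (\<Sum>c\<in>facs j - {b}. \<phi> z * (D (Suc t) j c z - D t j c z))" for z
      by (simp add: W_Suc sum_distrib_left[symmetric] sum_subtractf diff_divide_distrib[symmetric]
          right_diff_distrib[symmetric])
    ultimately show "(\<integral>z. \<phi> z * (W (Suc (Suc t)) j b z - W (Suc t) j b z) \<partial>M) = 0" by simp
  qed
qed

lemma W_increment_orthogonal:
  assumes "Suc t \<le> L" "fin_mom M \<phi>" "\<And>z z'. sim t k c z z' \<Longrightarrow> \<phi> z = \<phi> z'"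
  shows "(\<integral>z. \<phi> z * (W (Suc t) k c z - W t k c z) \<partial>M) = 0"
  using mart_step[OF assms(1)] assms(2,3) unfolding mart_step_def by blast

text \<open>Telescoping over the times from \<open>s\<close> to \<open>t\<close>; the test function
  must be admissible at every intermediate time.\<close>

lemma D_increments_orthogonal:
  assumes s: "s \<le> t" and t: "t \<le> L" and c: "c \<in> E" "j \<in> mems c" and \<phi>: "fin_mom M \<phi>"
    and inv: "\<And>u k z z'. s \<le> u \<Longrightarrow> u < t \<Longrightarrow> k \<in> mems c \<Longrightarrow> k \<noteq> j \<Longrightarrow> sim u k c z z' \<Longrightarrow> \<phi> z = \<phi> z'"
  shows "(\<integral>z. \<phi> z * (D t j c z - D s j c z) \<partial>M) = 0"
proof -
  have "(\<integral>z. (\<Sum>u\<in>{s..<t}. \<phi> z * (D (Suc u) j c z - D u j c z)) \<partial>M)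
    = (\<Sum>u\<in>{s..<t}. \<integral>z. \<phi> z * (D (Suc u) j c z - D u j c z) \<partial>M)"
    by (intro integral_sum_fin_mom fin_mom_mult \<phi> fin_mom_diff fin_mom_D c) (use t in auto)
  also have "\<dots> = 0"
  proof (intro sum.neutral ballI D_increment[OF mart_step] c \<phi>)
    fix u k z z' assume "u \<in> {s..<t}" "k \<in> mems c" "k \<noteq> j" "sim u k c z z'"
    then show "\<phi> z = \<phi> z'" by (intro inv[of u k]) auto
  qed (use t in auto)
  also have "(\<lambda>z. \<Sum>u\<in>{s..<t}. \<phi> z * (D (Suc u) j c z - D u j c z)) = (\<lambda>z. \<phi> z * (D t j c z - D s j c z))"
    by (simp add: sum_distrib_left[symmetric] sum_Suc_diff'[OF s, of "\<lambda>u. D u j c z" for z])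
  finally show ?thesis .
qed

lemma prod_orthogonal:
  assumes t: "t \<le> L" and c: "c \<in> E" and T: "T \<subseteq> {..<r}" "T \<noteq> {}" and \<phi>: "fin_mom M \<phi>"
    and inv: "\<And>k z z'. k \<in> vtx c ` T \<Longrightarrow> (\<And>v. v \<notin> dep r E vtx t k c \<Longrightarrow> z v = z' v) \<Longrightarrow> \<phi> z = \<phi> z'"
  shows "(\<integral>z. \<phi> z * (\<Prod>\<kappa>\<in>T. Z t (vtx c \<kappa>) c z) \<partial>M) = 0"
  using t inv
proof (induction t)
  case 0
  show ?case
  proof (rule prod_initial[OF c T \<phi>])
    fix k z x assume "k \<in> vtx c ` T"
    then show "\<phi> (z(k := x)) = \<phi> z" by (rule 0(2)) simp
  qed
next
  case (Suc t)
  have fZ: "fin_mom M (\<lambda>z. \<Prod>\<kappa>\<in>T. Z u (vtx c \<kappa>) c z)" if "u \<le> Suc t" for u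
    using that Suc.prems(1) T(1) vtx_in[OF c] by (intro fin_mom_prod fin_mom_Z) auto
  have "(\<integral>z. \<phi> z * ((\<Prod>\<kappa>\<in>T. Z (Suc t) (vtx c \<kappa>) c z) - (\<Prod>\<kappa>\<in>T. Z t (vtx c \<kappa>) c z)) \<partial>M) = 0"
  proof (rule prod_increment[OF mart_step[OF Suc.prems(1)] Suc.prems(1) c T(1) \<phi>])
    fix k z z' assume k: "k \<in> vtx c ` T" and s: "sim t k c z z'"
    from k show "\<phi> z = \<phi> z'" by (rule Suc.prems(2)) (use s in \<open>simp add: sim_def\<close>)
  qed
  moreover have "(\<integral>z. \<phi> z * (\<Prod>\<kappa>\<in>T. Z t (vtx c \<kappa>) c z) \<partial>M) = 0"
  proof (rule Suc.IH)
    show "t \<le> L" using Suc.prems by simp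
    fix k and z z' :: "nat \<Rightarrow> real" assume "k \<in> vtx c ` T" "\<And>v. v \<notin> dep r E vtx t k c \<Longrightarrow> z v = z' v"
    moreover have "dep r E vtx t k c \<subseteq> dep r E vtx (Suc t) k c" by (rule dep_mono) simp
    ultimately show "\<phi> z = \<phi> z'" by (intro Suc.prems(2)[of k]) blast+
  qed
  moreover have "(\<integral>z. \<phi> z * ((\<Prod>\<kappa>\<in>T. Z (Suc t) (vtx c \<kappa>) c z) - (\<Prod>\<kappa>\<in>T. Z t (vtx c \<kappa>) c z)) \<partial>M)
    = (\<integral>z. \<phi> z * (\<Prod>\<kappa>\<in>T. Z (Suc t) (vtx c \<kappa>) c z) \<partial>M) - (\<integral>z. \<phi> z * (\<Prod>\<kappa>\<in>T. Z t (vtx c \<kappa>) c z) \<partial>M)"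
    unfolding right_diff_distrib
    by (intro Bochner_Integration.integral_diff fin_mom_integrable fin_mom_mult \<phi> fZ) auto
  ultimately show ?case by simp
qed

lemma D_orthogonal:
  assumes t: "t \<le> L" and c: "c \<in> E" "j \<in> mems c" and \<phi>: "fin_mom M \<phi>"
    and inv: "\<And>k z z'. k \<in> mems c \<Longrightarrow> k \<noteq> j \<Longrightarrow> (\<And>v. v \<notin> dep r E vtx t k c \<Longrightarrow> z v = z' v) \<Longrightarrow> \<phi> z = \<phi> z'"
  shows "(\<integral>z. \<phi> z * D t j c z \<partial>M) = 0"
proof -
  define P where "P T z = (if T \<subseteq> {..<r} then \<phi> z * (\<Prod>\<kappa>\<in>T. Z t (vtx c \<kappa>) c z) else 0)" for T z
  have "(\<integral>z. (\<Sum>S\<in>{S\<in>Pow {..<r}. idx r vtx c j \<in> S}. fhat f r S * P (S - {idx r vtx c j}) z) \<partial>M) = 0"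
  proof (rule D_integral_0[OF c])
    show "fin_mom M (P T)" for T
    proof (cases "T \<subseteq> {..<r}")
      case True
      then show ?thesis unfolding P_def[abs_def]
        using t vtx_in[OF c(1)] by (auto intro!: fin_mom_mult fin_mom_prod fin_mom_Z \<phi>)
    qed (simp add: P_def[abs_def] fin_mom_const)
    show "(\<integral>z. P T z \<partial>M) = 0" if T: "T \<subseteq> {..<r}" "T \<noteq> {}" "j \<notin> vtx c ` T" for T
    proof -
      have "(\<integral>z. \<phi> z * (\<Prod>\<kappa>\<in>T. Z t (vtx c \<kappa>) c z) \<partial>M) = 0"
      proof (rule prod_orthogonal[OF t c(1) T(1,2) \<phi>])
        fix k and z z' :: "nat \<Rightarrow> real" assume "k \<in> vtx c ` T" and eq: "\<And>v. v \<notin> dep r E vtx t k c \<Longrightarrow> z v = z' v"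
        then have "k \<in> mems c" "k \<noteq> j" using T by auto
        then show "\<phi> z = \<phi> z'" by (rule inv) (rule eq)
      qed
      then show ?thesis using T by (simp add: P_def)
    qed
  qed
  moreover have "\<phi> z * D t j c z
    = (\<Sum>S\<in>{S\<in>Pow {..<r}. idx r vtx c j \<in> S}. fhat f r S * P (S - {idx r vtx c j}) z)" for z
    unfolding D_sum sum_distrib_left
    by (intro sum.cong refl) (auto simp: P_def algebra_simps)
  ultimately show ?thesis by simp
qed

end

subsection \<open>Uniform moment bounds\<close>

text \<open>The operations on bounds mirror the operations on random variables, so that the bound of
  a composed expression has the shape of the expression and visibly contains neither
  \<open>d\<close> nor the hypergraph.\<close>

definition bd_add :: "(nat \<Rightarrow> real) \<Rightarrow> (nat \<Rightarrow> real) \<Rightarrow> nat \<Rightarrow> real" where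
  "bd_add C D m = 2 ^ m * (C m + D m)"

definition bd_mult :: "(nat \<Rightarrow> real) \<Rightarrow> (nat \<Rightarrow> real) \<Rightarrow> nat \<Rightarrow> real" where
  "bd_mult C D m = C (2 * m) + D (2 * m)"

definition bd_sum :: "nat \<Rightarrow> (nat \<Rightarrow> real) \<Rightarrow> nat \<Rightarrow> real" where
  "bd_sum n C m = 1 + real n ^ m * (real n * \<bar>C m\<bar>)"

definition bd_D :: "((nat \<Rightarrow> real) \<Rightarrow> real) \<Rightarrow> nat \<Rightarrow> (nat \<Rightarrow> real) \<Rightarrow> nat \<Rightarrow> real" where
  "bd_D f r C m = fhat_l1 f r ^ m * bd_add (\<lambda>m. 1) (bd_sum r C) (r * m)"

text \<open>The constant of \<open>martingale_sum_even_moment\<close> after division by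
  \<open>n ^ m\<close>; the leading 1 comes from
  \<open>\<bar>x\<bar>^m \<le> 1 + x^(2m)\<close>.\<close>

definition bd_martingale :: "(nat \<Rightarrow> real) \<Rightarrow> nat \<Rightarrow> real" where
  "bd_martingale C m = 1 + 2 * 4 ^ m * exp (4 ^ m) * C (2 * m)"

text \<open>A pair, because the two bounds are mutually recursive: \<open>W\<close> at the next time
  needs \<open>Z\<close>, and \<open>Z\<close> at the next time needs \<open>W\<close> at both
  times.\<close>

primrec bd_WZ :: "((nat \<Rightarrow> real) \<Rightarrow> real) \<Rightarrow> nat \<Rightarrow> real \<Rightarrow> real \<Rightarrow> nat \<Rightarrow> (nat \<Rightarrow> real) \<times> (nat \<Rightarrow> real)" where
  "bd_WZ f r \<delta> K 0 = (\<lambda>m. 1, gauss_abs_moment \<delta>)"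
| "bd_WZ f r \<delta> K (Suc t) =
     (bd_martingale (bd_D f r (snd (bd_WZ f r \<delta> K t))),
      bd_add (snd (bd_WZ f r \<delta> K t)) (bd_mult (\<lambda>m. K ^ m)
        (bd_add (bd_martingale (bd_D f r (snd (bd_WZ f r \<delta> K t)))) (fst (bd_WZ f r \<delta> K t)))))"

abbreviation "bd_W f r \<delta> K t \<equiv> fst (bd_WZ f r \<delta> K t)"
abbreviation "bd_Z f r \<delta> K t \<equiv> snd (bd_WZ f r \<delta> K t)"

primrec bd_Wdiff :: "((nat \<Rightarrow> real) \<Rightarrow> real) \<Rightarrow> nat \<Rightarrow> real \<Rightarrow> real \<Rightarrow> nat \<Rightarrow> nat \<Rightarrow> real" where
  "bd_Wdiff f r \<delta> K 0 = (\<lambda>m. 1)"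
| "bd_Wdiff f r \<delta> K (Suc t) = bd_add (bd_D f r (bd_Z f r \<delta> K t)) (bd_W f r \<delta> K (Suc t))"

text \<open>Bounds for sqrt d times the difference of node value and message; \<open>Cm\<close> is
  the family of constants of Property (P1).\<close>

primrec bd_Zdiff :: "((nat \<Rightarrow> real) \<Rightarrow> real) \<Rightarrow> nat \<Rightarrow> real \<Rightarrow> real \<Rightarrow> (nat \<Rightarrow> real) \<Rightarrow> nat \<Rightarrow> nat \<Rightarrow> real" where
  "bd_Zdiff f r \<delta> K Cm 0 = (\<lambda>m. 1)"
| "bd_Zdiff f r \<delta> K Cm (Suc t) = bd_add (bd_Zdiff f r \<delta> K Cm t)
     (bd_add (bd_mult Cm (bd_add (bd_W f r \<delta> K (Suc t)) (bd_W f r \<delta> K t)))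
       (bd_mult (\<lambda>m. K ^ m) (bd_add (bd_Wdiff f r \<delta> K (Suc t)) (bd_Wdiff f r \<delta> K t))))"

lemma mom_bdd_bd_add:
  "mom_bdd M C X \<Longrightarrow> mom_bdd M D Y \<Longrightarrow> mom_bdd M (bd_add C D) (\<lambda>z. X z + Y z)"
  unfolding bd_add_def[abs_def] by (rule mom_bdd_add)

lemma mom_bdd_bd_diff:
  "mom_bdd M C X \<Longrightarrow> mom_bdd M D Y \<Longrightarrow> mom_bdd M (bd_add C D) (\<lambda>z. X z - Y z)"
  using mom_bdd_bd_add[of M C X D "\<lambda>z. - Y z"] mom_bdd_minus by fastforce

lemma mom_bdd_bd_mult:
  "mom_bdd M C X \<Longrightarrow> mom_bdd M D Y \<Longrightarrow> mom_bdd M (bd_mult C D) (\<lambda>z. X z * Y z)"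
  unfolding bd_mult_def[abs_def] by (rule mom_bdd_mult)

lemma (in prob_space) mom_bdd_bd_sum:
  "finite I \<Longrightarrow> card I \<le> n \<Longrightarrow> (\<And>i. i \<in> I \<Longrightarrow> mom_bdd M C (X i)) \<Longrightarrow>
    mom_bdd M (bd_sum n C) (\<lambda>z. \<Sum>i\<in>I. X i z)"
  unfolding bd_sum_def[abs_def] by (rule mom_bdd_sum)

lemma (in prob_space) mom_bdd_const_le_1: "\<bar>c\<bar> \<le> 1 \<Longrightarrow> mom_bdd M (\<lambda>m. 1) (\<lambda>z. c)"
  using mom_bdd_bounded[of "\<lambda>z. c" 1] by simp

lemma (in prob_space) mom_bdd_one_plus_sum_abs:
  assumes "\<And>\<kappa>. \<kappa> < r \<Longrightarrow> mom_bdd M C (Y \<kappa>)"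
  shows "mom_bdd M (bd_add (\<lambda>m. 1) (bd_sum r C)) (\<lambda>z. 1 + (\<Sum>\<kappa><r. \<bar>Y \<kappa> z\<bar>))"
  by (intro mom_bdd_bd_add mom_bdd_const_le_1 mom_bdd_bd_sum mom_bdd_abs) (use assms in auto)

lemma (in prob_space) mom_bdd_mlderiv:
  assumes Y: "\<And>\<kappa>. \<kappa> < r \<Longrightarrow> mom_bdd M C (Y \<kappa>)"
  shows "mom_bdd M (bd_D f r C) (\<lambda>z. mlderiv f r \<iota> (\<lambda>\<kappa>. Y \<kappa> z))"
proof (rule mom_bdd_le)
  show "mom_bdd M (bd_D f r C) (\<lambda>z. fhat_l1 f r * (1 + (\<Sum>\<kappa><r. \<bar>Y \<kappa> z\<bar>)) ^ r)"
    unfolding bd_D_def[abs_def]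
    by (intro mom_bdd_scale mom_bdd_power mom_bdd_one_plus_sum_abs Y) (simp_all add: abs_of_nonneg[OF fhat_l1_nonneg])
  have "Y \<kappa> \<in> borel_measurable M" if "\<kappa> < r" for \<kappa> using mom_bddD(1)[OF Y[OF that]] .
  then show "(\<lambda>z. mlderiv f r \<iota> (\<lambda>\<kappa>. Y \<kappa> z)) \<in> borel_measurable M"
    unfolding mlderiv_def by (intro borel_measurable_sum borel_measurable_times borel_measurable_prod) auto
  show "\<bar>mlderiv f r \<iota> (\<lambda>\<kappa>. Y \<kappa> z)\<bar> \<le> \<bar>fhat_l1 f r * (1 + (\<Sum>\<kappa><r. \<bar>Y \<kappa> z\<bar>)) ^ r\<bar>" for z
    by (rule order_trans[OF abs_mlderiv_le abs_ge_self])
qed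

text \<open>Only even moments of positive order are available from the martingale bound; the others
  follow from \<open>\<bar>x\<bar>^m \<le> 1 + x^(2m)\<close>, with order 0 treated apart.\<close>

lemma (in prob_space) mom_bdd_of_even:
  assumes X: "fin_mom M X" and e: "\<And>m. 1 \<le> m \<Longrightarrow> (\<integral>z. X z ^ (2 * m) \<partial>M) \<le> e m" "\<And>m. 0 \<le> e m"
  shows "mom_bdd M (\<lambda>m. 1 + e m) X"
proof (rule mom_bddI[where Y="\<lambda>m z. if m = 0 then 1 else 1 + X z ^ (2 * m)"])
  have i: "integrable M (\<lambda>z. X z ^ (2 * m))" for m by (intro fin_mom_integrable fin_mom_power X)
  fix m
  show "integrable M (\<lambda>z. if m = 0 then 1 else 1 + X z ^ (2 * m))" using i by (cases "m = 0") auto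
  show "(\<integral>z. (if m = 0 then 1 else 1 + X z ^ (2 * m)) \<partial>M) \<le> 1 + e m"
    using i e by (cases "m = 0") (auto simp: prob_space)
  fix z
  show "\<bar>X z\<bar> ^ m \<le> (if m = 0 then 1 else 1 + X z ^ (2 * m))"
  proof (cases "\<bar>X z\<bar> ^ m \<le> 1")
    case True
    then show ?thesis by (simp add: add_increasing2 zero_le_even_power)
  next
    case False
    then have "\<bar>X z\<bar> ^ m * 1 \<le> \<bar>X z\<bar> ^ m * \<bar>X z\<bar> ^ m" by (intro mult_left_mono) auto
    also have "\<dots> = X z ^ (2 * m)" by (simp add: mult_2 power_add[symmetric] power_even_abs)
    finally show ?thesis by auto
  qed
qed (rule fin_mom_measurable[OF X])

section \<open>Moments of messages, node values and their differences\<close>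

context message_passing
begin

lemma mom_bdd_D:
  assumes "c \<in> E" "\<And>k. k \<in> mems c \<Longrightarrow> mom_bdd M C (Z t k c)"
  shows "mom_bdd M (bd_D f r C) (D t j c)"
  unfolding D_def[abs_def] Dpart_def by (rule mom_bdd_mlderiv) (use assms in auto)

lemma D_local_branch:
  assumes c: "c \<in> facs i" "b \<in> facs i" "b \<noteq> c" "k \<in> mems c" "k \<noteq> i" and t: "Suc t \<le> L"
    and eq: "\<And>v. v \<notin> dep r E vtx t k c \<Longrightarrow> z v = z' v"
  shows "D t i b z = D t i b z'"
proof (rule D_cong)
  fix k' assume k': "k' \<in> mems b - {i}"
  have "dep r E vtx t k' b \<subseteq> dep r E vtx (Suc t) i c"
    using dep_branch_subset[OF c(2,3)] k' by auto
  moreover have "dep r E vtx (Suc t) i c \<inter> dep r E vtx t k c = {}"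
    using dep_disjoint[OF girth t, of t c i k] c t by (auto simp: fac_iff)
  ultimately show "Z t k' b z = Z t k' b z'" by (intro Z_local eq) blast
qed (use c in \<open>auto simp: fac_iff\<close>)

text \<open>The partial sum over other branches at \<open>i\<close> does not change when variables
  behind a member \<open>k\<close> of \<open>c\<close> change, so \<open>D_orthogonal\<close>
  provides the required orthogonality.\<close>

lemma branch_sum_even_moment:
  assumes t: "Suc t \<le> L" and B: "B \<subseteq> facs i" "card B \<le> n" and nm: "1 \<le> n" "1 \<le> m"
    and C: "\<And>b. b \<in> B \<Longrightarrow> mom_bdd M C (D t i b)" "0 \<le> C (2 * m)"
  shows "(\<integral>z. (\<Sum>b\<in>B. D t i b z) ^ (2 * m) \<partial>M) \<le> 2 * 4 ^ m * exp (4 ^ m) * C (2 * m) * real n ^ m"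
proof (rule martingale_sum_even_moment)
  show "finite B" using B(1) finite_facs finite_subset by blast
  show "fin_mom M (D t i b)" if "b \<in> B" for b using C(1)[OF that] by (rule fin_momI)
  show "(\<integral>z. D t i b z ^ (2 * m) \<partial>M) \<le> C (2 * m)" if "b \<in> B" for b
    using mom_bdd_power_integral(2)[OF C(1)[OF that]] .
  fix A' c assume A': "A' \<subseteq> B" and c: "c \<in> B - A'"
  have cE: "c \<in> E" "i \<in> mems c" "c \<in> facs i" using c B by (auto simp: fac_iff)
  show "(\<integral>z. (\<Sum>b\<in>A'. D t i b z) ^ (2 * m - 1) * D t i c z \<partial>M) = 0"
  proof (rule D_orthogonal[OF _ cE(1,2)])
    show "fin_mom M (\<lambda>z. (\<Sum>b\<in>A'. D t i b z) ^ (2 * m - 1))"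
      by (intro fin_mom_power fin_mom_sum fin_momI[OF C(1)]) (use A' in auto)
    fix k and z z' :: "nat \<Rightarrow> real"
    assume k: "k \<in> mems c" "k \<noteq> i" and eq: "\<And>v. v \<notin> dep r E vtx t k c \<Longrightarrow> z v = z' v"
    have "D t i b z = D t i b z'" if "b \<in> A'" for b
      by (rule D_local_branch[OF cE(3) _ _ k t eq]) (use that A' c B in auto)
    then show "(\<Sum>b\<in>A'. D t i b z) ^ (2 * m - 1) = (\<Sum>b\<in>A'. D t i b z') ^ (2 * m - 1)"
      by simp
  qed (use t in simp)
qed (use B nm C in \<open>auto intro: prob_space_axioms\<close>)

text \<open>The normalisation cancels \<open>n ^ m\<close> exactly. It is applied with
  \<open>n = d - 1\<close> for messages and \<open>n = d\<close> for nodes, giving both the same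
  bound.\<close>

lemma mom_bdd_branch_sum:
  assumes t: "Suc t \<le> L" and B: "B \<subseteq> facs i" "card B \<le> n" and n: "1 \<le> n"
    and C: "\<And>b. b \<in> B \<Longrightarrow> mom_bdd M C (D t i b)" "\<And>m. 0 \<le> C m"
  shows "mom_bdd M (bd_martingale C) (\<lambda>z. 1 / sqrt (real n) * (\<Sum>b\<in>B. D t i b z))"
  unfolding bd_martingale_def[abs_def]
proof (rule mom_bdd_of_even)
  show "fin_mom M (\<lambda>z. 1 / sqrt (real n) * (\<Sum>b\<in>B. D t i b z))"
    by (intro fin_mom_cmult fin_mom_sum fin_momI[OF C(1)])
  show "0 \<le> 2 * 4 ^ m * exp (4 ^ m) * C (2 * m)" for m using C(2) by simp
  fix m :: nat assume m: "1 \<le> m"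
  have s: "(1 / sqrt (real n)) ^ (2 * m) = 1 / real n ^ m"
    by (simp add: power_mult power_divide)
  have "(\<integral>z. (1 / sqrt (real n) * (\<Sum>b\<in>B. D t i b z)) ^ (2 * m) \<partial>M)
    = 1 / real n ^ m * (\<integral>z. (\<Sum>b\<in>B. D t i b z) ^ (2 * m) \<partial>M)"
    by (simp only: power_mult_distrib s) simp
  also have "\<dots> \<le> 1 / real n ^ m * (2 * 4 ^ m * exp (4 ^ m) * C (2 * m) * real n ^ m)"
    by (rule mult_left_mono[OF branch_sum_even_moment[OF t B n m C(1) C(2)]]) auto
  also have "\<dots> = 2 * 4 ^ m * exp (4 ^ m) * C (2 * m)" using n by simp
  finally show "(\<integral>z. (1 / sqrt (real n) * (\<Sum>b\<in>B. D t i b z)) ^ (2 * m) \<partial>M)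
    \<le> 2 * 4 ^ m * exp (4 ^ m) * C (2 * m)" .
qed

lemma bd_D_nonneg:
  assumes "\<And>m. 0 \<le> C m" shows "0 \<le> bd_D f r C m"
  using fhat_l1_nonneg[of f r] by (simp add: bd_D_def bd_add_def bd_sum_def)

lemma mom_bdd_W_Z:
  assumes "t \<le> L" "i \<in> V" "a \<in> facs i"
  shows "mom_bdd M (bd_W f r \<delta> K t) (W t i a) \<and> mom_bdd M (bd_Z f r \<delta> K t) (Z t i a)"
  using assms
proof (induction t arbitrary: i a)
  case 0
  then show ?case
    using mom_bdd_const_le_1[of 0] mom_bdd_gauss_init_coord[OF \<delta>_pos] by (simp add: W_0[abs_def] Z_0[abs_def])
next
  case (Suc t)
  have D: "mom_bdd M (bd_D f r (bd_Z f r \<delta> K t)) (D t i b)" if "b \<in> facs i - {a}" for b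
  proof (rule mom_bdd_D)
    fix k assume "k \<in> mems b"
    then show "mom_bdd M (bd_Z f r \<delta> K t) (Z t k b)"
      using Suc.IH[of k b] Suc.prems(1) that vtx_in by (auto simp: fac_iff)
  qed (use that in \<open>auto simp: fac_iff\<close>)
  \<comment> \<open>A function bounding moments is nonnegative; the message \<open>Z t i a\<close>
    itself is the witness.\<close>
  have nn: "0 \<le> bd_Z f r \<delta> K t m" for m
    using Suc.IH[OF _ Suc.prems(2,3)] Suc.prems(1) mom_bddD(4)[of M "bd_Z f r \<delta> K t" "Z t i a" m] by simp
  have n: "card (facs i - {a}) \<le> d - 1"
    using card_facs[OF Suc.prems(2)] Suc.prems(3) finite_facs by simp
  have "mom_bdd M (bd_martingale (bd_D f r (bd_Z f r \<delta> K t)))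
     (\<lambda>z. 1 / sqrt (real (d - 1)) * (\<Sum>b\<in>facs i - {a}. D t i b z))"
    by (rule mom_bdd_branch_sum[OF Suc.prems(1) _ n _ D bd_D_nonneg])
       (use d2 nn in auto)
  then have W: "mom_bdd M (bd_W f r \<delta> K (Suc t)) (W (Suc t) i a)"
    using d2 by (simp add: W_Suc[abs_def] of_nat_diff)
  have W0: "mom_bdd M (bd_W f r \<delta> K t) (W t i a)" and Z0: "mom_bdd M (bd_Z f r \<delta> K t) (Z t i a)"
    using Suc.IH[of i a] Suc.prems by auto
  have A: "mom_bdd M (\<lambda>m. K ^ m) (A t i a)"
    using Suc.prems by (intro mom_bdd_A fin_mom_measurable fin_mom_W) auto
  have "mom_bdd M (bd_Z f r \<delta> K (Suc t)) (\<lambda>z. Z t i a z + A t i a z * (W (Suc t) i a z - W t i a z))"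
    using W unfolding bd_WZ.simps snd_conv fst_conv
    by (intro mom_bdd_bd_add mom_bdd_bd_mult mom_bdd_bd_diff Z0 A W0)
  then show ?case using W by (simp add: Z_Suc[abs_def])
qed

lemma mom_bdd_D_uniform:
  assumes "c \<in> E" "t \<le> L" shows "mom_bdd M (bd_D f r (bd_Z f r \<delta> K t)) (D t j c)"
proof (rule mom_bdd_D[OF assms(1)])
  fix k assume "k \<in> mems c"
  then show "mom_bdd M (bd_Z f r \<delta> K t) (Z t k c)"
    using mom_bdd_W_Z[of t k c] assms vtx_in by (auto simp: fac_iff)
qed

lemma mom_bdd_Wn:
  assumes "t \<le> L" "i \<in> V" shows "mom_bdd M (bd_W f r \<delta> K t) (Wn t i)"
proof (cases t)
  case 0
  then show ?thesis using mom_bdd_const_le_1[of 0] by (simp add: Wn_0[abs_def])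
next
  case (Suc s)
  have D: "mom_bdd M (bd_D f r (bd_Z f r \<delta> K s)) (D s i b)" if "b \<in> facs i" for b
    using that assms Suc by (intro mom_bdd_D_uniform) (auto simp: fac_iff)
  have "facs i \<noteq> {}" using card_facs[OF assms(2)] d2 by auto
  then have nn: "0 \<le> bd_D f r (bd_Z f r \<delta> K s) m" for m
    using D mom_bddD(4) by blast
  show ?thesis unfolding Suc Wn_Suc[abs_def] bd_WZ.simps fst_conv
    by (rule mom_bdd_branch_sum) (use assms Suc card_facs d2 D nn in auto)
qed

text \<open>The two sums differ in the single term \<open>D s i a\<close>. The different
  normalisations add the multiple \<open>q\<close> of \<open>W\<close>, and
  \<open>\<bar>q\<bar> \<le> 1\<close> because neighbouring square roots differ by at most
  1.\<close>

lemma mom_bdd_W_diff: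
  assumes t: "t \<le> L" and i: "i \<in> V" "a \<in> facs i"
  shows "mom_bdd M (bd_Wdiff f r \<delta> K t) (\<lambda>z. sqrt (real d) * (Wn t i z - W t i a z))"
proof (cases t)
  case 0
  then show ?thesis using mom_bdd_const_le_1[of 0] by (simp add: Wn_0 W_0)
next
  case (Suc s)
  define q where "q = sqrt (real d - 1) - sqrt (real d)"
  have p: "0 < sqrt (real d - 1)" "0 < sqrt (real d)" using d2 by auto
  have "sqrt (real d) \<le> sqrt (real d - 1) + sqrt 1"
    using sqrt_add_le_add_sqrt[of "real d - 1" 1] d2 by simp
  moreover have "sqrt (real d - 1) \<le> sqrt (real d)" by simp
  ultimately have q: "\<bar>q\<bar> \<le> 1" by (simp add: q_def)
  have eq: "sqrt (real d) * (Wn t i z - W t i a z) = D s i a z + q * W t i a z" for z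
  proof -
    have "sqrt (real d) * Wn t i z = (\<Sum>b\<in>facs i. D s i b z)"
      using p by (simp add: Suc Wn_Suc)
    also have "\<dots> = D s i a z + (\<Sum>b\<in>facs i - {a}. D s i b z)"
      by (rule sum.remove[OF finite_facs i(2)])
    also have "(\<Sum>b\<in>facs i - {a}. D s i b z) = sqrt (real d - 1) * W t i a z"
      using p by (simp add: Suc W_Suc)
    finally show ?thesis by (simp add: q_def algebra_simps)
  qed
  have W: "mom_bdd M (bd_W f r \<delta> K t) (\<lambda>z. q * W t i a z)"
  proof (rule mom_bdd_le)
    show W: "mom_bdd M (bd_W f r \<delta> K t) (W t i a)" using mom_bdd_W_Z[OF t i] by simp
    show "(\<lambda>z. q * W t i a z) \<in> borel_measurable M" using mom_bddD(1)[OF W] by simp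
    show "\<bar>q * W t i a z\<bar> \<le> \<bar>W t i a z\<bar>" for z
      using mult_right_mono[OF q, of "\<bar>W t i a z\<bar>"] by (simp add: abs_mult)
  qed
  have "mom_bdd M (bd_D f r (bd_Z f r \<delta> K s)) (D s i a)"
    using i t Suc by (intro mom_bdd_D_uniform) (auto simp: fac_iff)
  from mom_bdd_bd_add[OF this W] show ?thesis by (simp only: eq) (simp only: Suc bd_Wdiff.simps)
qed

lemma Zn_0: "Zn 0 i z = z i"
  by (simp add: Zn_eq hZ_def)

lemma Zn_Suc: "Zn (Suc t) i z = Zn t i z + An t i z * (Wn (Suc t) i z - Wn t i z)"
  by (simp add: Zn_eq hZ_Suc An_def)

text \<open>Property (P1) in rescaled form: \<open>sqrt d ^ m\<close> cancels
  \<open>d powr (- m / 2)\<close>.\<close>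

lemma mom_bdd_A_diff:
  assumes t: "t < L"
    and P1: "\<And>m. (\<integral>z. \<bar>An t i z - A t i a z\<bar> ^ m \<partial>M) \<le> Cm m * real d powr (- real m / 2)"
  shows "mom_bdd M Cm (\<lambda>z. sqrt (real d) * (An t i z - A t i a z))"
proof -
  have fm: "fin_mom M (\<lambda>z. An t i z - A t i a z)"
    using t by (intro fin_mom_diff fin_mom_An fin_mom_A)
  then obtain C where C: "mom_bdd M C (\<lambda>z. An t i z - A t i a z)" by (auto simp: fin_mom_def)
  show ?thesis
  proof (rule mom_bddI[where Y="\<lambda>m z. sqrt (real d) ^ m * \<bar>An t i z - A t i a z\<bar> ^ m"])
    show "(\<lambda>z. sqrt (real d) * (An t i z - A t i a z)) \<in> borel_measurable M"
      using fin_mom_measurable[OF fm] by simp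
    fix m
    show "integrable M (\<lambda>z. sqrt (real d) ^ m * \<bar>An t i z - A t i a z\<bar> ^ m)"
      using mom_bddD(2)[OF C] by simp
    have "sqrt (real d) ^ m * real d powr (- real m / 2) = 1"
    proof -
      have "sqrt (real d) ^ m = (real d powr (1 / 2)) powr real m"
        using d2 by (simp add: powr_realpow powr_half_sqrt)
      also have "\<dots> = real d powr (real m / 2)" by (simp add: powr_powr)
      finally show ?thesis using d2 by (simp flip: powr_add)
    qed
    then have "sqrt (real d) ^ m * (Cm m * real d powr (- real m / 2)) = Cm m"
      by (simp add: mult.left_commute)
    moreover have "sqrt (real d) ^ m * (\<integral>z. \<bar>An t i z - A t i a z\<bar> ^ m \<partial>M)
      \<le> sqrt (real d) ^ m * (Cm m * real d powr (- real m / 2))"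
      by (rule mult_left_mono[OF P1]) simp
    ultimately show "(\<integral>z. sqrt (real d) ^ m * \<bar>An t i z - A t i a z\<bar> ^ m \<partial>M) \<le> Cm m"
      by (simp only: integral_mult_right_zero)
  qed (simp add: abs_mult power_mult_distrib)
qed

text \<open>With \<open>U\<close> and \<open>u\<close> the node and message increments, the new
  difference is \<open>An U - A u = (An - A) U + A (U - u)\<close>; the factor sqrt d goes to the
  difference in each product.\<close>

lemma mom_bdd_Z_diff:
  assumes t: "t \<le> L" and i: "i \<in> V" "a \<in> facs i"
    and P1: "\<And>m l. l < L \<Longrightarrow> (\<integral>z. \<bar>An l i z - A l i a z\<bar> ^ m \<partial>M) \<le> Cm m * real d powr (- real m / 2)"
  shows "mom_bdd M (bd_Zdiff f r \<delta> K Cm t) (\<lambda>z. sqrt (real d) * (Zn t i z - Z t i a z))"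
  using t
proof (induction t)
  case 0
  then show ?case using mom_bdd_const_le_1[of 0] by (simp add: Zn_0 Z_0)
next
  case (Suc t)
  let ?s = "sqrt (real d)"
  have eq: "?s * (Zn (Suc t) i z - Z (Suc t) i a z) = ?s * (Zn t i z - Z t i a z)
    + ((?s * (An t i z - A t i a z)) * (Wn (Suc t) i z - Wn t i z)
      + A t i a z * (?s * (Wn (Suc t) i z - W (Suc t) i a z) - ?s * (Wn t i z - W t i a z)))" for z
    by (simp add: Zn_Suc Z_Suc algebra_simps)
  have "mom_bdd M (\<lambda>m. K ^ m) (A t i a)"
    using Suc.prems by (intro mom_bdd_A fin_mom_measurable fin_mom_W) auto
  then show ?case unfolding eq bd_Zdiff.simps
    by (intro mom_bdd_bd_add mom_bdd_bd_mult mom_bdd_bd_diff mom_bdd_A_diff mom_bdd_Wn mom_bdd_W_diff P1 i)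
       (use Suc in auto)
qed

end

text \<open>The constant of the theorem: the Taylor remainder without its factor
  \<open>\<epsilon>\<^sup>2\<close>, with the power of its base replaced by a bound for the
  \<open>r\<close>-th moment.\<close>

definition bd_taylor :: "((nat \<Rightarrow> real) \<Rightarrow> real) \<Rightarrow> nat \<Rightarrow> real \<Rightarrow> real \<Rightarrow> (nat \<Rightarrow> real) \<Rightarrow> nat \<Rightarrow> real" where
  "bd_taylor f r \<delta> K Cm L = fhat_l1 f r * (2 ^ r *
     bd_add (bd_add (\<lambda>m. 1) (bd_sum r (bd_Z f r \<delta> K L))) (bd_sum r (bd_Zdiff f r \<delta> K Cm L)) r)"

context message_passing
begin

subsection \<open>The expansion to first order\<close>

lemma integral_mlext_Z:
  assumes a: "a \<in> E"
  shows "(\<integral>z. mlext f r (\<lambda>\<iota>. Z L (vtx a \<iota>) a z) \<partial>M) = fhat f r {}"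
proof -
  have "(\<integral>z. mlext f r (\<lambda>\<iota>. Z L (vtx a \<iota>) a z) \<partial>M)
    = (\<Sum>S\<in>Pow {..<r}. \<integral>z. fhat f r S * (\<Prod>\<iota>\<in>S. Z L (vtx a \<iota>) a z) \<partial>M)"
    unfolding mlext_def
    by (intro integral_sum_fin_mom fin_mom_cmult fin_mom_prod fin_mom_Z) (use vtx_in[OF a] in auto)
  also have "\<dots> = (\<Sum>S\<in>Pow {..<r}. if S = {} then fhat f r {} else 0)"
  proof (rule sum.cong[OF refl])
    fix S assume S: "S \<in> Pow {..<r}"
    show "(\<integral>z. fhat f r S * (\<Prod>\<iota>\<in>S. Z L (vtx a \<iota>) a z) \<partial>M) = (if S = {} then fhat f r {} else 0)"
    proof (cases "S = {}")
      case True
      then show ?thesis by (simp add: prob_space)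
    next
      case False
      then have "(\<integral>z. 1 * (\<Prod>\<iota>\<in>S. Z L (vtx a \<iota>) a z) \<partial>M) = 0"
        by (intro prod_orthogonal a fin_mom_const) (use S in auto)
      then show ?thesis using False by simp
    qed
  qed
  also have "\<dots> = fhat f r {}" by simp
  finally show ?thesis .
qed

text \<open>The derivative at \<open>i\<close> involves only the other members of \<open>a\<close>,
  which the future of the message from \<open>i\<close> to \<open>a\<close> cannot reach; so
  \<open>D L i a * A s i a\<close> is a test function for its increment.\<close>

lemma D_A_U_integral_0:
  assumes a: "a \<in> E" "i \<in> mems a" and s: "s < L"
  shows "(\<integral>z. D L i a z * (A s i a z * (W (Suc s) i a z - W s i a z)) \<partial>M) = 0"
proof -
  have "(\<integral>z. (D L i a z * A s i a z) * (W (Suc s) i a z - W s i a z) \<partial>M) = 0"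
  proof (rule W_increment_orthogonal)
    show "fin_mom M (\<lambda>z. D L i a z * A s i a z)"
      using a s by (intro fin_mom_mult fin_mom_D fin_mom_A) auto
    fix z z' assume z: "sim s i a z z'"
    have "D L i a z = D L i a z'"
    proof (rule D_cong[OF a])
      show "Z L k a z = Z L k a z'" if "k \<in> mems a - {i}" for k
        by (rule sim_Z_other[OF z a]) (use that s in auto)
    qed
    then show "D L i a z * A s i a z = D L i a z' * A s i a z'" using sim_A[OF z] by simp
  qed (use s in simp)
  then show ?thesis by (simp add: mult.assoc)
qed

text \<open>The node quantities up to time \<open>Suc s\<close> are computed from messages up to
  time \<open>s\<close>, so they are test functions for the increments of \<open>D\<close> at all
  times from \<open>s\<close> to \<open>L\<close>.\<close>

lemma An_Un_D_integral_eq: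
  assumes b: "b \<in> facs i" and s: "s < L"
  shows "(\<integral>z. An s i z * (Wn (Suc s) i z - Wn s i z) * D L i b z \<partial>M)
    = (\<integral>z. An s i z * (Wn (Suc s) i z - Wn s i z) * D s i b z \<partial>M)"
proof -
  let ?\<phi> = "\<lambda>z. An s i z * (Wn (Suc s) i z - Wn s i z)"
  have bE: "b \<in> E" "i \<in> mems b" using b by (auto simp: fac_iff)
  have \<phi>: "fin_mom M ?\<phi>" using s by (intro fin_mom_mult fin_mom_diff fin_mom_An fin_mom_Wn) auto
  have "(\<integral>z. ?\<phi> z * (D L i b z - D s i b z) \<partial>M) = 0"
  proof (rule D_increments_orthogonal[OF _ _ bE \<phi>])
    fix u k z z' assume u: "s \<le> u" "u < L" and k: "k \<in> mems b" "k \<noteq> i" and z: "sim u k b z z'"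
    have W: "Wn v i z = Wn v i z'" if "v \<le> Suc s" for v
      by (rule sim_Wn[OF z b k]) (use that u in auto)
    then have "An s i z = An s i z'" unfolding An_def by (intro hA_cong) auto
    then show "?\<phi> z = ?\<phi> z'" using W by simp
  qed (use s in auto)
  moreover have "(\<integral>z. ?\<phi> z * (D L i b z - D s i b z) \<partial>M)
    = (\<integral>z. ?\<phi> z * D L i b z \<partial>M) - (\<integral>z. ?\<phi> z * D s i b z \<partial>M)"
    unfolding right_diff_distrib[of "?\<phi> _"] using s
    by (intro Bochner_Integration.integral_diff fin_mom_integrable fin_mom_mult[OF \<phi>] fin_mom_D bE) auto
  ultimately show ?thesis by simp
qed

text \<open>The node sequence inherits the martingale property: its increment at \<open>s\<close>
  sums increments of \<open>D\<close> from \<open>s - 1\<close> to \<open>s\<close>, while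
  \<open>An s * Wn s\<close> uses messages up to time \<open>s - 1\<close> only. For
  \<open>s = 0\<close> the factor \<open>Wn 0\<close> vanishes.\<close>

lemma An_Wn_Un_integral_0:
  assumes s: "s < L"
  shows "(\<integral>z. An s i z * Wn s i z * (Wn (Suc s) i z - Wn s i z) \<partial>M) = 0"
proof (cases s)
  case 0
  then show ?thesis by (simp add: Wn_0)
next
  case (Suc t)
  let ?\<phi> = "\<lambda>z. An s i z * Wn s i z"
  have \<phi>: "fin_mom M ?\<phi>" using s by (intro fin_mom_mult fin_mom_An fin_mom_Wn) auto
  have b0: "(\<integral>z. ?\<phi> z * (D (Suc t) i b z - D t i b z) \<partial>M) = 0" if b: "b \<in> facs i" for b
  proof (rule D_increment[OF mart_step])
    fix k z z' assume k: "k \<in> mems b" "k \<noteq> i" and z: "sim t k b z z'"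
    have W: "Wn v i z = Wn v i z'" if "v \<le> s" for v
      by (rule sim_Wn[OF z b k]) (use that s Suc in auto)
    then have "An s i z = An s i z'" unfolding An_def by (intro hA_cong) auto
    then show "?\<phi> z = ?\<phi> z'" using W by simp
  qed (use b s Suc \<phi> in \<open>auto simp: fac_iff\<close>)
  have "(\<integral>z. (\<Sum>b\<in>facs i. ?\<phi> z * (D (Suc t) i b z - D t i b z)) \<partial>M)
    = (\<Sum>b\<in>facs i. \<integral>z. ?\<phi> z * (D (Suc t) i b z - D t i b z) \<partial>M)"
    by (intro integral_sum_fin_mom fin_mom_mult[OF \<phi>] fin_mom_diff fin_mom_D)
       (use s Suc in \<open>auto simp: fac_iff\<close>)
  also have "\<dots> = 0" using b0 by simp
  finally have "(\<integral>z. 1 / sqrt (real d) * (\<Sum>b\<in>facs i. ?\<phi> z * (D (Suc t) i b z - D t i b z)) \<partial>M) = 0"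
    by simp
  moreover have "?\<phi> z * (Wn (Suc s) i z - Wn s i z)
    = 1 / sqrt (real d) * (\<Sum>b\<in>facs i. ?\<phi> z * (D (Suc t) i b z - D t i b z))" for z
    unfolding Suc Wn_Suc sum_distrib_left[symmetric] sum_subtractf by (simp add: algebra_simps)
  ultimately show ?thesis by simp
qed

lemma Zn_minus_Z:
  "Zn t i z - Z t i a z = (\<Sum>s<t. An s i z * (Wn (Suc s) i z - Wn s i z)
     - A s i a z * (W (Suc s) i a z - W s i a z))"
  by (induction t) (simp_all add: Zn_0 Z_0 Zn_Suc Z_Suc)

text \<open>Summed over the factors at \<open>i\<close>, the terms \<open>D s i a\<close> give sqrt
  d times \<open>Wn (Suc s)\<close>, which is the increment plus \<open>Wn s\<close>. The increment
  produces the square and the part with \<open>Wn s\<close> integrates to 0.\<close>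

lemma first_order_vertex:
  "(\<Sum>a\<in>facs i. \<integral>z. D L i a z * (Zn L i z - Z L i a z) \<partial>M)
    = sqrt (real d) * (\<Sum>s<L. \<integral>z. An s i z * (Wn (Suc s) i z - Wn s i z)\<^sup>2 \<partial>M)"
proof -
  have aE: "a \<in> E" "i \<in> mems a" if "a \<in> facs i" for a using that by (auto simp: fac_iff)
  have fU: "fin_mom M (\<lambda>z. Wn (Suc s) i z - Wn s i z)" if "s < L" for s
    using that by (intro fin_mom_diff fin_mom_Wn) auto
  have fAU: "fin_mom M (\<lambda>z. An s i z * (Wn (Suc s) i z - Wn s i z))" if "s < L" for s
    using that by (intro fin_mom_mult fU fin_mom_An) auto
  have fAUm: "fin_mom M (\<lambda>z. A s i a z * (W (Suc s) i a z - W s i a z))" if "s < L" for s a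
    using that by (intro fin_mom_mult fin_mom_diff fin_mom_A fin_mom_W) auto
  have 1: "(\<integral>z. D L i a z * (Zn L i z - Z L i a z) \<partial>M)
    = (\<Sum>s<L. \<integral>z. An s i z * (Wn (Suc s) i z - Wn s i z) * D s i a z \<partial>M)" if a: "a \<in> facs i" for a
  proof -
    have fD: "fin_mom M (D L i a)" using aE[OF a] by (intro fin_mom_D) auto
    have "(\<integral>z. D L i a z * (Zn L i z - Z L i a z) \<partial>M)
      = (\<integral>z. (\<Sum>s<L. D L i a z * (An s i z * (Wn (Suc s) i z - Wn s i z))
          - D L i a z * (A s i a z * (W (Suc s) i a z - W s i a z))) \<partial>M)"
      by (simp add: Zn_minus_Z sum_distrib_left right_diff_distrib)
    also have "\<dots> = (\<Sum>s<L. \<integral>z. D L i a z * (An s i z * (Wn (Suc s) i z - Wn s i z))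
          - D L i a z * (A s i a z * (W (Suc s) i a z - W s i a z)) \<partial>M)"
      by (intro integral_sum_fin_mom fin_mom_diff fin_mom_mult[OF fD] fAU fAUm) auto
    also have "\<dots> = (\<Sum>s<L. \<integral>z. An s i z * (Wn (Suc s) i z - Wn s i z) * D s i a z \<partial>M)"
    proof (rule sum.cong[OF refl])
      fix s assume "s \<in> {..<L}"
      then have s: "s < L" by simp
      have "(\<integral>z. D L i a z * (An s i z * (Wn (Suc s) i z - Wn s i z))
          - D L i a z * (A s i a z * (W (Suc s) i a z - W s i a z)) \<partial>M)
        = (\<integral>z. D L i a z * (An s i z * (Wn (Suc s) i z - Wn s i z)) \<partial>M)
          - (\<integral>z. D L i a z * (A s i a z * (W (Suc s) i a z - W s i a z)) \<partial>M)"
        by (intro Bochner_Integration.integral_diff fin_mom_integrable fin_mom_mult[OF fD] fAU fAUm s)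
      also have "\<dots> = (\<integral>z. An s i z * (Wn (Suc s) i z - Wn s i z) * D L i a z \<partial>M)"
        using D_A_U_integral_0[OF aE[OF a] s] by (simp add: mult_ac)
      also have "\<dots> = (\<integral>z. An s i z * (Wn (Suc s) i z - Wn s i z) * D s i a z \<partial>M)"
        by (rule An_Un_D_integral_eq[OF a s])
      finally show "(\<integral>z. D L i a z * (An s i z * (Wn (Suc s) i z - Wn s i z))
          - D L i a z * (A s i a z * (W (Suc s) i a z - W s i a z)) \<partial>M)
        = (\<integral>z. An s i z * (Wn (Suc s) i z - Wn s i z) * D s i a z \<partial>M)" .
    qed
    finally show ?thesis .
  qed
  have 2: "(\<Sum>a\<in>facs i. \<integral>z. An s i z * (Wn (Suc s) i z - Wn s i z) * D s i a z \<partial>M)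
    = sqrt (real d) * (\<integral>z. An s i z * (Wn (Suc s) i z - Wn s i z)\<^sup>2 \<partial>M)" if s: "s < L" for s
  proof -
    have "(\<Sum>a\<in>facs i. \<integral>z. An s i z * (Wn (Suc s) i z - Wn s i z) * D s i a z \<partial>M)
      = (\<integral>z. (\<Sum>a\<in>facs i. An s i z * (Wn (Suc s) i z - Wn s i z) * D s i a z) \<partial>M)"
      by (rule integral_sum_fin_mom[symmetric])
         (use s aE in \<open>auto intro!: fin_mom_mult[OF fAU] fin_mom_D\<close>)
    also have "(\<lambda>z. \<Sum>a\<in>facs i. An s i z * (Wn (Suc s) i z - Wn s i z) * D s i a z)
      = (\<lambda>z. sqrt (real d) * (An s i z * (Wn (Suc s) i z - Wn s i z)\<^sup>2
          + An s i z * Wn s i z * (Wn (Suc s) i z - Wn s i z)))"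
    proof
      fix z
      have "(\<Sum>a\<in>facs i. D s i a z) = sqrt (real d) * Wn (Suc s) i z"
        using d2 by (simp add: Wn_Suc)
      with sum_distrib_left[of "An s i z * (Wn (Suc s) i z - Wn s i z)" "\<lambda>a. D s i a z" "facs i"] show "(\<Sum>a\<in>facs i. An s i z * (Wn (Suc s) i z - Wn s i z) * D s i a z)
        = sqrt (real d) * (An s i z * (Wn (Suc s) i z - Wn s i z)\<^sup>2
          + An s i z * Wn s i z * (Wn (Suc s) i z - Wn s i z))"
        by (simp add: power2_eq_square algebra_simps del: sum_subtractf)
    qed
    also have "(\<integral>z. sqrt (real d) * (An s i z * (Wn (Suc s) i z - Wn s i z)\<^sup>2
          + An s i z * Wn s i z * (Wn (Suc s) i z - Wn s i z)) \<partial>M)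
      = sqrt (real d) * (\<integral>z. An s i z * (Wn (Suc s) i z - Wn s i z)\<^sup>2
          + An s i z * Wn s i z * (Wn (Suc s) i z - Wn s i z) \<partial>M)"
      by (rule integral_mult_right_zero)
    also have "(\<integral>z. An s i z * (Wn (Suc s) i z - Wn s i z)\<^sup>2
          + An s i z * Wn s i z * (Wn (Suc s) i z - Wn s i z) \<partial>M)
      = (\<integral>z. An s i z * (Wn (Suc s) i z - Wn s i z)\<^sup>2 \<partial>M)
          + (\<integral>z. An s i z * Wn s i z * (Wn (Suc s) i z - Wn s i z) \<partial>M)"
      using s by (intro Bochner_Integration.integral_add fin_mom_integrable fin_mom_mult fin_mom_power
          fU fin_mom_An fin_mom_Wn) auto
    also have "\<dots> = (\<integral>z. An s i z * (Wn (Suc s) i z - Wn s i z)\<^sup>2 \<partial>M)"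
      using An_Wn_Un_integral_0[OF s] by simp
    finally show ?thesis .
  qed
  have "(\<Sum>a\<in>facs i. \<integral>z. D L i a z * (Zn L i z - Z L i a z) \<partial>M)
    = (\<Sum>a\<in>facs i. \<Sum>s<L. \<integral>z. An s i z * (Wn (Suc s) i z - Wn s i z) * D s i a z \<partial>M)"
    by (rule sum.cong[OF refl 1])
  also have "\<dots> = (\<Sum>s<L. \<Sum>a\<in>facs i. \<integral>z. An s i z * (Wn (Suc s) i z - Wn s i z) * D s i a z \<partial>M)"
    by (rule sum.swap)
  also have "\<dots> = (\<Sum>s<L. sqrt (real d) * (\<integral>z. An s i z * (Wn (Suc s) i z - Wn s i z)\<^sup>2 \<partial>M))"
    by (rule sum.cong) (use 2 in auto)
  finally show ?thesis by (simp add: sum_distrib_left)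
qed

section \<open>Double counting of incidences and the average over all factors\<close>

lemma sum_factors_swap:
  "(\<Sum>a\<in>E. \<Sum>\<iota><r. g a (vtx a \<iota>)) = (\<Sum>i\<in>V. \<Sum>a\<in>facs i. g a i)"
proof -
  have "(\<Sum>a\<in>E. \<Sum>\<iota><r. g a (vtx a \<iota>)) = (\<Sum>a\<in>E. \<Sum>i\<in>{i\<in>V. i \<in> mems a}. g a i)"
  proof (rule sum.cong[OF refl])
    fix a assume a: "a \<in> E"
    have "{i\<in>V. i \<in> mems a} = mems a" using vtx_in[OF a] by auto
    then show "(\<Sum>\<iota><r. g a (vtx a \<iota>)) = (\<Sum>i\<in>{i\<in>V. i \<in> mems a}. g a i)"
      using sum.reindex[OF vtx_inj[OF a], of "g a"] by simp
  qed
  also have "\<dots> = (\<Sum>i\<in>V. \<Sum>a\<in>{a\<in>E. i \<in> mems a}. g a i)"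
    by (rule sum.swap_restrict[OF finite_E finite_V])
  also have "\<dots> = (\<Sum>i\<in>V. \<Sum>a\<in>facs i. g a i)"
    by (intro sum.cong refl) (auto simp: fac_def)
  finally show ?thesis .
qed

lemma card_E: "card E * r = d * card V"
proof -
  have "(\<Sum>a\<in>E. \<Sum>\<iota><r. 1) = (\<Sum>i\<in>V. \<Sum>a\<in>facs i. (1::nat))"
    using sum_factors_swap[of "\<lambda>a i. 1 :: nat"] .
  then show ?thesis using card_facs by (simp add: mult.commute)
qed

lemma first_order_total:
  "(\<Sum>a\<in>E. \<Sum>\<iota><r. \<integral>z. D L (vtx a \<iota>) a z * (Zn L (vtx a \<iota>) z - Z L (vtx a \<iota>) a z) \<partial>M)
    = sqrt (real d) * (\<Sum>s<L. \<Sum>i\<in>V. \<integral>z. An s i z * (Wn (Suc s) i z - Wn s i z)\<^sup>2 \<partial>M)"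
  by (simp add: sum_factors_swap[of "\<lambda>a i. \<integral>z. D L i a z * (Zn L i z - Z L i a z) \<partial>M"]
      first_order_vertex sum_distrib_left[symmetric] sum.swap[of _ V])

lemma taylor_factor:
  assumes a: "a \<in> E"
    and P1: "\<And>m l i. l < L \<Longrightarrow> i \<in> V \<Longrightarrow> a \<in> facs i \<Longrightarrow>
      (\<integral>z. \<bar>An l i z - A l i a z\<bar> ^ m \<partial>M) \<le> Cm m * real d powr (- real m / 2)"
  shows "\<bar>(\<integral>z. mlext f r (\<lambda>\<iota>. Zn L (vtx a \<iota>) z) \<partial>M) - fhat f r {}
     - (\<Sum>\<iota><r. \<integral>z. D L (vtx a \<iota>) a z * (Zn L (vtx a \<iota>) z - Z L (vtx a \<iota>) a z) \<partial>M)\<bar>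
    \<le> bd_taylor f r \<delta> K Cm L / real d"
proof -
  define y where "y \<iota> z = Z L (vtx a \<iota>) a z" for \<iota> z
  define e where "e \<iota> z = sqrt (real d) * (Zn L (vtx a \<iota>) z - Z L (vtx a \<iota>) a z)" for \<iota> z
  define \<epsilon> where "\<epsilon> = 1 / sqrt (real d)"
  have \<epsilon>: "0 \<le> \<epsilon>" "\<epsilon> \<le> 1" using d2 by (auto simp: \<epsilon>_def)
  have \<epsilon>2: "\<epsilon>\<^sup>2 = 1 / real d" by (simp add: \<epsilon>_def power_divide)
  have Zn: "Zn L (vtx a \<iota>) z = y \<iota> z + \<epsilon> * e \<iota> z" for \<iota> z
    using d2 by (simp add: y_def e_def \<epsilon>_def)
  have in_V: "vtx a \<iota> \<in> V" "a \<in> facs (vtx a \<iota>)" if "\<iota> < r" for \<iota>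
    using vtx_in[OF a that] a that by (auto simp: fac_iff)
  have yb: "mom_bdd M (bd_Z f r \<delta> K L) (y \<iota>)" if "\<iota> < r" for \<iota>
    using mom_bdd_W_Z[OF order_refl in_V[OF that]] by (simp add: y_def[abs_def])
  have eb: "mom_bdd M (bd_Zdiff f r \<delta> K Cm L) (e \<iota>)" if "\<iota> < r" for \<iota>
    unfolding e_def[abs_def] by (rule mom_bdd_Z_diff[OF order_refl in_V[OF that] P1]) (use in_V[OF that] in auto)
  have D: "mlderiv f r \<iota> (\<lambda>\<kappa>. y \<kappa> z) = D L (vtx a \<iota>) a z" if "\<iota> < r" for \<iota> z
    by (simp add: D_def Dpart_def y_def idx_vtx[OF a that])
  \<comment> \<open>\<open>R\<close> dominates all messages and all rescaled deviations of the
    factor, so its \<open>r\<close>-th moment controls the whole remainder.\<close>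
  define R where "R z = 1 + (\<Sum>\<kappa><r. \<bar>y \<kappa> z\<bar>) + (\<Sum>\<kappa><r. \<bar>e \<kappa> z\<bar>)" for z
  have R: "mom_bdd M (bd_add (bd_add (\<lambda>m. 1) (bd_sum r (bd_Z f r \<delta> K L))) (bd_sum r (bd_Zdiff f r \<delta> K Cm L))) R"
    unfolding R_def[abs_def]
    by (intro mom_bdd_bd_add[OF mom_bdd_one_plus_sum_abs mom_bdd_bd_sum] mom_bdd_abs yb eb) auto
  define X where "X z = mlext f r (\<lambda>\<iota>. Zn L (vtx a \<iota>) z) - mlext f r (\<lambda>\<iota>. y \<iota> z)
    - (\<Sum>\<iota><r. D L (vtx a \<iota>) a z * (\<epsilon> * e \<iota> z))" for z
  have X: "\<bar>X z\<bar> \<le> \<epsilon>\<^sup>2 * fhat_l1 f r * 2 ^ r * R z ^ r" for z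
    using mlext_taylor_le[OF \<epsilon>, of f r "\<lambda>\<iota>. y \<iota> z" "\<lambda>\<iota>. e \<iota> z", unfolded power_mult_distrib]
    unfolding X_def Zn R_def by (simp add: D mult.assoc)
  have fD: "fin_mom M (D L (vtx a \<iota>) a)" for \<iota> using a by (intro fin_mom_D) auto
  have fy: "fin_mom M (y \<iota>)" and fe: "fin_mom M (e \<iota>)" if "\<iota> < r" for \<iota>
    using yb eb that fin_momI by blast+
  have fZn: "fin_mom M (Zn L (vtx a \<iota>))" if "\<iota> < r" for \<iota>
    unfolding Zn by (intro fin_mom_add fin_mom_cmult fy fe that)
  have f1: "fin_mom M (\<lambda>z. mlext f r (\<lambda>\<iota>. Zn L (vtx a \<iota>) z))"
    unfolding mlext_def by (intro fin_mom_sum fin_mom_cmult fin_mom_prod fZn) auto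
  have f2: "fin_mom M (\<lambda>z. mlext f r (\<lambda>\<iota>. y \<iota> z))"
    unfolding mlext_def by (intro fin_mom_sum fin_mom_cmult fin_mom_prod fy) auto
  have f3: "fin_mom M (\<lambda>z. D L (vtx a \<iota>) a z * (\<epsilon> * e \<iota> z))" if "\<iota> < r" for \<iota>
    by (intro fin_mom_mult fD fin_mom_cmult fe that)
  have f4: "fin_mom M (\<lambda>z. \<Sum>\<iota><r. D L (vtx a \<iota>) a z * (\<epsilon> * e \<iota> z))"
    by (intro fin_mom_sum f3) auto
  have "(\<integral>z. X z \<partial>M) = (\<integral>z. mlext f r (\<lambda>\<iota>. Zn L (vtx a \<iota>) z) \<partial>M) - (\<integral>z. mlext f r (\<lambda>\<iota>. y \<iota> z) \<partial>M)
    - (\<integral>z. (\<Sum>\<iota><r. D L (vtx a \<iota>) a z * (\<epsilon> * e \<iota> z)) \<partial>M)"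
    unfolding X_def using f1 f2 f4 by (simp add: fin_mom_integrable)
  also have "(\<integral>z. mlext f r (\<lambda>\<iota>. y \<iota> z) \<partial>M) = fhat f r {}"
    unfolding y_def by (rule integral_mlext_Z[OF a])
  also have "(\<integral>z. (\<Sum>\<iota><r. D L (vtx a \<iota>) a z * (\<epsilon> * e \<iota> z)) \<partial>M)
    = (\<Sum>\<iota><r. \<integral>z. D L (vtx a \<iota>) a z * (\<epsilon> * e \<iota> z) \<partial>M)"
    by (rule integral_sum_fin_mom) (auto intro: f3)
  also have "(\<lambda>\<iota> z. D L (vtx a \<iota>) a z * (\<epsilon> * e \<iota> z))
    = (\<lambda>\<iota> z. D L (vtx a \<iota>) a z * (Zn L (vtx a \<iota>) z - Z L (vtx a \<iota>) a z))"
    by (simp add: Zn y_def)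
  finally have IX: "(\<integral>z. X z \<partial>M) = (\<integral>z. mlext f r (\<lambda>\<iota>. Zn L (vtx a \<iota>) z) \<partial>M) - fhat f r {}
     - (\<Sum>\<iota><r. \<integral>z. D L (vtx a \<iota>) a z * (Zn L (vtx a \<iota>) z - Z L (vtx a \<iota>) a z) \<partial>M)" .
  have "\<bar>\<integral>z. X z \<partial>M\<bar> \<le> (\<integral>z. \<bar>X z\<bar> \<partial>M)" by (rule integral_abs_bound)
  also have "\<dots> \<le> (\<integral>z. \<epsilon>\<^sup>2 * fhat_l1 f r * 2 ^ r * R z ^ r \<partial>M)"
  proof (rule integral_mono[OF _ _ X])
    have "fin_mom M X" unfolding X_def[abs_def] by (intro fin_mom_diff f1 f2 f4)
    then show "integrable M (\<lambda>z. \<bar>X z\<bar>)" using fin_mom_integrable by (intro integrable_abs)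
    show "integrable M (\<lambda>z. \<epsilon>\<^sup>2 * fhat_l1 f r * 2 ^ r * R z ^ r)"
      using mom_bdd_power_integral(1)[OF R] by simp
  qed
  also have "\<dots> = \<epsilon>\<^sup>2 * fhat_l1 f r * 2 ^ r * (\<integral>z. R z ^ r \<partial>M)" by (rule integral_mult_right_zero)
  also have "\<dots> \<le> \<epsilon>\<^sup>2 * fhat_l1 f r * 2 ^ r *
     bd_add (bd_add (\<lambda>m. 1) (bd_sum r (bd_Z f r \<delta> K L))) (bd_sum r (bd_Zdiff f r \<delta> K Cm L)) r"
    by (rule mult_left_mono[OF mom_bdd_power_integral(2)[OF R]]) (simp add: fhat_l1_nonneg)
  also have "\<dots> = bd_taylor f r \<delta> K Cm L / real d"
    by (simp add: bd_taylor_def \<epsilon>2)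
  finally show ?thesis unfolding IX .
qed

lemma average_expansion:
  assumes r: "r > 0" and V: "V \<noteq> {}"
    and P1: "\<And>m l i a. l < L \<Longrightarrow> i \<in> V \<Longrightarrow> a \<in> facs i \<Longrightarrow>
      (\<integral>z. \<bar>An l i z - A l i a z\<bar> ^ m \<partial>M) \<le> Cm m * real d powr (- real m / 2)"
  shows "\<bar>1 / (real d / real r * real (card V)) *
        (\<Sum>a\<in>E. \<integral>z. mlext f r (\<lambda>\<iota>. Zn L (vtx a \<iota>) z) \<partial>M)
      - (fhat f r {} + real r / sqrt (real d) *
          (\<Sum>s<L. 1 / real (card V) * (\<Sum>i\<in>V. \<integral>z. An s i z * (Wn (Suc s) i z - Wn s i z)\<^sup>2 \<partial>M)))\<bar>
      \<le> bd_taylor f r \<delta> K Cm L / real d"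
proof -
  define N where "N = real d / real r * real (card V)"
  define Y where "Y a = (\<integral>z. mlext f r (\<lambda>\<iota>. Zn L (vtx a \<iota>) z) \<partial>M)" for a
  define G where "G a = (\<Sum>\<iota><r. \<integral>z. D L (vtx a \<iota>) a z * (Zn L (vtx a \<iota>) z - Z L (vtx a \<iota>) a z) \<partial>M)" for a
  define J where "J = (\<Sum>s<L. \<Sum>i\<in>V. \<integral>z. An s i z * (Wn (Suc s) i z - Wn s i z)\<^sup>2 \<partial>M)"
  define B where "B = bd_taylor f r \<delta> K Cm L / real d"
  have V0: "real (card V) > 0" using V finite_V by (simp add: card_gt_0_iff)
  have d0: "real d > 0" using d2 by simp
  have N0: "N > 0" using r V0 d0 by (simp add: N_def)
  have "real (card E) * real r = real d * real (card V)"
    using card_E by (metis of_nat_mult)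
  then have NE: "real (card E) = N" using r by (simp add: N_def field_simps)
  have G: "(\<Sum>a\<in>E. G a) = sqrt (real d) * J"
    unfolding G_def J_def by (rule first_order_total)
  have "\<bar>(\<Sum>a\<in>E. Y a - fhat f r {} - G a)\<bar> \<le> (\<Sum>a\<in>E. \<bar>Y a - fhat f r {} - G a\<bar>)" by (rule sum_abs)
  also have "\<dots> \<le> (\<Sum>a\<in>E. B)"
    unfolding Y_def G_def B_def by (intro sum_mono taylor_factor P1) auto
  also have "\<dots> = N * B" by (simp add: NE)
  also have "(\<Sum>a\<in>E. Y a - fhat f r {} - G a) = (\<Sum>a\<in>E. Y a) - N * fhat f r {} - sqrt (real d) * J"
    by (simp add: sum_subtractf G NE)
  finally have b: "\<bar>(\<Sum>a\<in>E. Y a) - N * fhat f r {} - sqrt (real d) * J\<bar> \<le> N * B" .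
  \<comment> \<open>With \<open>N = d n / r\<close>, where \<open>n\<close> is the number of
    variables, the factor \<open>sqrt d / N\<close> is the \<open>r / (n sqrt d)\<close> of the
    statement.\<close>
  have q: "1 / N * sqrt (real d) = real r / sqrt (real d) * (1 / real (card V))"
    using r V0 d0 by (simp add: N_def field_simps)
  have "1 / N * (\<Sum>a\<in>E. Y a) - (fhat f r {} + real r / sqrt (real d) * (1 / real (card V) * J))
    = 1 / N * (\<Sum>a\<in>E. Y a) - 1 / N * (N * fhat f r {}) - (1 / N * sqrt (real d)) * J"
    unfolding q using N0 by (simp add: mult.assoc)
  also have "\<dots> = 1 / N * ((\<Sum>a\<in>E. Y a) - N * fhat f r {} - sqrt (real d) * J)"
    by (simp add: right_diff_distrib)
  also have "\<bar>\<dots>\<bar> \<le> 1 / N * (N * B)"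
    unfolding abs_mult using N0 b by (intro mult_mono) auto
  also have "\<dots> = B" using N0 by simp
  finally show ?thesis
    unfolding N_def Y_def J_def B_def by (simp only: sum_distrib_left)
qed

end

theorem mainTheorem2:
  fixes r :: nat and f :: "(nat \<Rightarrow> real) \<Rightarrow> real" and \<delta> K :: real and Cm :: "nat \<Rightarrow> real"
  assumes "r \<ge> 2"
    and "\<forall>x\<in>cube r. f x = 0 \<or> f x = 1"
    and "\<forall>S. S \<subseteq> {..<r} \<and> card S = 1 \<longrightarrow> fhat f r S = 0"
    and "\<delta> > 0" and "K > 0"
  shows "\<exists>C d0. \<forall>d V E vtx F Fto.
     let L = nat \<lfloor>1 / \<delta>\<rfloor>; M = gauss_init \<delta> V in
     d \<ge> d0 \<and> V \<noteq> {} \<and> index_regular r d V E vtx \<and> girth_ge r E vtx (4 * L + 4) \<and>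
     good_nonlin K L F \<and> good_nonlin K L Fto \<and>
     (\<forall>l<L. \<forall>i\<in>V. \<forall>a\<in>fac r E vtx i. \<forall>m::nat.
        (\<integral>z0. \<bar>Anode f r E vtx d F Fto z0 l i - Amsg f r E vtx d Fto z0 l i a\<bar> ^ m \<partial>M)
          \<le> Cm m * real d powr (- real m / 2))
     \<longrightarrow>
     \<bar>1 / (real d / real r * real (card V)) *
        (\<Sum>a\<in>E. \<integral>z0. mlext f r (\<lambda>\<iota>. znode f r E vtx d F Fto z0 L (vtx a \<iota>)) \<partial>M)
      - (fhat f r {} + real r / sqrt (real d) *
          (\<Sum>l<L. 1 / real (card V) *
             (\<Sum>i\<in>V. \<integral>z0. Anode f r E vtx d F Fto z0 l i *
                         (unode f r E vtx d Fto z0 (Suc l) i)\<^sup>2 \<partial>M)))\<bar>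
      \<le> C / real d"
proof -
  define L where "L = nat \<lfloor>1 / \<delta>\<rfloor>"
  have main: "\<bar>1 / (real d / real r * real (card V)) *
        (\<Sum>a\<in>E. \<integral>z0. mlext f r (\<lambda>\<iota>. znode f r E vtx d F Fto z0 L (vtx a \<iota>)) \<partial>gauss_init \<delta> V)
      - (fhat f r {} + real r / sqrt (real d) *
          (\<Sum>l<L. 1 / real (card V) *
             (\<Sum>i\<in>V. \<integral>z0. Anode f r E vtx d F Fto z0 l i *
                         (unode f r E vtx d Fto z0 (Suc l) i)\<^sup>2 \<partial>gauss_init \<delta> V)))\<bar>
      \<le> bd_taylor f r \<delta> K Cm L / real d"
    if h: "d \<ge> 2" "V \<noteq> {}" "index_regular r d V E vtx" "girth_ge r E vtx (4 * L + 4)"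
      "good_nonlin K L F" "good_nonlin K L Fto"
      and P1: "\<And>l i a m. l < L \<Longrightarrow> i \<in> V \<Longrightarrow> a \<in> fac r E vtx i \<Longrightarrow>
        (\<integral>z0. \<bar>Anode f r E vtx d F Fto z0 l i - Amsg f r E vtx d Fto z0 l i a\<bar> ^ m \<partial>gauss_init \<delta> V)
          \<le> Cm m * real d powr (- real m / 2)"
    for d V E vtx F Fto
  proof -
    interpret message_passing r f \<delta> K L d V E vtx F Fto
      by unfold_locales (use assms h in auto)
    show ?thesis
      using average_expansion[of Cm] assms(1) h(2) P1
      by (simp only: Zn_def[symmetric] Anode_eq Amsg_eq unode_eq) simp
  qed
  show ?thesis
    unfolding Let_def L_def[symmetric]
    \<comment> \<open>\<open>L\<close> is determined by \<open>\<delta>\<close>, so the constant is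
      fixed before \<open>d\<close> and the hypergraph. The threshold 2 keeps the message normaliser
      \<open>sqrt (d - 1)\<close> positive.\<close>
    by (intro exI[of _ "bd_taylor f r \<delta> K Cm L"] exI[of _ 2] allI impI main) auto
qed

end
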